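(* $\alpha$-Simultaneous Feedback Vertex Set is solvable in time $\mathcal{O}^\star(23^{\alpha k})$.
   Context: An $\alpha$-edge-colored graph is $G=(V,\cup_{i=1}^{\alpha}E_i)$ with edge set partitioned into $\alpha$ color classes; $G_i=(V,E_i)$. In the $\alpha$-Simultaneous Feedback Vertex Set ($\alpha$-SimFVS) problem, given an $\alpha$-colored (multi)graph $G$ and a positive integer $k$ (the parameter), one asks whether there is $S\subseteq V(G)$ with $|S|\le k$ such that $G_i\setminus S$ is a forest for every $1\le i\le\alpha$. The notation $\mathcal{O}^\star(f)$ suppresses polynomial factors in the input size. *)

theory Defs
  imports Complex_Main "HOL-Computational_Algebra.Polynomial"
begin

section \<open>Edge-coloured multigraphs and simultaneous feedback vertex sets\<close>

text \<open>
  Edges are named objects, so that parallel edges are distinct edges with the same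
  set of endpoints; a loop is an edge with a single endpoint. Since every edge has exactly one
  colour, the edge set is partitioned into the colour classes. The colours are
  \<open>0, \<dots>, \<alpha> - 1\<close>.
\<close>

record ('v, 'e) cgraph =
  verts :: "'v set"
  edges :: "'e set"
  ends :: "'e \<Rightarrow> 'v set"
  colour :: "'e \<Rightarrow> nat"

definition wf_cgraph :: "nat \<Rightarrow> ('v, 'e) cgraph \<Rightarrow> bool" where
  "wf_cgraph \<alpha> G \<longleftrightarrow> finite (verts G) \<and> finite (edges G) \<and>
     (\<forall>e \<in> edges G. (\<exists>u \<in> verts G. \<exists>v \<in> verts G. ends G e = {u, v}) \<and> colour G e < \<alpha>)"

definition colour_class :: "('v, 'e) cgraph \<Rightarrow> nat \<Rightarrow> ('v, 'e) cgraph" where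
  "colour_class G i = G\<lparr>edges := {e \<in> edges G. colour G e = i}\<rparr>"

definition delete_verts :: "('v, 'e) cgraph \<Rightarrow> 'v set \<Rightarrow> ('v, 'e) cgraph" where
  "delete_verts G S = G\<lparr>verts := verts G - S, edges := {e \<in> edges G. ends G e \<inter> S = {}}\<rparr>"

text \<open>
  A cycle consists of distinct vertices \<open>v\<^sub>0, \<dots>, v\<^sub>n\<^sub>-\<^sub>1\<close> and distinct edges
  \<open>e\<^sub>0, \<dots>, e\<^sub>n\<^sub>-\<^sub>1\<close>, where \<open>e\<^sub>i\<close> joins \<open>v\<^sub>i\<close> to its cyclic successor. Loops are the cycles with
  \<open>n = 1\<close>, pairs of parallel edges those with \<open>n = 2\<close>.
\<close>

definition is_cycle :: "('v, 'e) cgraph \<Rightarrow> 'v list \<Rightarrow> 'e list \<Rightarrow> bool" where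
  "is_cycle G vs es \<longleftrightarrow>
     es \<noteq> [] \<and> length vs = length es \<and> distinct vs \<and> distinct es \<and>
     set vs \<subseteq> verts G \<and> set es \<subseteq> edges G \<and>
     (\<forall>i < length es. ends G (es ! i) = {vs ! i, vs ! (Suc i mod length es)})"

definition forest :: "('v, 'e) cgraph \<Rightarrow> bool" where
  "forest G \<longleftrightarrow> (\<nexists>vs es. is_cycle G vs es)"

definition sim_fvs :: "nat \<Rightarrow> ('v, 'e) cgraph \<Rightarrow> 'v set \<Rightarrow> bool" where
  "sim_fvs \<alpha> G S \<longleftrightarrow> S \<subseteq> verts G \<and> (\<forall>i < \<alpha>. forest (delete_verts (colour_class G i) S))"


section \<open>Problem instances\<close>

text \<open>
  An instance presents the graph on the vertices \<open>0, \<dots>, n - 1\<close> by a list of coloured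
  edges \<open>(i, u, v)\<close>: colour \<open>i\<close>, endpoints \<open>u\<close> and \<open>v\<close>. The edges are named by their positions,
  so repeated entries are parallel edges.
\<close>

record instance_data =
  num_colours :: nat
  param :: nat
  num_verts :: nat
  edge_list :: "(nat \<times> nat \<times> nat) list"

definition graph_of :: "instance_data \<Rightarrow> (nat, nat) cgraph" where
  "graph_of I = \<lparr>verts = {..<num_verts I}, edges = {..<length (edge_list I)},
     ends = (\<lambda>j. case edge_list I ! j of (i, u, v) \<Rightarrow> {u, v}),
     colour = (\<lambda>j. fst (edge_list I ! j))\<rparr>"

definition simfvs_instances :: "instance_data set" where
  "simfvs_instances =
     {I. num_colours I \<ge> 1 \<and> param I \<ge> 1 \<and> wf_cgraph (num_colours I) (graph_of I)}"

definition simfvs :: "instance_data \<Rightarrow> bool" where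
  "simfvs I \<longleftrightarrow> (\<exists>S. sim_fvs (num_colours I) (graph_of I) S \<and> card S \<le> param I)"

text \<open>
  The parameter is not counted: numbers of vertices, edges and colours alone bound the input size.
\<close>

definition instance_size :: "instance_data \<Rightarrow> nat" where
  "instance_size I = num_verts I + length (edge_list I) + num_colours I"


section \<open>Computation model: a first-order functional language on binary trees\<close>

text \<open>
  Jones's first-order language (Computability and Complexity from a Programming Perspective,
  1997). Data are binary trees; the only operations build a pair, take one apart and test
  for the leaf. Hence there is no unit-cost arithmetic, and no operation inspects or copies
  more than one node: a tree is a pointer to an immutable, possibly shared cell. Each
  evaluated expression node costs one step. For a fixed program a run of \<open>t\<close> steps takes
  \<open>O(t)\<close> steps on a pointer machine or a random access machine with \<open>O(log t)\<close>-bit words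
  (plus the input size), so exponential factors in running times are meaningful.
\<close>

datatype tree = Leaf | Node tree tree

datatype expr =
    Var nat
  | ENil
  | ECons expr expr
  | EHd expr
  | ETl expr
  | EIf expr expr expr
  | Call nat "expr list"

text \<open>
  A program is a list of function bodies; \<open>Call f\<close> refers to the body at position \<open>f\<close>, in which
  \<open>Var i\<close> is the \<open>i\<close>-th argument.
\<close>

type_synonym prog = "expr list"

primrec left :: "tree \<Rightarrow> tree" where
  "left Leaf = Leaf"
| "left (Node a b) = a"

primrec right :: "tree \<Rightarrow> tree" where
  "right Leaf = Leaf"
| "right (Node a b) = b"

text \<open>
  \<open>eval P env e t v\<close>: in environment \<open>env\<close>, evaluation of \<open>e\<close> terminates with value \<open>v\<close> after
  \<open>t\<close> steps. Evaluation is call-by-value and deterministic.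
\<close>

inductive eval :: "prog \<Rightarrow> tree list \<Rightarrow> expr \<Rightarrow> nat \<Rightarrow> tree \<Rightarrow> bool"
  and evals :: "prog \<Rightarrow> tree list \<Rightarrow> expr list \<Rightarrow> nat \<Rightarrow> tree list \<Rightarrow> bool"
  for P :: prog where
  eval_Var: "i < length env \<Longrightarrow> eval P env (Var i) 1 (env ! i)"
| eval_Nil: "eval P env ENil 1 Leaf"
| eval_Cons: "eval P env a s x \<Longrightarrow> eval P env b t y \<Longrightarrow>
    eval P env (ECons a b) (Suc (s + t)) (Node x y)"
| eval_Hd: "eval P env a t x \<Longrightarrow> eval P env (EHd a) (Suc t) (left x)"
| eval_Tl: "eval P env a t x \<Longrightarrow> eval P env (ETl a) (Suc t) (right x)"
| eval_If_True: "eval P env a s x \<Longrightarrow> x \<noteq> Leaf \<Longrightarrow> eval P env b t y \<Longrightarrow>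
    eval P env (EIf a b c) (Suc (s + t)) y"
| eval_If_False: "eval P env a s Leaf \<Longrightarrow> eval P env c t y \<Longrightarrow>
    eval P env (EIf a b c) (Suc (s + t)) y"
| eval_Call: "evals P env as s xs \<Longrightarrow> f < length P \<Longrightarrow> eval P xs (P ! f) t y \<Longrightarrow>
    eval P env (Call f as) (Suc (s + t)) y"
| evals_Nil: "evals P env [] 0 []"
| evals_Cons: "eval P env a s x \<Longrightarrow> evals P env as t xs \<Longrightarrow>
    evals P env (a # as) (s + t) (x # xs)"

lemma eval_deterministic:
  "eval P env e t v \<Longrightarrow> eval P env e t' v' \<Longrightarrow> t = t' \<and> v = v'"
  "evals P env es t vs \<Longrightarrow> evals P env es t' vs' \<Longrightarrow> t = t' \<and> vs = vs'"
proof (induction arbitrary: t' v' and t' vs' rule: eval_evals.inducts)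
  case (eval_Var i env) from eval_Var(2) show ?case by cases auto
next
  case (eval_Nil env) from eval_Nil show ?case by cases auto
next
  case eval_Cons from eval_Cons(5) show ?case by cases (use eval_Cons in blast)
next
  case eval_Hd from eval_Hd(3) show ?case by cases (use eval_Hd in blast)
next
  case eval_Tl from eval_Tl(3) show ?case by cases (use eval_Tl in blast)
next
  case eval_If_True from eval_If_True(6) show ?case by cases (use eval_If_True in blast)+
next
  case eval_If_False from eval_If_False(5) show ?case by cases (use eval_If_False in blast)+
next
  case eval_Call from eval_Call(6) show ?case by cases (use eval_Call in blast)
next
  case evals_Nil from evals_Nil show ?case by cases auto
next
  case evals_Cons from evals_Cons(5) show ?case by cases (use evals_Cons in blast)
qed

text \<open>The body at position \<open>0\<close> is the main function; it receives the input as only argument.\<close>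

definition runs :: "prog \<Rightarrow> tree \<Rightarrow> nat \<Rightarrow> tree \<Rightarrow> bool" where
  "runs P x t y \<longleftrightarrow> eval P [x] (Call 0 [Var 0]) t y"

definition bool_tree :: "bool \<Rightarrow> tree" where
  "bool_tree b = (if b then Node Leaf Leaf else Leaf)"

definition decides_in_time ::
  "prog \<Rightarrow> ('i \<Rightarrow> tree) \<Rightarrow> 'i set \<Rightarrow> ('i \<Rightarrow> bool) \<Rightarrow> ('i \<Rightarrow> nat) \<Rightarrow> bool" where
  "decides_in_time P enc X Q T \<longleftrightarrow>
     (\<forall>x \<in> X. \<exists>t \<le> T x. runs P (enc x) t (bool_tree (Q x)))"

text \<open>
  The problem of deciding \<open>Q\<close> on the inputs \<open>X\<close>, encoded by \<open>enc\<close> and of size \<open>size_of\<close>, is solvable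
  in time \<open>O\<^sup>\<star>(f)\<close>: one program and one polynomial in the input size serve all inputs.
\<close>

definition solvable_in_Ostar ::
  "('i \<Rightarrow> tree) \<Rightarrow> ('i \<Rightarrow> nat) \<Rightarrow> 'i set \<Rightarrow> ('i \<Rightarrow> bool) \<Rightarrow> ('i \<Rightarrow> nat) \<Rightarrow> bool" where
  "solvable_in_Ostar enc size_of X Q f \<longleftrightarrow>
     (\<exists>P (p :: nat poly). decides_in_time P enc X Q (\<lambda>x. f x * poly p (size_of x)))"


section \<open>Encoding of instances\<close>

text \<open>
  Numbers are written in unary. Vertex and colour names are smaller than \<open>instance_size\<close>, so this
  costs only a polynomial factor. The parameter \<open>k\<close> in unary takes \<open>k \<le> 23\<^sup>k\<close> nodes.
\<close>

primrec enc_nat :: "nat \<Rightarrow> tree" where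
  "enc_nat 0 = Leaf"
| "enc_nat (Suc n) = Node Leaf (enc_nat n)"

primrec enc_list :: "('a \<Rightarrow> tree) \<Rightarrow> 'a list \<Rightarrow> tree" where
  "enc_list enc [] = Leaf"
| "enc_list enc (x # xs) = Node (enc x) (enc_list enc xs)"

definition enc_edge :: "nat \<times> nat \<times> nat \<Rightarrow> tree" where
  "enc_edge e = (case e of (i, u, v) \<Rightarrow> Node (enc_nat i) (Node (enc_nat u) (enc_nat v)))"

definition enc_instance :: "instance_data \<Rightarrow> tree" where
  "enc_instance I =
     Node (enc_nat (num_colours I))
       (Node (enc_nat (param I))
         (Node (enc_nat (num_verts I)) (enc_list enc_edge (edge_list I))))"

end

theory Submission
  imports Defs "HOL-Library.Multiset"
begin

text \<open>
  Iterative compression over the edge list: a solution of size \<open>k\<close> for all but one edge, together with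
  an endpoint of the new edge, is a solution \<open>W\<close> of size \<open>k + 1\<close>. Guess the part of \<open>W\<close> that is deleted;
  the rest \<open>Y\<close> is kept, leaving budget \<open>k'\<close> and \<open>k' + 1\<close> undeletable vertices, while the vertices outside
  \<open>W\<close> induce a forest in every colour. The colours are coupled only by the requirement that the same set
  serves for all of them. So for each colour separately the solutions are enumerated in compressed form,
  as a set of forced vertices and a list of disjoint classes of interchangeable vertices that have to be
  met; the branching has total weight \<open>20^k'\<close> if a family with \<open>r\<close> classes counts \<open>2\<^sup>r\<close>. A choice of one
  family per colour is a hitting set problem with \<open>m\<close> sets, solved by a table of size \<open>2\<^sup>m\<close>. Summing over
  the guesses gives \<open>(20\<^sup>\<alpha> + 1)\<^sup>k \<le> 23\<^bsup>\<alpha>k\<^esup>\<close> up to polynomial factors.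
\<close>

section \<open>Acyclic edge multisets\<close>

text \<open>The obstacle is that a reduction safe for one colour is unsafe for another: a vertex of
  degree two may be suppressed in one colour although another colour needs precisely that vertex. So
  the branching never decides which vertex of a suppressed path is deleted. It records the path as a
  class, and the decision is left to the hitting set, where a vertex that serves several colours is
  counted once. For the same reason every colour receives the whole budget \<open>k'\<close>, which
  brings \<open>\<alpha>\<close> into the exponent, and the true size is tested only at the end.
  Constants: a unit of budget weighs 10 and a merger of two components weighs 2;
  \<open>k' + 1\<close> kept vertices allow at most \<open>k'\<close> mergers, hence
  \<open>10^k' 2^k' = 20^k'\<close> per colour. With \<open>Z = 20^\<alpha>\<close>, each of the
  \<open>k + 1\<close> vertices of \<open>W\<close> is either kept or deleted, and a deletion saves
  one factor \<open>Z\<close>. The sum over all guesses is at most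
  \<open>(Z + 1)^(k + 1) / Z\<close>, hence at most \<open>2 (Z + 1)^k\<close>. Finally
  \<open>Z + 1 \<le> 23^\<alpha>\<close> because \<open>\<alpha> \<ge> 1\<close>.\<close>

text \<open>
  Edges are two-element multisets. A multigraph has a cycle iff some nonempty set of edges leaves no vertex
  with degree exactly one; unlike cycles themselves, this condition is compatible with contraction
  by purely local degree counts.
\<close>

definition acyc :: "'a multiset multiset \<Rightarrow> bool" where
  "acyc M \<longleftrightarrow> (\<forall>A. A \<subseteq># M \<longrightarrow> A \<noteq> {#} \<longrightarrow> (\<exists>v. count (\<Sum>\<^sub># A) v = 1))"

lemma acyc_antimono: "M \<subseteq># N \<Longrightarrow> acyc N \<Longrightarrow> acyc M"
  unfolding acyc_def by (meson subset_mset.order_trans)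

lemma not_acyc_loop: "\<not> acyc (add_mset {#a, a#} M)"
proof -
  have "count (\<Sum>\<^sub># {#{#a, a#}#}) v \<noteq> 1" for v by auto
  then show ?thesis unfolding acyc_def
    by (metis add_mset_not_empty mset_subset_eq_add_left union_mset_add_mset_left add_0)
qed

lemma count_image_mset_upd:
  assumes "a \<noteq> b"
  shows "count (image_mset (id(b := a)) N) v =
    (if v = a then count N a + count N b else if v = b then 0 else count N v)"
  using assms by (induction N) auto

lemma sum_mset_image_image:
  "\<Sum>\<^sub># (image_mset (image_mset f) A) = image_mset f (\<Sum>\<^sub># A)"
  by (induction A) auto

lemma subset_image_mset_obtain:
  assumes "B \<subseteq># image_mset f M"
  obtains A where "A \<subseteq># M" "B = image_mset f A"
  using assms
proof (induction M arbitrary: B thesis)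
  case empty
  then show ?case by simp
next
  case (add x M)
  show ?case
  proof (cases "f x \<in># B")
    case True
    then obtain B' where B: "B = add_mset (f x) B'" by (metis multi_member_split)
    with add.prems(2) have "B' \<subseteq># image_mset f M" by simp
    with add.IH obtain A where "A \<subseteq># M" "B' = image_mset f A" by blast
    then show ?thesis using add.prems(1)[of "add_mset x A"] B by simp
  next
    case False
    then have "B \<subseteq># image_mset f M" using add.prems(2)
      by (metis add_mset_remove_trivial diff_single_trivial image_mset_add_mset mset_subset_eq_insertD
          subset_eq_diff_conv add_mset_add_single)
    with add.IH obtain A where "A \<subseteq># M" "B = image_mset f A" by blast
    then show ?thesis using add.prems(1)[of A]
      by (metis add_mset_add_single mset_subset_eq_add_left subset_mset.order_trans)
  qed
qed

text \<open>In the contraction the degree of \<open>a\<close> is the sum of the degrees of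
  \<open>a\<close> and \<open>b\<close>, and all other degrees are unchanged. Hence an edge set
  without vertices of degree one passes from either side to the other, once the contracted edge is
  added to it or removed from it where necessary.\<close>

lemma acyc_contract:
  assumes ab: "a \<noteq> b"
  shows "acyc (add_mset {#a, b#} M) \<longleftrightarrow> acyc (image_mset (image_mset (id(b := a))) M)"
proof
  let ?f = "id(b := a)"
  assume ac: "acyc (add_mset {#a, b#} M)"
  show "acyc (image_mset (image_mset ?f) M)"
    unfolding acyc_def
  proof (intro allI impI, rule ccontr)
    fix B assume "B \<subseteq># image_mset (image_mset ?f) M" and ne: "B \<noteq> {#}"
      and core: "\<nexists>v. count (\<Sum>\<^sub># B) v = 1"
    then obtain A where A: "A \<subseteq># M" "B = image_mset (image_mset ?f) A"
      by (metis subset_image_mset_obtain)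
    let ?d = "count (\<Sum>\<^sub># A)"
    have cB: "count (\<Sum>\<^sub># B) v = (if v = a then ?d a + ?d b else if v = b then 0 else ?d v)" for v
      unfolding A sum_mset_image_image count_image_mset_upd[OF ab] by simp
    have sm: "?d a + ?d b \<noteq> 1" using core cB[of a] by metis
    have ot: "?d v \<noteq> 1" if "v \<noteq> a" "v \<noteq> b" for v using core cB[of v] that by metis
    show False
    proof (cases "?d a = 1 \<or> ?d b = 1")
      case False
      have "A \<subseteq># add_mset {#a, b#} M" using A(1)
        by (metis add_mset_add_single mset_subset_eq_add_left subset_mset.order_trans)
      moreover have "A \<noteq> {#}" using A(2) ne by auto
      ultimately obtain v where "?d v = 1" using ac unfolding acyc_def by blast
      then show False using False ot by metis
    next
      case True
      \<comment> \<open>The degrees of \<open>a\<close> and \<open>b\<close> do not add up to one,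
        so if one of them is one, the other is positive. With the additional edge both are at least
        two.\<close>
      have "add_mset {#a, b#} A \<subseteq># add_mset {#a, b#} M" using A(1) by simp
      then obtain v where v: "count (\<Sum>\<^sub># (add_mset {#a, b#} A)) v = 1"
        using ac unfolding acyc_def by (metis add_mset_not_empty)
      then show False using True sm ot[of v] ab by (auto split: if_splits)
    qed
  qed
next
  let ?f = "id(b := a)"
  assume ac: "acyc (image_mset (image_mset ?f) M)"
  have img: "\<exists>v. (if v = a then count (\<Sum>\<^sub># A) a + count (\<Sum>\<^sub># A) b
      else if v = b then 0 else count (\<Sum>\<^sub># A) v) = 1" if "A \<subseteq># M" "A \<noteq> {#}" for A
    using ac[unfolded acyc_def, rule_format, of "image_mset (image_mset ?f) A"] that
    unfolding sum_mset_image_image count_image_mset_upd[OF ab]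
    by (simp add: image_mset_subseteq_mono)
  show "acyc (add_mset {#a, b#} M)"
    unfolding acyc_def
  proof (intro allI impI, rule ccontr)
    fix A assume sub: "A \<subseteq># add_mset {#a, b#} M" and ne: "A \<noteq> {#}"
      and core: "\<nexists>v. count (\<Sum>\<^sub># A) v = 1"
    show False
    proof (cases "A \<subseteq># M")
      case True
      then show False using img[OF True ne] core by (auto split: if_splits simp: add_is_1)
    next
      case False
      have "{#a, b#} \<in># A"
        using sub False by (metis diff_single_trivial subset_eq_diff_conv add_mset_add_single)
      then obtain A0 where A0: "A = add_mset {#a, b#} A0" by (metis multi_member_split)
      have "A0 \<subseteq># M" using sub A0 by simp
      have c: "count (\<Sum>\<^sub># A) v = count (\<Sum>\<^sub># A0) v + (if v = a \<or> v = b then 1 else 0)" for v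
        using ab unfolding A0 by auto
      \<comment> \<open>Degree one in \<open>A\<close> is excluded, so without the additional edge
        \<open>a\<close> and \<open>b\<close> still have positive degree, and the identified vertex
        has degree at least two.\<close>
      have ga: "count (\<Sum>\<^sub># A0) a \<ge> 1" using core c[of a] by (cases "count (\<Sum>\<^sub># A0) a") auto
      have gb: "count (\<Sum>\<^sub># A0) b \<ge> 1" using core c[of b] by (cases "count (\<Sum>\<^sub># A0) b") auto
      have "A0 \<noteq> {#}" using ga by auto
      from img[OF \<open>A0 \<subseteq># M\<close> this] obtain v where
        v: "(if v = a then count (\<Sum>\<^sub># A0) a + count (\<Sum>\<^sub># A0) b
          else if v = b then 0 else count (\<Sum>\<^sub># A0) v) = 1" by blast
      moreover have "count (\<Sum>\<^sub># A0) a + count (\<Sum>\<^sub># A0) b \<noteq> 1" using ga gb by linarith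
      ultimately have "v \<noteq> a" "v \<noteq> b" using ab by (auto simp only: if_True if_False split: if_splits)
      then show False using v c[of v] core by auto
    qed
  qed
qed

lemma image_mset_image_mset_id:
  assumes "b \<notin># \<Sum>\<^sub># M"
  shows "image_mset (image_mset (id(b := a))) M = M"
proof -
  have "image_mset (id(b := a)) e = e" if "e \<in># M" for e
  proof -
    have "b \<notin># e" using that assms by (auto simp: in_Union_mset_iff)
    then have "image_mset (id(b := a)) e = image_mset id e"
      by (intro image_mset_cong) auto
    then show ?thesis by simp
  qed
  then have "image_mset (image_mset (id(b := a))) M = image_mset id M"
    by (intro image_mset_cong) auto
  then show ?thesis by simp
qed

lemma acyc_leaf:
  assumes "b \<notin># \<Sum>\<^sub># M" "a \<noteq> b"
  shows "acyc (add_mset {#b, a#} M) \<longleftrightarrow> acyc M"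
  using acyc_contract[OF assms(2), of M] image_mset_image_mset_id[OF assms(1), of a]
  by (simp add: add_mset_commute)

text \<open>Contracting the edge between \<open>v\<close> and \<open>p\<close> turns the other edge
  at \<open>v\<close> into one between \<open>p\<close> and \<open>y\<close>, and leaves the rest
  alone because \<open>v\<close> has no further edges.\<close>

lemma acyc_suppress:
  assumes "v \<notin># \<Sum>\<^sub># M" "p \<noteq> v" "y \<noteq> v"
  shows "acyc (add_mset {#v, p#} (add_mset {#v, y#} M)) \<longleftrightarrow> acyc (add_mset {#p, y#} M)"
  using acyc_contract[OF assms(2), of "add_mset {#v, y#} M"] image_mset_image_mset_id[OF assms(1), of p]
    assms by (simp add: add_mset_commute)

text \<open>Both sides contract to the same multigraph, in which \<open>v\<close>, \<open>y1\<close>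
  and \<open>y2\<close> are a single vertex. The right side has one edge fewer at \<open>v\<close>
  and one component fewer: this is the progress made when both paths at \<open>v\<close> are left
  intact.\<close>

lemma acyc_merge:
  assumes "y1 \<noteq> y2" "v \<noteq> y1" "v \<noteq> y2"
  shows "acyc (add_mset {#v, y1#} (add_mset {#v, y2#} M)) \<longleftrightarrow>
     acyc (add_mset {#v, y1#} (image_mset (image_mset (id(y2 := y1))) M))"
proof -
  let ?v = "image_mset (image_mset (id(v := y1)))" and ?y = "image_mset (image_mset (id(y2 := y1)))"
  have comp: "?y (?v M) = ?v (?y M)"
  proof -
    have "id(y2 := y1) \<circ> id(v := y1) = id(v := y1) \<circ> id(y2 := y1)" using assms by auto
    then show ?thesis by (simp add: image_mset.compositionality multiset.map_comp o_def fun_eq_iff)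
  qed
  have "acyc (add_mset {#y1, v#} (add_mset {#v, y2#} M)) \<longleftrightarrow> acyc (add_mset {#y1, y2#} (?v M))"
    using acyc_contract[of y1 v "add_mset {#v, y2#} M"] assms by auto
  also have "\<dots> \<longleftrightarrow> acyc (?y (?v M))" using acyc_contract[of y1 y2] assms by auto
  also have "\<dots> \<longleftrightarrow> acyc (add_mset {#y1, v#} (?y M))"
    unfolding comp using acyc_contract[of y1 v] assms by auto
  finally show ?thesis by (simp add: add_mset_commute)
qed

lemma acyc_empty [simp]: "acyc {#}" by (simp add: acyc_def)

section \<open>Forests and acyclic edge multisets\<close>

lemma count_sum_image_mset_set:
  assumes "finite B"
  shows "count (\<Sum>\<^sub># (image_mset h (mset_set B))) v = (\<Sum>e\<in>B. count (h e) v)"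
  using assms by (induction B rule: finite_induct) auto

definition simple_path :: "('v, 'e) cgraph \<Rightarrow> 'e set \<Rightarrow> 'v list \<Rightarrow> 'e list \<Rightarrow> bool" where
  "simple_path H B vs es \<longleftrightarrow> length vs = Suc (length es) \<and> distinct vs \<and> distinct es \<and>
     set vs \<subseteq> verts H \<and> set es \<subseteq> B \<and> (\<forall>i < length es. ends H (es ! i) = {vs ! i, vs ! Suc i})"

text \<open>The prefix of the path up to \<open>w\<close> is closed by \<open>e\<close>. Only the
  first edge of the path contains \<open>v\<close>, so any other edge at \<open>v\<close> is new;
  \<open>w = v\<close> yields a loop.\<close>

lemma cycle_of_chord:
  assumes p: "simple_path H B (v # vs) es" and e: "e \<in> B" "ends H e = {v, w}"
    and ne: "es = [] \<or> e \<noteq> hd es" and w: "w \<in> set (v # vs)" and B: "B \<subseteq> edges H"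
  shows "\<exists>cs ds. is_cycle H cs ds"
proof -
  obtain j where j: "j < length (v # vs)" "w = (v # vs) ! j"
    using w by (metis in_set_conv_nth)
  let ?cs = "take (Suc j) (v # vs)" and ?ds = "take j es @ [e]"
  have len: "length vs = length es" using p by (simp add: simple_path_def)
  have ed: "ends H (es ! i) = {(v # vs) ! i, (v # vs) ! Suc i}" if "i < length es" for i
    using p that unfolding simple_path_def by blast
  have dv: "distinct (v # vs)" using p by (simp add: simple_path_def)
  have notin: "e \<notin> set (take j es)"
  proof
    assume "e \<in> set (take j es)"
    then obtain i where i: "i < j" "i < length es" "e = es ! i" by (auto simp: in_set_conv_nth)
    have "es \<noteq> []" using i by auto
    then have "i \<noteq> 0" using ne i by (metis hd_conv_nth)
    then have "(v # vs) ! 0 \<noteq> (v # vs) ! i" "(v # vs) ! 0 \<noteq> (v # vs) ! Suc i"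
      using i(2) len dv by (subst nth_eq_iff_index_eq; simp)+
    then show False using ed[OF i(2)] e(2) i(3) by auto
  qed
  have "is_cycle H ?cs ?ds"
    unfolding is_cycle_def
  proof (intro conjI allI impI)
    show "length ?cs = length ?ds" using j(1) len by simp
    show "distinct ?cs" using dv by (rule distinct_take)
    show "distinct ?ds" using p notin by (simp add: simple_path_def)
    show "set ?cs \<subseteq> verts H" using p set_take_subset[of "Suc j" "v # vs"]
      unfolding simple_path_def by blast
    show "set ?ds \<subseteq> edges H" using p B e(1) set_take_subset[of j es]
      unfolding simple_path_def by auto
    fix i assume "i < length ?ds"
    then have i: "i \<le> j" "j \<le> length es" using j(1) len by auto
    show "ends H (?ds ! i) = {?cs ! i, ?cs ! (Suc i mod length ?ds)}"
    proof (cases "i = j")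
      case True
      have "?ds ! i = e" using True i by (simp add: nth_append)
      moreover have "?cs ! i = w" using True j by (simp only: nth_take lessI)
      moreover have "Suc i mod length ?ds = 0" using True i by simp
      ultimately show ?thesis using e(2) by (simp add: insert_commute)
    next
      case False
      then have "i < j" using i by simp
      then have "?ds ! i = es ! i" "Suc i mod length ?ds = Suc i" using i by (auto simp: nth_append)
      moreover have "?cs ! i = (v # vs) ! i" "?cs ! Suc i = (v # vs) ! Suc i"
        using \<open>i < j\<close> by (simp_all only: nth_take less_SucI Suc_less_eq)
      ultimately show ?thesis using ed[of i] \<open>i < j\<close> i by simp
    qed
  qed simp
  then show ?thesis by blast
qed

text \<open>A longest path, extended at its front: the first vertex has an edge other than the first
  edge of the path, and by maximality its other end already lies on the path.\<close>

lemma cycle_of_min_degree_2: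
  assumes B: "finite B" "B \<subseteq> edges H" "B \<noteq> {}" and fin: "finite (verts H)"
    and ends: "\<And>e. e \<in> B \<Longrightarrow> ends H e = {f e, g e} \<and> f e \<in> verts H \<and> g e \<in> verts H"
    and deg: "\<And>v. (\<Sum>e\<in>B. count {#f e, g e#} v) \<noteq> 1"
  shows "\<exists>cs ds. is_cycle H cs ds"
proof -
  \<comment> \<open>Incidence of the first vertex with \<open>B\<close> matters for the path without
    edges, which might otherwise sit at a vertex that has no edge to continue with.\<close>
  let ?P = "\<lambda>n. \<exists>v vs es. simple_path H B (v # vs) es \<and> v \<in> \<Union>(ends H ` B) \<and> length es = n"
  obtain e0 where e0: "e0 \<in> B" using B(3) by blast
  have "simple_path H B [f e0] []" using ends[OF e0] by (simp add: simple_path_def)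
  then have "?P 0" using ends[OF e0] e0 by blast
  moreover have bound: "n \<le> card (verts H)" if h: "?P n" for n
  proof -
    obtain v vs es where "simple_path H B (v # vs) es" "length es = n" using h by blast
    then have "n \<le> card (set (v # vs))" "set (v # vs) \<subseteq> verts H"
      using distinct_card[of "v # vs"] unfolding simple_path_def by auto
    then show ?thesis using card_mono[OF fin] by (meson le_trans)
  qed
  ultimately obtain n where n: "?P n" and mx: "\<And>m. ?P m \<Longrightarrow> m \<le> n"
    using Nat.ex_has_greatest_nat[of ?P 0 "card (verts H)"] by blast
  then obtain v vs es where p: "simple_path H B (v # vs) es" and v: "v \<in> \<Union>(ends H ` B)"
    and l: "length es = n" by blast
  have "\<exists>e\<in>B. \<exists>w. ends H e = {v, w} \<and> (es = [] \<or> e \<noteq> hd es \<or> w = v)"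
  proof (cases "es = []")
    case True
    obtain e where "e \<in> B" "v \<in> ends H e" using v by blast
    then show ?thesis using ends[of e] True by (auto simp: insert_commute)
  next
    case False
    then have "ends H (es ! 0) = {v, vs ! 0}" using p unfolding simple_path_def by fastforce
    then have h: "hd es \<in> B" "v \<in> ends H (hd es)"
      using p False unfolding simple_path_def by (auto simp: hd_conv_nth)
    show ?thesis
    proof (rule ccontr)
      assume no: "\<not> ?thesis"
      \<comment> \<open>If the first edge of the path were the only edge at \<open>v\<close>, and no
        loop, the degree of \<open>v\<close> in \<open>B\<close> would be exactly one.\<close>
      have "count {#f e, g e#} v = (if e = hd es then 1 else 0)" if e: "e \<in> B" for e
      proof (cases "e = hd es")
        case True
        have "ends H e \<noteq> {v, v}" using no e by blast
        then have "\<not> (f e = v \<and> g e = v)" using ends[OF e] by metis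
        moreover have "f e = v \<or> g e = v" using h(2) ends[OF h(1)] unfolding True by auto
        ultimately show ?thesis using True by auto
      next
        case False
        have "ends H e \<noteq> {v, w}" for w using no e False by blast
        then have "f e \<noteq> v" "g e \<noteq> v" using ends[OF e] by (metis insert_commute)+
        then show ?thesis using False by simp
      qed
      then have "(\<Sum>e\<in>B. count {#f e, g e#} v) = (\<Sum>e\<in>B. if e = hd es then 1 else 0)"
        by (intro sum.cong) auto
      then show False using deg[of v] h(1) B(1) by simp
    qed
  qed
  then obtain e w where e: "e \<in> B" "ends H e = {v, w}" and c: "es = [] \<or> e \<noteq> hd es \<or> w = v"
    by blast
  show ?thesis
  proof (cases "w = v")
    case True
    have "simple_path H B [v] []" using p by (simp add: simple_path_def)
    from cycle_of_chord[OF this e(1)] show ?thesis using e True B by simp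
  next
    case False
    then have c': "es = [] \<or> e \<noteq> hd es" using c by blast
    show ?thesis
    proof (cases "w \<in> set (v # vs)")
      case True
      from cycle_of_chord[OF p e c' this B(2)] show ?thesis .
    next
      case new: False
      have "e \<notin> set es"
      proof
        assume "e \<in> set es"
        then obtain i where i: "i < length es" "e = es ! i" by (auto simp: in_set_conv_nth)
        then have "ends H e = {(v # vs) ! i, (v # vs) ! Suc i}" "Suc i < length (v # vs)"
          using p unfolding simple_path_def by auto
        then have "w \<in> set (v # vs)" using e(2)
          by (metis insertCI insertE nth_mem singletonD Suc_lessD)
        then show False using new by simp
      qed
      moreover have "w \<in> verts H" using ends[OF e(1)] e(2) by (metis insertCI insertE singletonD)
      ultimately have "simple_path H B (w # v # vs) (e # es)"
        using p new e unfolding simple_path_def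
        by (auto simp: nth_Cons insert_commute split: nat.split)
      moreover have "w \<in> \<Union>(ends H ` B)" using e by blast
      ultimately have "?P (length (e # es))" by blast
      from mx[OF this] l show ?thesis by simp
    qed
  qed
qed

text \<open>A vertex of the cycle lies on the edge at its own position and on the edge at the
  preceding one. If the two coincide, the edge is a loop and counts twice.\<close>

lemma min_degree_2_of_cycle:
  assumes c: "is_cycle H vs es"
    and ends: "\<And>e. e \<in> set es \<Longrightarrow> ends H e = {f e, g e}"
  shows "(\<Sum>e\<in>set es. count {#f e, g e#} v) \<noteq> 1"
proof (cases "\<exists>e\<in>set es. v \<in> ends H e")
  case False
  then have "(\<Sum>e\<in>set es. count {#f e, g e#} v) = 0" using ends by (intro sum.neutral) auto
  then show ?thesis by simp
next
  case True
  let ?n = "length es"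
  have n: "?n > 0" and len: "length vs = ?n" and de: "distinct es"
    and nth: "\<And>i. i < ?n \<Longrightarrow> ends H (es ! i) = {vs ! i, vs ! (Suc i mod ?n)}"
    using c unfolding is_cycle_def by auto
  obtain i where i: "i < ?n" "v \<in> ends H (es ! i)" using True by (auto simp: in_set_conv_nth)
  then obtain j where j: "j < ?n" "v = vs ! j"
    using nth[OF i(1)] n by (metis insertE mod_less_divisor singletonD)
  \<comment> \<open>The cyclic predecessor of \<open>j\<close>; adding the length first avoids
    truncated subtraction at \<open>j = 0\<close>.\<close>
  define k where "k = (j + ?n - 1) mod ?n"
  have k: "k < ?n" "Suc k mod ?n = j"
    using n j(1) unfolding k_def by (simp_all add: mod_Suc_eq)
  have ej: "v \<in> ends H (es ! j)" "v \<in> ends H (es ! k)" using nth[OF j(1)] nth[OF k(1)] j k by auto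
  show ?thesis
  proof (cases "k = j")
    case True
    then have "ends H (es ! j) = {v}" using nth[OF k(1)] k j by simp
    then have "count {#f (es ! j), g (es ! j)#} v = 2" using ends[of "es ! j"] j
      by (auto simp: doubleton_eq_iff)
    moreover have "count {#f (es ! j), g (es ! j)#} v \<le> (\<Sum>e\<in>set es. count {#f e, g e#} v)"
      using j(1) by (intro member_le_sum) auto
    ultimately show ?thesis by linarith
  next
    case False
    have ne: "es ! k \<noteq> es ! j" using False k j de by (simp add: nth_eq_iff_index_eq)
    have ge1: "count {#f (es ! i), g (es ! i)#} v \<ge> 1" if "i < ?n" "v \<in> ends H (es ! i)" for i
      using ends[of "es ! i"] that by auto
    have "2 \<le> (\<Sum>e\<in>{es ! k, es ! j}. count {#f e, g e#} v)"
      using add_mono[OF ge1[OF k(1) ej(2)] ge1[OF j(1) ej(1)]] ne by (simp only: sum.insert finite.intros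
          sum.empty empty_iff insert_iff not_False_eq_True simp_thms)
    also have "\<dots> \<le> (\<Sum>e\<in>set es. count {#f e, g e#} v)"
      using j k by (intro sum_mono2) auto
    finally show ?thesis by linarith
  qed
qed

lemma forest_iff_acyc:
  assumes fin: "finite (edges H)" "finite (verts H)"
    and ends: "\<And>e. e \<in> edges H \<Longrightarrow> ends H e = {f e, g e} \<and> f e \<in> verts H \<and> g e \<in> verts H"
  shows "forest H \<longleftrightarrow> acyc (image_mset (\<lambda>e. {#f e, g e#}) (mset_set (edges H)))"
    (is "_ \<longleftrightarrow> acyc (image_mset ?h _)")
proof
  assume fo: "forest H"
  show "acyc (image_mset ?h (mset_set (edges H)))"
    unfolding acyc_def
  proof (intro allI impI, rule ccontr)
    fix A assume A: "A \<subseteq># image_mset ?h (mset_set (edges H))" "A \<noteq> {#}"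
      "\<nexists>v. count (\<Sum>\<^sub># A) v = 1"
    then obtain B' where B': "B' \<subseteq># mset_set (edges H)" "A = image_mset ?h B'"
      using subset_image_mset_obtain[OF A(1)] by blast
    define B where "B = set_mset B'"
    have BE: "B \<subseteq> edges H" using set_mset_mono[OF B'(1)] fin by (simp add: B_def)
    \<comment> \<open>The preimage consists of edge names, which have multiplicity one. It is
      therefore a set, even when parallel edges give elements of \<open>A\<close> a higher
      multiplicity.\<close>
    have "B' = mset_set B" unfolding B_def
    proof (rule multiset_eqI)
      fix x
      have "count B' x \<le> 1"
        using mset_subset_eq_count[OF B'(1), of x] by (simp add: count_mset_set' split: if_splits)
      then show "count B' x = count (mset_set (set_mset B')) x"
        by (cases "x \<in># B'") (simp_all add: count_mset_set' not_in_iff le_antisym Suc_le_eq)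
    qed
    moreover note BE
    moreover have "finite B" by (simp add: B_def)
    moreover have "B \<noteq> {}" using A(2) B'(2) by (simp add: B_def)
    moreover have "(\<Sum>e\<in>B. count {#f e, g e#} v) \<noteq> 1" for v
      using A(3) count_sum_image_mset_set[OF \<open>finite B\<close>, of ?h v] B'(2) \<open>B' = mset_set B\<close> by metis
    ultimately have "\<exists>cs ds. is_cycle H cs ds"
      using cycle_of_min_degree_2[of B H f g] ends fin(2) by blast
    then show False using fo by (simp add: forest_def)
  qed
next
  assume ac: "acyc (image_mset ?h (mset_set (edges H)))"
  show "forest H" unfolding forest_def
  proof
    assume "\<exists>vs es. is_cycle H vs es"
    then obtain vs es where c: "is_cycle H vs es" by blast
    then have es: "set es \<subseteq> edges H" "es \<noteq> []" by (auto simp: is_cycle_def)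
    let ?A = "image_mset ?h (mset_set (set es))"
    have "?A \<subseteq># image_mset ?h (mset_set (edges H))"
      using es(1) fin by (intro image_mset_subseteq_mono subset_imp_msubset_mset_set)
    moreover have "?A \<noteq> {#}" using es(2) by (simp add: mset_set_empty_iff)
    ultimately obtain v where "count (\<Sum>\<^sub># ?A) v = 1" using ac unfolding acyc_def by blast
    then show False
      using min_degree_2_of_cycle[OF c, of f g v] es(1) ends
      by (subst (asm) count_sum_image_mset_set) auto
  qed
qed

section \<open>Instances as acyclicity conditions, one for each colour\<close>

lemma mset_filter_conv_nth:
  "mset (map h (filter P xs)) = image_mset (\<lambda>j. h (xs ! j)) (mset_set {j. j < length xs \<and> P (xs ! j)})"
proof -
  have "mset xs = image_mset (\<lambda>j. xs ! j) (mset_set {..<length xs})"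
    by (metis map_nth mset_map mset_upt atLeast0LessThan)
  then have "mset (map h (filter P xs)) =
      image_mset h (filter_mset P (image_mset (\<lambda>j. xs ! j) (mset_set {..<length xs})))"
    by simp
  also have "\<dots> = image_mset (\<lambda>j. h (xs ! j)) (filter_mset (\<lambda>j. P (xs ! j)) (mset_set {..<length xs}))"
    by (simp add: filter_mset_image_mset image_mset.compositionality o_def)
  also have "filter_mset (\<lambda>j. P (xs ! j)) (mset_set {..<length xs}) =
      mset_set {j. j < length xs \<and> P (xs ! j)}"
    by (auto simp: intro!: arg_cong[where f = mset_set])
  finally show ?thesis .
qed

definition col_edges :: "nat \<Rightarrow> nat set \<Rightarrow> (nat \<times> nat \<times> nat) list \<Rightarrow> nat multiset multiset" where
  "col_edges c S es = mset (map (\<lambda>(i, u, v). {#u, v#}) (filter (\<lambda>(i, u, v). i = c \<and> u \<notin> S \<and> v \<notin> S) es))"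

text \<open>The quantifier ranges over all colours, which saves carrying \<open>\<alpha>\<close>
  along: colours outside the instance have no edges.\<close>

definition solution :: "(nat \<times> nat \<times> nat) list \<Rightarrow> nat set \<Rightarrow> bool" where
  "solution es S \<longleftrightarrow> (\<forall>c. acyc (col_edges c S es))"

lemma edge_bounds:
  assumes wf: "wf_cgraph (num_colours I) (graph_of I)" and h: "(i, u, v) \<in> set (edge_list I)"
  shows "i < num_colours I" "u < num_verts I" "v < num_verts I"
proof -
  obtain j where j: "j < length (edge_list I)" "edge_list I ! j = (i, u, v)"
    using h by (auto simp: in_set_conv_nth)
  then have "j \<in> edges (graph_of I)" "ends (graph_of I) j = {u, v}" "colour (graph_of I) j = i"
    by (simp_all add: graph_of_def)
  then have "\<exists>a \<in> verts (graph_of I). \<exists>b \<in> verts (graph_of I). {u, v} = {a, b}" "i < num_colours I"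
    using wf unfolding wf_cgraph_def by (metis (no_types, lifting))+
  then have "\<exists>a \<in> {..<num_verts I}. \<exists>b \<in> {..<num_verts I}. {u, v} = {a, b}" "i < num_colours I"
    by (simp_all add: graph_of_def)
  then show "i < num_colours I" "u < num_verts I" "v < num_verts I" by (auto simp: doubleton_eq_iff)
qed

lemma sim_fvs_iff_solution:
  assumes wf: "wf_cgraph (num_colours I) (graph_of I)"
  shows "sim_fvs (num_colours I) (graph_of I) S \<longleftrightarrow> S \<subseteq> {..<num_verts I} \<and> solution (edge_list I) S"
proof -
  let ?E = "edge_list I" and ?n = "num_verts I"
  note e = edge_bounds[OF wf]
  have fo: "forest (delete_verts (colour_class (graph_of I) c) S) \<longleftrightarrow> acyc (col_edges c S ?E)" for c
  proof -
    let ?H = "delete_verts (colour_class (graph_of I) c) S"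
    let ?f = "\<lambda>j. fst (snd (?E ! j))" and ?g = "\<lambda>j. snd (snd (?E ! j))"
    have ed: "edges ?H = {j. j < length ?E \<and> (case ?E ! j of (i, u, v) \<Rightarrow> i = c \<and> u \<notin> S \<and> v \<notin> S)}"
      by (auto simp: delete_verts_def colour_class_def graph_of_def split: prod.splits)
    have "forest ?H \<longleftrightarrow> acyc (image_mset (\<lambda>j. {#?f j, ?g j#}) (mset_set (edges ?H)))"
    proof (rule forest_iff_acyc)
      fix j assume "j \<in> edges ?H"
      then obtain i u v where j: "j < length ?E" "?E ! j = (i, u, v)" "u \<notin> S" "v \<notin> S"
        unfolding ed by auto
      then have "u < ?n" "v < ?n" using e[of i u v] by (metis nth_mem)+
      then show "ends ?H j = {?f j, ?g j} \<and> ?f j \<in> verts ?H \<and> ?g j \<in> verts ?H"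
        using j by (simp add: delete_verts_def colour_class_def graph_of_def)
    qed (auto simp: delete_verts_def colour_class_def graph_of_def)
    also have "image_mset (\<lambda>j. {#?f j, ?g j#}) (mset_set (edges ?H)) = col_edges c S ?E"
      unfolding col_edges_def mset_filter_conv_nth ed
      by (intro image_mset_cong) (auto split: prod.splits)
    finally show ?thesis .
  qed
  have "acyc (col_edges c S ?E)" if "\<not> c < num_colours I" for c
  proof -
    have "col_edges c S ?E = {#}" using e(1) that by (auto simp: col_edges_def filter_empty_conv)
    then show ?thesis by simp
  qed
  then show ?thesis unfolding sim_fvs_def solution_def fo by (auto simp: graph_of_def)
qed

section \<open>Enumerating feedback vertex sets of one colour\<close>

text \<open>
  A state of the branching consists of the still deletable vertices in an elimination order of the forest
  outside \<open>Y\<close>, each with its at most one later neighbour, and of pending edges \<open>(u, y, C)\<close>: an edge from \<open>u\<close>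
  to the contracted component \<open>y\<close> of undeletable vertices, subdivided by suppressed vertices of degree two.
  These lie on the same cycles, so all that matters is whether a solution meets \<open>C\<close>. A family \<open>(D, cls)\<close>
  stands for the sets that contain \<open>D\<close> and meet every class in \<open>cls\<close>.
\<close>

type_synonym pend = "nat \<times> nat \<times> nat list"
type_synonym family = "nat list \<times> nat list list"

abbreviation nodes :: "(nat \<times> nat list) list \<Rightarrow> nat set" where
  "nodes os \<equiv> fst ` set os"

definition relab :: "nat \<Rightarrow> nat \<Rightarrow> pend list \<Rightarrow> pend list" where
  "relab b a F = map (\<lambda>(u, y, C). (u, (id(b := a)) y, C)) F"

lemma length_relab [simp]: "length (relab b a F) = length F"
  by (simp add: relab_def)

abbreviation pend_at :: "nat \<Rightarrow> pend list \<Rightarrow> pend list" where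
  "pend_at v F \<equiv> filter (\<lambda>e. fst e = v) F"

abbreviation pend_off :: "nat \<Rightarrow> pend list \<Rightarrow> pend list" where
  "pend_off v F \<equiv> filter (\<lambda>e. fst e \<noteq> v) F"

lemma length_at_off: "length (pend_at v F) + length (pend_off v F) = length F"
  by (rule sum_length_filter_compl)

text \<open>For a vertex with a single pending edge. With a parent \<open>p\<close> it has degree
  two and is suppressed: the edge moves to \<open>p\<close>, and the vertex is to be prepended to
  the class by the caller. Without a parent it is a leaf, and the edge is dropped.\<close>

definition push :: "nat list \<Rightarrow> nat \<Rightarrow> nat list \<Rightarrow> pend list \<Rightarrow> pend list" where
  "push ps y C R = (case ps of [] \<Rightarrow> R | p # _ \<Rightarrow> (p, y, C) # R)"

text \<open>
  If the first vertex \<open>v\<close> has two pending edges, a solution contains \<open>v\<close>, meets the class of one of the two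
  edges, or leaves a path that merges two distinct components.
\<close>

function branch :: "nat \<Rightarrow> (nat \<times> nat list) list \<Rightarrow> pend list \<Rightarrow> nat list \<Rightarrow> nat list list \<Rightarrow> family list" where
  "branch k [] F D cls = [(D, cls)]"
| "branch k ((v, ps) # os) F D cls = (case pend_at v F of
     [] \<Rightarrow> branch k os (pend_off v F) D cls
   | e1 # L1 \<Rightarrow> (case L1 of
       [] \<Rightarrow> branch k os (push ps (fst (snd e1)) (v # snd (snd e1)) (pend_off v F)) D cls
     | e2 # L \<Rightarrow>
         (if k = 0 then [] else
            branch (k - 1) os (pend_off v F) (v # D) cls @
            branch (k - 1) ((v, ps) # os) (e2 # L @ pend_off v F) D (snd (snd e1) # cls) @
            branch (k - 1) ((v, ps) # os) (e1 # L @ pend_off v F) D (snd (snd e2) # cls)) @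
         (if fst (snd e1) = fst (snd e2) then [] else
            branch k ((v, ps) # os)
              ((v, fst (snd e1), []) # relab (fst (snd e2)) (fst (snd e1)) (L @ pend_off v F)) D cls)))"
  by pat_completeness auto
termination
\<comment> \<open>Pushing consumes a vertex and returns at most the one edge that it took; merging
  keeps the vertices but replaces two pending edges by one.\<close>
proof (relation "measure (\<lambda>(k, os, F, D, cls). length os + length F)", goal_cases)
  case (3 k v ps os F D cls e1 L1)
  then show ?case using length_at_off[of v F] by (auto simp: push_def split: list.splits)
next
  case (4 k v ps os F D cls e1 L1 e2 L)
  then show ?case using length_at_off[of v F] by simp
next
  case (5 k v ps os F D cls e1 L1 e2 L)
  then show ?case using length_at_off[of v F] by simp
next
  case (6 k v ps os F D cls e1 L1 e2 L)
  then show ?case using length_at_off[of v F] by simp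
next
  case (7 k v ps os F D cls e1 L1 e2 L)
  then show ?case using length_at_off[of v F] by simp
qed (auto simp: less_Suc_eq_le)

declare branch.simps(2) [simp del]

text \<open>Replaces the generated rule, whose premises are guarded by nested case distinctions and
  selectors, by one case per branching rule with the pending edges in destructured form.\<close>

lemma branch_induct [case_names Nil drop push split]:
  assumes "\<And>k F D cls. P k [] F D cls"
  and "\<And>k v ps os F D cls. pend_at v F = [] \<Longrightarrow> P k os (pend_off v F) D cls \<Longrightarrow> P k ((v, ps) # os) F D cls"
  and "\<And>k v ps os F D cls y C. pend_at v F = [(v, y, C)] \<Longrightarrow>
     P k os (push ps y (v # C) (pend_off v F)) D cls \<Longrightarrow> P k ((v, ps) # os) F D cls"
  and "\<And>k v ps os F D cls y1 C1 y2 C2 L. pend_at v F = (v, y1, C1) # (v, y2, C2) # L \<Longrightarrow>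
     (\<And>k'. k = Suc k' \<Longrightarrow> P k' os (pend_off v F) (v # D) cls) \<Longrightarrow>
     (\<And>k'. k = Suc k' \<Longrightarrow> P k' ((v, ps) # os) ((v, y2, C2) # L @ pend_off v F) D (C1 # cls)) \<Longrightarrow>
     (\<And>k'. k = Suc k' \<Longrightarrow> P k' ((v, ps) # os) ((v, y1, C1) # L @ pend_off v F) D (C2 # cls)) \<Longrightarrow>
     (y1 \<noteq> y2 \<Longrightarrow> P k ((v, ps) # os) ((v, y1, []) # relab y2 y1 (L @ pend_off v F)) D cls) \<Longrightarrow>
     P k ((v, ps) # os) F D cls"
  shows "P k os F D cls"
proof (induction k os F D cls rule: branch.induct)
  case (1 k F D cls)
  then show ?case using assms(1) by simp
next
  case (2 k v ps os F D cls)
  have hd: "fst e = v" if "e \<in> set (pend_at v F)" for e using that by simp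
  consider "pend_at v F = []" | y C where "pend_at v F = [(v, y, C)]"
    | y1 C1 y2 C2 L where "pend_at v F = (v, y1, C1) # (v, y2, C2) # L"
  proof (cases "pend_at v F")
    case (Cons e1 L1)
    then have e1: "e1 = (v, snd e1)" using hd[of e1] by (metis list.set_intros(1) prod.collapse)
    show thesis
    proof (cases L1)
      case Nil
      then show thesis using that(2)[of "fst (snd e1)" "snd (snd e1)"] Cons e1 by simp
    next
      case (Cons e2 L)
      then have "e2 = (v, snd e2)"
        using hd[of e2] \<open>pend_at v F = e1 # L1\<close> by (metis list.set_intros prod.collapse)
      then show thesis
        using that(3)[of "fst (snd e1)" "snd (snd e1)" "fst (snd e2)" "snd (snd e2)" L]
          e1 Cons \<open>pend_at v F = e1 # L1\<close> by simp
    qed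
  qed (use that(1) in blast)
  then show ?case
  proof cases
    case 1
    then show ?thesis using assms(2) 2(1) by blast
  next
    case (2 y C)
    from "2.IH"(2)[OF 2 refl] show ?thesis using assms(3)[OF 2] by simp
  next
    case (3 y1 C1 y2 C2 L)
    note ih = "2.IH"(3-)[OF 3 refl]
    show ?thesis by (rule assms(4)[OF 3]) (use ih in auto)
  qed
qed

section \<open>The multigraph that a state represents, and the invariant\<close>

definition oe :: "nat set \<Rightarrow> nat \<Rightarrow> nat list \<Rightarrow> nat multiset multiset" where
  "oe S v ps = (if v \<in> S then {#} else mset (map (\<lambda>p. {#v, p#}) (filter (\<lambda>p. p \<notin> S) ps)))"

definition ord_edges :: "nat set \<Rightarrow> (nat \<times> nat list) list \<Rightarrow> nat multiset multiset" where
  "ord_edges S os = sum_list (map (\<lambda>(v, ps). oe S v ps) os)"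

text \<open>A pending edge is a path, broken by deleting its endpoint \<open>u\<close> or any vertex
  of its class. The label \<open>y\<close> stands for undeletable vertices and is not
  tested.\<close>

definition pend_edges :: "nat set \<Rightarrow> pend list \<Rightarrow> nat multiset multiset" where
  "pend_edges S F = mset (map (\<lambda>(u, y, C). {#u, y#}) (filter (\<lambda>(u, y, C). u \<notin> S \<and> set C \<inter> S = {}) F))"

definition st_edges :: "(nat \<times> nat list) list \<Rightarrow> pend list \<Rightarrow> nat set \<Rightarrow> nat multiset multiset" where
  "st_edges os F S = ord_edges S os + pend_edges S F"

lemma ord_edges_simps [simp]:
  "ord_edges S [] = {#}"
  "ord_edges S ((v, ps) # os) = oe S v ps + ord_edges S os"
  by (simp_all add: ord_edges_def)

lemma pend_edges_simps [simp]:
  "pend_edges S [] = {#}"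
  "pend_edges S ((u, y, C) # F) =
     (if u \<notin> S \<and> set C \<inter> S = {} then add_mset {#u, y#} (pend_edges S F) else pend_edges S F)"
  "pend_edges S (F @ F') = pend_edges S F + pend_edges S F'"
  by (simp_all add: pend_edges_def)

lemma pend_edges_at_off: "pend_edges S F = pend_edges S (pend_at v F) + pend_edges S (pend_off v F)"
  by (induction F) auto

fun ordered :: "(nat \<times> nat list) list \<Rightarrow> bool" where
  "ordered [] \<longleftrightarrow> True"
| "ordered ((v, ps) # os) \<longleftrightarrow> v \<notin> nodes os \<and> length ps \<le> 1 \<and> set ps \<subseteq> nodes os \<and> ordered os"

text \<open>\<open>Lb\<close> contains the labels still in use, and its size is the potential that a
  merger consumes. Disjointness of the classes from each other and from the remaining vertices
  ensures that meeting one class has no side effect on the rest of the state.\<close>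

definition state_inv :: "nat set \<Rightarrow> (nat \<times> nat list) list \<Rightarrow> pend list \<Rightarrow> bool" where
  "state_inv Lb os F \<longleftrightarrow> ordered os \<and> distinct (concat (map (snd \<circ> snd) F)) \<and>
     (\<forall>e \<in> set F. fst e \<in> nodes os \<and> fst (snd e) \<in> Lb \<and> set (snd (snd e)) \<inter> nodes os = {}) \<and>
     Lb \<inter> nodes os = {} \<and> finite Lb"

lemma distinct_concat_at_off:
  "distinct (concat (map g F)) \<longleftrightarrow> distinct (concat (map g (pend_at v F @ pend_off v F)))"
proof (rule mset_eq_imp_distinct_iff)
  show "mset (concat (map g F)) = mset (concat (map g (pend_at v F @ pend_off v F)))"
    by (induction F) auto
qed

lemma inv_at_off: "state_inv Lb os F \<longleftrightarrow> state_inv Lb os (pend_at v F @ pend_off v F)"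
proof -
  have "set (pend_at v F @ pend_off v F) = set F" by auto
  then show ?thesis unfolding state_inv_def using distinct_concat_at_off[of "snd \<circ> snd" F v] by simp
qed

lemma inv_fst: "state_inv Lb os F \<Longrightarrow> fst ` set F \<subseteq> nodes os"
  by (rule image_subsetI) (simp add: state_inv_def)

lemma inv_drop:
  assumes "state_inv Lb ((v, ps) # os) F"
  shows "state_inv Lb os (pend_off v F)"
proof -
  have "state_inv Lb ((v, ps) # os) (pend_at v F @ pend_off v F)" using assms inv_at_off by blast
  then have "distinct (concat (map (snd \<circ> snd) (pend_off v F)))" unfolding state_inv_def by simp
  moreover have "fst e \<in> nodes os" if "e \<in> set (pend_off v F)" for e
    using assms that unfolding state_inv_def by (cases "fst e = v") auto
  ultimately show ?thesis using assms unfolding state_inv_def by simp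
qed

lemma inv_push:
  assumes "state_inv Lb ((v, ps) # os) F" "pend_at v F = [(v, y, C)]"
  shows "state_inv Lb os (push ps y (v # C) (pend_off v F))"
proof -
  have i: "state_inv Lb ((v, ps) # os) ((v, y, C) # pend_off v F)" using assms inv_at_off[of Lb _ F v] by simp
  then have "\<forall>e \<in> set ((v, y, C) # pend_off v F). v \<notin> set (snd (snd e))"
    unfolding state_inv_def by auto
  then have "v \<notin> set (concat (map (snd \<circ> snd) ((v, y, C) # pend_off v F)))" by auto
  then show ?thesis using i inv_drop[OF assms(1)] unfolding state_inv_def push_def by (cases ps) auto
qed

lemma inv_cut:
  assumes "state_inv Lb ((v, ps) # os) F" "pend_at v F = (v, y1, C1) # (v, y2, C2) # L"
  shows "state_inv Lb ((v, ps) # os) ((v, y2, C2) # L @ pend_off v F)"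
    and "state_inv Lb ((v, ps) # os) ((v, y1, C1) # L @ pend_off v F)"
    and "set C1 \<inter> set (concat (map (snd \<circ> snd) ((v, y2, C2) # L @ pend_off v F))) = {}"
    and "set C2 \<inter> set (concat (map (snd \<circ> snd) ((v, y1, C1) # L @ pend_off v F))) = {}"
    and "set C1 \<inter> nodes ((v, ps) # os) = {}" "set C2 \<inter> nodes ((v, ps) # os) = {}"
proof -
  define X where "X = L @ pend_off v F"
  have i: "state_inv Lb ((v, ps) # os) ((v, y1, C1) # (v, y2, C2) # X)"
    using assms inv_at_off[of Lb _ F v] by (simp add: X_def)
  then show "state_inv Lb ((v, ps) # os) ((v, y2, C2) # L @ pend_off v F)"
    "state_inv Lb ((v, ps) # os) ((v, y1, C1) # L @ pend_off v F)"
    unfolding X_def[symmetric] state_inv_def by (simp_all add: Int_Un_distrib)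
  show "set C1 \<inter> set (concat (map (snd \<circ> snd) ((v, y2, C2) # L @ pend_off v F))) = {}"
    "set C2 \<inter> set (concat (map (snd \<circ> snd) ((v, y1, C1) # L @ pend_off v F))) = {}"
    using i unfolding X_def[symmetric] state_inv_def by auto
  show "set C1 \<inter> nodes ((v, ps) # os) = {}" "set C2 \<inter> nodes ((v, ps) # os) = {}"
    using i unfolding state_inv_def by simp_all
qed

lemma map_classes_relab: "map (snd \<circ> snd) (relab b a F) = map (snd \<circ> snd) F"
  by (induction F) (auto simp: relab_def)

lemma relab_elem:
  assumes "e \<in> set (relab b a F)"
  obtains e' where "e' \<in> set F" "fst e = fst e'" "snd (snd e) = snd (snd e')"
    "fst (snd e) = (id(b := a)) (fst (snd e'))"
  using assms unfolding relab_def by fastforce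

lemma inv_merge:
  assumes "state_inv Lb ((v, ps) # os) F" "pend_at v F = (v, y1, C1) # (v, y2, C2) # L" "y1 \<noteq> y2"
  shows "state_inv (Lb - {y2}) ((v, ps) # os) ((v, y1, []) # relab y2 y1 (L @ pend_off v F))"
    and "y1 \<in> Lb" "y2 \<in> Lb"
proof -
  define X where "X = L @ pend_off v F"
  have i: "state_inv Lb ((v, ps) # os) ((v, y1, C1) # (v, y2, C2) # X)"
    using assms inv_at_off[of Lb _ F v] by (simp add: X_def)
  then show y: "y1 \<in> Lb" "y2 \<in> Lb" unfolding state_inv_def by auto
  have *: "fst e \<in> nodes ((v, ps) # os) \<and> fst (snd e) \<in> Lb - {y2} \<and>
      set (snd (snd e)) \<inter> nodes ((v, ps) # os) = {}" if h: "e \<in> set (relab y2 y1 X)" for e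
  proof -
    obtain e' where e': "e' \<in> set X" "fst e = fst e'" "snd (snd e) = snd (snd e')"
      "fst (snd e) = (id(y2 := y1)) (fst (snd e'))"
      using h by (rule relab_elem)
    then have "fst e' \<in> nodes ((v, ps) # os) \<and> fst (snd e') \<in> Lb \<and>
        set (snd (snd e')) \<inter> nodes ((v, ps) # os) = {}"
      using i unfolding state_inv_def by simp
    then show ?thesis using e' y assms(3) by auto
  qed
  then show "state_inv (Lb - {y2}) ((v, ps) # os) ((v, y1, []) # relab y2 y1 (L @ pend_off v F))"
    using i assms(3) y unfolding X_def[symmetric] state_inv_def by (auto simp: map_classes_relab)
qed

section \<open>The effect of each branching rule on acyclicity\<close>

lemma in_oe: "e \<in># oe S v ps \<Longrightarrow> x \<in># e \<Longrightarrow> x = v \<or> x \<in> set ps"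
  by (auto simp: oe_def split: if_splits)

lemma in_ord_edges: "e \<in># ord_edges S os \<Longrightarrow> x \<in># e \<Longrightarrow> ordered os \<Longrightarrow> x \<in> nodes os"
proof (induction os)
  case (Cons w os)
  then show ?case using in_oe[of e S "fst w" "snd w" x] by (cases w) auto
qed simp

lemma in_pend_edges: "e \<in># pend_edges S F \<Longrightarrow> x \<in># e \<Longrightarrow>
   x \<in> fst ` set F \<or> x \<in> (fst \<circ> snd) ` set F"
  by (auto simp: pend_edges_def) force+

text \<open>Earlier vertices have left the order and later ones do not list \<open>v\<close> as a
  parent, so all edges at \<open>v\<close> are its parent edge and its own pending edges. This
  supplies the freshness condition for leaves and suppressed vertices.\<close>

lemma head_fresh:
  assumes "state_inv Lb ((v, ps) # os) F"
  shows "v \<notin># \<Sum>\<^sub># (ord_edges S os + pend_edges S (pend_off v F))"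
proof
  assume "v \<in># \<Sum>\<^sub># (ord_edges S os + pend_edges S (pend_off v F))"
  then obtain e where "v \<in># e" "e \<in># ord_edges S os \<or> e \<in># pend_edges S (pend_off v F)" by auto
  moreover have "ordered os" "v \<notin> nodes os" using assms by (auto simp: state_inv_def)
  ultimately have "v \<in> fst ` set (pend_off v F) \<or> v \<in> (fst \<circ> snd) ` set (pend_off v F)"
    using in_ord_edges in_pend_edges by metis
  moreover have "\<forall>e \<in> set F. fst (snd e) \<noteq> v" using assms unfolding state_inv_def by auto
  ultimately show False by auto
qed

lemma acyc_oe:
  assumes "state_inv Lb ((v, ps) # os) F" "v \<notin># \<Sum>\<^sub># E"
  shows "acyc (oe S v ps + E) \<longleftrightarrow> acyc E"
proof (cases ps)
  case (Cons p qs)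
  then have "qs = []" "p \<noteq> v" using assms(1) by (auto simp: state_inv_def)
  then show ?thesis using Cons acyc_leaf[OF assms(2), of p] by (auto simp: oe_def)
qed (simp add: oe_def)

lemma acyc_drop:
  assumes "state_inv Lb ((v, ps) # os) F" "pend_at v F = []"
  shows "acyc (st_edges ((v, ps) # os) F S) \<longleftrightarrow> acyc (st_edges os (pend_off v F) S)"
  using acyc_oe[OF assms(1) head_fresh[OF assms(1)]] assms(2)
  by (simp add: st_edges_def pend_edges_at_off[of S F v] add.assoc)

text \<open>If \<open>v\<close> is deleted or \<open>C\<close> is met, the edge vanishes on both
  sides. Otherwise \<open>v\<close> is suppressed when its parent survives, and is a leaf attached
  to \<open>y\<close> when there is no parent or the parent is deleted; in the latter case a pushed
  edge disappears together with the parent.\<close>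

lemma acyc_push:
  assumes i: "state_inv Lb ((v, ps) # os) F" and at: "pend_at v F = [(v, y, C)]"
  shows "acyc (st_edges ((v, ps) # os) F S) \<longleftrightarrow>
     acyc (st_edges os (push ps y (v # C) (pend_off v F)) S)"
proof -
  let ?E = "ord_edges S os + pend_edges S (pend_off v F)"
  have fr: "v \<notin># \<Sum>\<^sub># ?E" by (rule head_fresh[OF i])
  have "(v, y, C) \<in> set F" using arg_cong[OF at, of set] by auto
  then have yv: "y \<noteq> v" using i unfolding state_inv_def by auto
  have st: "st_edges ((v, ps) # os) F S = oe S v ps + (pend_edges S [(v, y, C)] + ?E)"
    unfolding st_edges_def pend_edges_at_off[of S F v] at by (simp add: ac_simps)
  show ?thesis
  proof (cases "v \<notin> S \<and> set C \<inter> S = {}")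
    case False
    then have "st_edges ((v, ps) # os) F S = oe S v ps + ?E" unfolding st by auto
    moreover have "st_edges os (push ps y (v # C) (pend_off v F)) S = ?E"
      using False by (auto simp: st_edges_def push_def split: list.split)
    ultimately show ?thesis using acyc_oe[OF i fr] by simp
  next
    case True
    show ?thesis
    proof (cases "\<exists>p. ps = [p] \<and> p \<notin> S")
      case True
      then obtain p where p: "ps = [p]" "p \<notin> S" by blast
      have "p \<noteq> v" using i p by (auto simp: state_inv_def)
      then show ?thesis using acyc_suppress[OF fr _ yv] p \<open>v \<notin> S \<and> set C \<inter> S = {}\<close>
        unfolding st
        by (simp add: st_edges_def push_def oe_def add_mset_commute)
    next
      case no: False
      have "length ps \<le> 1" using i by (simp add: state_inv_def)
      then have "oe S v ps = {#}" "st_edges os (push ps y (v # C) (pend_off v F)) S = ?E"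
        using no by (cases ps; auto simp: oe_def st_edges_def push_def)+
      then show ?thesis using True acyc_leaf[OF fr, of y] yv unfolding st by simp
    qed
  qed
qed

lemma acyc_hit_head:
  assumes "v \<in> S"
  shows "st_edges ((v, ps) # os) F S = st_edges os (pend_off v F) S"
proof -
  have "pend_edges S (pend_at v F) = {#}" using assms by (induction F) auto
  then show ?thesis using assms by (simp add: st_edges_def pend_edges_at_off[of S F v] oe_def)
qed

lemma st_edges_split:
  assumes "pend_at v F = (v, y1, C1) # (v, y2, C2) # L"
  shows "st_edges os F S = st_edges os ((v, y1, C1) # (v, y2, C2) # L @ pend_off v F) S"
  unfolding st_edges_def pend_edges_at_off[of S F v] assms by simp

lemma acyc_hit_class:
  assumes "pend_at v F = (v, y1, C1) # (v, y2, C2) # L"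
  shows "set C1 \<inter> S \<noteq> {} \<Longrightarrow> st_edges os F S = st_edges os ((v, y2, C2) # L @ pend_off v F) S"
    and "set C2 \<inter> S \<noteq> {} \<Longrightarrow> st_edges os F S = st_edges os ((v, y1, C1) # L @ pend_off v F) S"
  unfolding st_edges_split[OF assms] by (auto simp: st_edges_def)

lemma pend_edges_relab:
  assumes "b \<notin> fst ` set F"
  shows "pend_edges S (relab b a F) = image_mset (image_mset (id(b := a))) (pend_edges S F)"
  using assms by (induction F) (auto simp: relab_def)

text \<open>The label \<open>y2\<close> is neither a remaining vertex nor a first component of a
  pending edge, so renaming it among the labels identifies \<open>y2\<close> with \<open>y1\<close>
  in the whole multigraph.\<close>

lemma merge_edges:
  assumes i: "state_inv Lb ((v, ps) # os) F" and at: "pend_at v F = (v, y1, C1) # (v, y2, C2) # L"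
      and ne: "y1 \<noteq> y2"
  shows "st_edges ((v, ps) # os) ((v, y1, []) # relab y2 y1 (L @ pend_off v F)) S =
    (if v \<in> S then {#} else {#{#v, y1#}#}) + image_mset (image_mset (id(y2 := y1)))
      (st_edges ((v, ps) # os) (L @ pend_off v F) S)"
proof -
  have y2: "y2 \<notin> nodes ((v, ps) # os)" using inv_merge(3)[OF assms] i unfolding state_inv_def by blast
  moreover have "y2 \<notin># \<Sum>\<^sub># (ord_edges S ((v, ps) # os))"
    using in_ord_edges y2 i unfolding state_inv_def by (metis in_Union_mset_iff)
  moreover have "y2 \<notin> fst ` set (L @ pend_off v F)"
  proof
    assume "y2 \<in> fst ` set (L @ pend_off v F)"
    moreover have "set L \<subseteq> set (pend_at v F)" using at by auto
    ultimately have "y2 \<in> fst ` set F" by auto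
    then show False using y2 i unfolding state_inv_def by auto
  qed
  ultimately show ?thesis
    unfolding st_edges_def by (simp add: image_mset_image_mset_id pend_edges_relab
        del: ord_edges_simps append_assoc pend_edges_simps(3) relab_def)
qed

lemma acyc_of_image_merge: "a \<noteq> b \<Longrightarrow> acyc (image_mset (image_mset (id(b := a))) M) \<Longrightarrow> acyc M"
  using acyc_contract[of a b M] acyc_antimono[of M "add_mset {#a, b#} M"]
  by (simp add: subset_mset.add_increasing)

lemma inv_head_not_label:
  assumes "state_inv Lb ((v, ps) # os) F" "y \<in> Lb"
  shows "v \<noteq> y"
  using assms unfolding state_inv_def by auto

text \<open>No condition on \<open>S\<close> is needed: if \<open>S\<close> contains
  \<open>v\<close> or meets \<open>C1\<close> or \<open>C2\<close>, the state before the merger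
  merely has fewer edges. This justifies giving the merged edge the empty class.\<close>

lemma acyc_merge_sound:
  assumes i: "state_inv Lb ((v, ps) # os) F" and at: "pend_at v F = (v, y1, C1) # (v, y2, C2) # L"
      and ne: "y1 \<noteq> y2"
    and ac: "acyc (st_edges ((v, ps) # os) ((v, y1, []) # relab y2 y1 (L @ pend_off v F)) S)"
  shows "acyc (st_edges ((v, ps) # os) F S)"
proof (cases "v \<in> S")
  case True
  have "acyc (st_edges ((v, ps) # os) (L @ pend_off v F) S)"
    using ac True unfolding merge_edges[OF i at ne] by (auto intro: acyc_of_image_merge[OF ne])
  then show ?thesis using True unfolding st_edges_split[OF at] by (simp add: st_edges_def)
next
  case False
  have v: "v \<noteq> y1" "v \<noteq> y2" using inv_head_not_label[OF i] inv_merge(2,3)[OF i at ne] by auto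
  have "acyc (add_mset {#v, y1#} (add_mset {#v, y2#} (st_edges ((v, ps) # os) (L @ pend_off v F) S)))"
    using ac False acyc_merge[OF ne v] unfolding merge_edges[OF i at ne] by simp
  then show ?thesis unfolding st_edges_split[OF at]
    by (rule acyc_antimono[rotated]) (auto simp: st_edges_def)
qed

text \<open>If both paths at \<open>v\<close> survive and lead to the same component, they are
  parallel edges and contracting one turns the other into a loop. Otherwise the merger is an
  equivalence.\<close>

lemma acyc_merge_complete:
  assumes i: "state_inv Lb ((v, ps) # os) F" and at: "pend_at v F = (v, y1, C1) # (v, y2, C2) # L"
    and S: "v \<notin> S" "set C1 \<inter> S = {}" "set C2 \<inter> S = {}"
    and ac: "acyc (st_edges ((v, ps) # os) F S)"
  shows "y1 \<noteq> y2" and "acyc (st_edges ((v, ps) # os) ((v, y1, []) # relab y2 y1 (L @ pend_off v F)) S)"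
proof -
  have "(v, y1, C1) \<in> set F" "(v, y2, C2) \<in> set F"
    using arg_cong[OF at, of set] by (auto simp: set_eq_iff)
  then have "y1 \<in> Lb" "y2 \<in> Lb" using i unfolding state_inv_def by auto
  then have v: "v \<noteq> y1" "v \<noteq> y2" using inv_head_not_label[OF i] by auto
  have st: "acyc (add_mset {#v, y1#} (add_mset {#v, y2#} (st_edges ((v, ps) # os) (L @ pend_off v F) S)))"
    using ac S unfolding st_edges_split[OF at] by (simp add: st_edges_def)
  show ne: "y1 \<noteq> y2"
  proof
    assume "y1 = y2"
    then have "acyc (add_mset {#y1, v#} (add_mset {#v, y1#} (st_edges ((v, ps) # os) (L @ pend_off v F) S)))"
      using st by (simp add: add_mset_commute)
    then show False using v(1) unfolding acyc_contract[OF v(1)[symmetric]]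
      by (simp add: not_acyc_loop)
  qed
  show "acyc (st_edges ((v, ps) # os) ((v, y1, []) # relab y2 y1 (L @ pend_off v F)) S)"
    using st acyc_merge[OF ne v] S unfolding merge_edges[OF i at ne] by simp
qed

section \<open>Soundness and completeness of the branching\<close>

definition hits :: "nat set \<Rightarrow> nat list list \<Rightarrow> bool" where
  "hits S cls \<longleftrightarrow> (\<forall>c \<in> set cls. set c \<inter> S \<noteq> {})"

lemma hits_simps [simp]: "hits S []" "hits S (c # cls) \<longleftrightarrow> set c \<inter> S \<noteq> {} \<and> hits S cls"
  by (simp_all add: hits_def)

lemma branch_eqs:
  "pend_at v F = [] \<Longrightarrow> branch k ((v, ps) # os) F D cls = branch k os (pend_off v F) D cls"
  "pend_at v F = [(v, y, C)] \<Longrightarrow>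
     branch k ((v, ps) # os) F D cls = branch k os (push ps y (v # C) (pend_off v F)) D cls"
  "pend_at v F = (v, y1, C1) # (v, y2, C2) # L \<Longrightarrow> branch k ((v, ps) # os) F D cls =
     (case k of 0 \<Rightarrow> [] | Suc k' \<Rightarrow>
        branch k' os (pend_off v F) (v # D) cls @
        branch k' ((v, ps) # os) ((v, y2, C2) # L @ pend_off v F) D (C1 # cls) @
        branch k' ((v, ps) # os) ((v, y1, C1) # L @ pend_off v F) D (C2 # cls)) @
     (if y1 = y2 then [] else
        branch k ((v, ps) # os) ((v, y1, []) # relab y2 y1 (L @ pend_off v F)) D cls)"
  by (subst branch.simps(2), simp split: nat.split)+

text \<open>The sets described by a family are closed under supersets, so soundness is claimed for
  all of them, regardless of size. The data \<open>D\<close> and \<open>cls\<close> only grow along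
  the branching, which gives the last two conclusions.\<close>

lemma branch_sound:
  assumes "state_inv Lb os F" "(D', cls') \<in> set (branch k os F D cls)" "set D' \<subseteq> S" "hits S cls'"
  shows "acyc (st_edges os F S) \<and> set D \<subseteq> S \<and> hits S cls"
  using assms
proof (induction k os F D cls arbitrary: Lb rule: branch_induct)
  case (Nil k F D cls)
  then have "F = []" using inv_fst[OF Nil.prems(1)] by simp
  then show ?case using Nil by (auto simp: st_edges_def)
next
  case (drop k v ps os F D cls)
  then show ?case
    using acyc_drop[OF drop.prems(1) drop.hyps] drop.IH[OF inv_drop[OF drop.prems(1)]]
    by (simp add: branch_eqs(1))
next
  case (push k v ps os F D cls y C)
  then show ?case
    using acyc_push[OF push.prems(1) push.hyps] push.IH[OF inv_push[OF push.prems(1) push.hyps]]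
    by (simp add: branch_eqs(2))
next
  case (split k v ps os F D cls y1 C1 y2 C2 L)
  note i = split.prems(1) and at = split.hyps
  from split.prems(2) consider
      k' where "k = Suc k'" "(D', cls') \<in> set (branch k' os (pend_off v F) (v # D) cls)"
    | k' where "k = Suc k'" "(D', cls') \<in> set (branch k' ((v, ps) # os) ((v, y2, C2) # L @ pend_off v F)
        D (C1 # cls))"
    | k' where "k = Suc k'" "(D', cls') \<in> set (branch k' ((v, ps) # os) ((v, y1, C1) # L @ pend_off v F)
        D (C2 # cls))"
    | "y1 \<noteq> y2" "(D', cls') \<in> set (branch k ((v, ps) # os) ((v, y1, []) # relab y2 y1 (L @ pend_off v
        F)) D cls)"
    unfolding branch_eqs(3)[OF at] by (auto split: nat.splits if_splits)
  then show ?case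
  proof cases
    case 1
    from split.IH(1)[OF 1(1) inv_drop[OF i] 1(2) split.prems(3,4)]
    show ?thesis using acyc_hit_head[of v S ps os F] by simp
  next
    case 2
    from split.IH(2)[OF 2(1) inv_cut(1)[OF i at] 2(2) split.prems(3,4)]
    show ?thesis using acyc_hit_class(1)[OF at, of S] by simp
  next
    case 3
    from split.IH(3)[OF 3(1) inv_cut(2)[OF i at] 3(2) split.prems(3,4)]
    show ?thesis using acyc_hit_class(2)[OF at, of S] by simp
  next
    case 4
    from split.IH(4)[OF 4(1) inv_merge(1)[OF i at 4(1)] 4(2) split.prems(3,4)]
    show ?thesis using acyc_merge_sound[OF i at 4(1)] by blast
  qed
qed

text \<open>The vertices of \<open>C\<close> have been suppressed and occur nowhere else in the
  state. Once \<open>C\<close> is recorded as met, a witness may drop all of them, and if it met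
  \<open>C\<close> it becomes smaller: this pays for the unit of budget.\<close>

lemma st_edges_remove_class:
  assumes "set C \<inter> nodes os = {}" "fst ` set F \<subseteq> nodes os"
    "set C \<inter> set (concat (map (snd \<circ> snd) F)) = {}" "ordered os"
  shows "st_edges os F (S - set C) = st_edges os F S"
proof -
  have "pend_edges (S - set C) F = pend_edges S F"
    using assms(2,3)
  proof (induction F)
    case (Cons e F)
    obtain u y C' where e: "e = (u, y, C')" by (cases e)
    have "u \<notin> set C" using Cons.prems(1) assms(1) e by auto
    moreover have "set C' \<inter> (S - set C) = {} \<longleftrightarrow> set C' \<inter> S = {}"
      using Cons.prems(2) e by auto
    moreover have "pend_edges (S - set C) F = pend_edges S F"
      by (rule Cons.IH) (use Cons.prems in auto)
    ultimately show ?case unfolding e by simp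
  qed simp
  moreover have "ord_edges (S - set C) os = ord_edges S os"
    using assms(1,4)
  proof (induction os)
    case (Cons w os)
    obtain v ps where w: "w = (v, ps)" by (cases w)
    then have "set ps \<subseteq> nodes os" "set C \<inter> nodes os = {}" "v \<notin> set C" using Cons.prems by auto
    then have "filter (\<lambda>p. p \<notin> S - set C) ps = filter (\<lambda>p. p \<notin> S) ps"
      by (intro filter_cong) auto
    then have "oe (S - set C) v ps = oe S v ps" using \<open>v \<notin> set C\<close> unfolding oe_def by simp
    then show ?case using Cons w by simp
  qed simp
  ultimately show ?thesis by (simp add: st_edges_def)
qed

text \<open>Two sets are needed: \<open>S\<close> is the part of the witness not yet spent and
  shrinks with the budget, while the fixed \<open>S0\<close> remembers the whole witness, against
  which the final family is tested.\<close>

lemma branch_complete: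
  assumes "state_inv Lb os F" "finite S" "acyc (st_edges os F S)" "card S \<le> k" "S \<subseteq> S0" "set D \<subseteq> S0"
      "hits S0 cls"
  shows "\<exists>(D', cls') \<in> set (branch k os F D cls). set D' \<subseteq> S0 \<and> hits S0 cls'"
  using assms
proof (induction k os F D cls arbitrary: Lb S rule: branch_induct)
  case (Nil k F D cls)
  then show ?case by simp
next
  case (drop k v ps os F D cls)
  show ?case
    unfolding branch_eqs(1)[OF drop(1)]
    by (rule drop(2)[OF inv_drop[OF drop(3)] drop(4)])
      (use drop acyc_drop[OF drop(3,1)] in auto)
next
  case (push k v ps os F D cls y C)
  show ?case
    unfolding branch_eqs(2)[OF push(1)]
    by (rule push(2)[OF inv_push[OF push(3,1)] push(4)])
      (use push acyc_push[OF push(3,1)] in auto)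
next
  case (split k v ps os F D cls y1 C1 y2 C2 L)
  note i = split.prems(1) and at = split.hyps and IH = split.IH
  let ?thesis = "\<exists>(D', cls') \<in> set (branch k ((v, ps) # os) F D cls). set D' \<subseteq> S0 \<and> hits S0 cls'"
  have cut: "k = Suc (k - 1) \<and> card (S - set C) \<le> k - 1" if h: "set C \<inter> S \<noteq> {}" for C
  proof -
    obtain x where x: "x \<in> set C" "x \<in> S" using h by blast
    have "card (S - set C) \<le> card (S - {x})" using x split.prems(2) by (intro card_mono) auto
    moreover have "card (S - {x}) = card S - 1" "card S > 0"
      using x split.prems(2) card_gt_0_iff by auto
    ultimately show ?thesis using split.prems(4) by linarith
  qed
  have ord: "ordered ((v, ps) # os)" using i by (simp add: state_inv_def)
  consider "v \<in> S" | "set C1 \<inter> S \<noteq> {}" | "set C2 \<inter> S \<noteq> {}"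
    | "v \<notin> S" "set C1 \<inter> S = {}" "set C2 \<inter> S = {}" by blast
  then show ?thesis
  proof cases
    case 1
    have eq: "st_edges os (pend_off v F) (S - set [v]) = st_edges os (pend_off v F) S"
      using inv_drop[OF i] i
      by (intro st_edges_remove_class) (auto simp: state_inv_def)
    have c: "k = Suc (k - 1)" "card (S - set [v]) \<le> k - 1" using cut[of "[v]"] 1 by auto
    have "\<exists>(D', cls') \<in> set (branch (k - 1) os (pend_off v F) (v # D) cls). set D' \<subseteq> S0 \<and> hits S0 cls'"
      by (rule IH(1)[OF c(1) inv_drop[OF i], of "S - set [v]"])
        (use split.prems c(2) 1 eq acyc_hit_head[OF 1, of ps os F] in auto)
    then show ?thesis unfolding branch_eqs(3)[OF at] by (subst c(1)) auto
  next
    case 2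
    have eq: "st_edges ((v, ps) # os) ((v, y2, C2) # L @ pend_off v F) (S - set C1) =
        st_edges ((v, ps) # os) F S"
      unfolding acyc_hit_class(1)[OF at 2]
      by (rule st_edges_remove_class[OF inv_cut(5)[OF i at] inv_fst[OF inv_cut(1)[OF i at]]
          inv_cut(3)[OF i at] ord])
    have c: "k = Suc (k - 1)" "card (S - set C1) \<le> k - 1" using cut[OF 2] by auto
    have "\<exists>(D', cls') \<in> set (branch (k - 1) ((v, ps) # os) ((v, y2, C2) # L @ pend_off v F) D (C1 # cls)).
        set D' \<subseteq> S0 \<and> hits S0 cls'"
      by (rule IH(2)[OF c(1) inv_cut(1)[OF i at], of "S - set C1"])
        (use split.prems c(2) 2 eq in auto)
    then show ?thesis unfolding branch_eqs(3)[OF at] by (subst c(1)) auto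
  next
    case 3
    have eq: "st_edges ((v, ps) # os) ((v, y1, C1) # L @ pend_off v F) (S - set C2) =
        st_edges ((v, ps) # os) F S"
      unfolding acyc_hit_class(2)[OF at 3]
      by (rule st_edges_remove_class[OF inv_cut(6)[OF i at] inv_fst[OF inv_cut(2)[OF i at]]
          inv_cut(4)[OF i at] ord])
    have c: "k = Suc (k - 1)" "card (S - set C2) \<le> k - 1" using cut[OF 3] by auto
    have "\<exists>(D', cls') \<in> set (branch (k - 1) ((v, ps) # os) ((v, y1, C1) # L @ pend_off v F) D (C2 # cls)).
        set D' \<subseteq> S0 \<and> hits S0 cls'"
      by (rule IH(3)[OF c(1) inv_cut(2)[OF i at], of "S - set C2"])
        (use split.prems c(2) 3 eq in auto)
    then show ?thesis unfolding branch_eqs(3)[OF at] by (subst c(1)) auto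
  next
    case 4
    note m = acyc_merge_complete[OF i at 4 split.prems(3)]
    have "\<exists>(D', cls') \<in> set (branch k ((v, ps) # os) ((v, y1, []) # relab y2 y1 (L @ pend_off v F)) D cls).
        set D' \<subseteq> S0 \<and> hits S0 cls'"
      by (rule IH(4)[OF m(1) inv_merge(1)[OF i at m(1)] split.prems(2) m(2)])
        (use split.prems in auto)
    then show ?thesis unfolding branch_eqs(3)[OF at] using m(1) by auto
  qed
qed

section \<open>Weight and size of the enumerated families\<close>

definition weight :: "family list \<Rightarrow> nat" where
  "weight fs = sum_list (map (\<lambda>(D, cls). 2 ^ length cls) fs)"

lemma weight_simps [simp]:
  "weight [] = 0" "weight ((D, cls) # fs) = 2 ^ length cls + weight fs"
  "weight (fs @ fs') = weight fs + weight fs'"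
  by (simp_all add: weight_def)

text \<open>A merger needs two distinct labels, so the potential \<open>p\<close> is positive
  beforehand and can be lowered by one.\<close>

lemma card_labels_merge:
  assumes "state_inv Lb ((v, ps) # os) F" "pend_at v F = (v, y1, C1) # (v, y2, C2) # L" "y1 \<noteq> y2"
      "card Lb \<le> Suc p"
  obtains p' where "p = Suc p'" "card (Lb - {y2}) \<le> Suc p'"
proof -
  have fin: "finite Lb" using assms(1) by (simp add: state_inv_def)
  have "{y1, y2} \<subseteq> Lb" using inv_merge(2,3)[OF assms(1-3)] by blast
  then have "card {y1, y2} \<le> card Lb" by (rule card_mono[OF fin])
  then obtain p' where "p = Suc p'" using assms(3,4) by (cases p) auto
  moreover have "card (Lb - {y2}) \<le> Suc p'"
    using inv_merge(3)[OF assms(1-3)] fin assms(4) \<open>p = Suc p'\<close> by simp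
  ultimately show thesis using that by blast
qed

text \<open>
  The weight \<open>10\<^sup>k 2\<^sup>p\<close> solves the recurrence: deleting \<open>v\<close> costs one unit of budget, hitting a class
      costs one unit
  and doubles the later hitting set table, merging reduces the number of components, and
  \<open>(1 + 2 + 2) / 10 + 1 / 2 = 1\<close>.
\<close>

lemma branch_weight:
  assumes "state_inv Lb os F" "card Lb \<le> Suc p"
  shows "weight (branch k os F D cls) \<le> 2 ^ length cls * 10 ^ k * 2 ^ p"
  using assms
proof (induction k os F D cls arbitrary: Lb p rule: branch_induct)
  case (split k v ps os F D cls y1 C1 y2 C2 L)
  note i = split.prems(1) and at = split.hyps and IH = split.IH
  let ?W = "2 ^ length cls :: nat"
  have m: "weight (if y1 = y2 then [] else
        branch k ((v, ps) # os) ((v, y1, []) # relab y2 y1 (L @ pend_off v F)) D cls) * 2 \<le>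
            ?W * 10 ^ k * 2 ^ p"
  proof (cases "y1 = y2")
    case False
    obtain p' where p': "p = Suc p'" "card (Lb - {y2}) \<le> Suc p'"
      using card_labels_merge[OF i at False split.prems(2)] by blast
    from IH(4)[OF False inv_merge(1)[OF i at False] p'(2)] show ?thesis using False p'(1) by simp
  qed simp
  show ?case
  proof (cases k)
    case 0
    then show ?thesis using m unfolding branch_eqs(3)[OF at] by simp
  next
    case (Suc k')
    have "weight (branch k' os (pend_off v F) (v # D) cls) \<le> ?W * 10 ^ k' * 2 ^ p"
      using IH(1)[OF Suc inv_drop[OF i] split.prems(2)] .
    moreover have "weight (branch k' ((v, ps) # os) ((v, y2, C2) # L @ pend_off v F) D (C1 # cls))
        \<le> 2 * (?W * 10 ^ k' * 2 ^ p)"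
      using IH(2)[OF Suc inv_cut(1)[OF i at] split.prems(2)] by simp
    moreover have "weight (branch k' ((v, ps) # os) ((v, y1, C1) # L @ pend_off v F) D (C2 # cls))
        \<le> 2 * (?W * 10 ^ k' * 2 ^ p)"
      using IH(3)[OF Suc inv_cut(2)[OF i at] split.prems(2)] by simp
    moreover have "?W * 10 ^ k * 2 ^ p = 10 * (?W * 10 ^ k' * 2 ^ p)" using Suc by simp
    ultimately show ?thesis using m unfolding branch_eqs(3)[OF at] Suc nat.case weight_simps
      by linarith
  qed
next
  case (drop k v ps os F D cls)
  show ?case unfolding branch_eqs(1)[OF drop(1)] by (rule drop(2)[OF inv_drop[OF drop(3)] drop(4)])
next
  case (push k v ps os F D cls y C)
  show ?case unfolding branch_eqs(2)[OF push(1)] by (rule push(2)[OF inv_push[OF push(3,1)] push(4)])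
qed simp

text \<open>A class grows by one vertex only when a vertex leaves the order, so the sum of the two
  lengths never increases. Each unit of budget adds one vertex to \<open>D\<close> or one class to
  \<open>cls\<close>.\<close>

lemma branch_bounds:
  assumes "(D', cls') \<in> set (branch k os F D cls)"
    and "\<forall>e \<in> set F. length (snd (snd e)) + length os \<le> N \<and> set (snd (snd e)) \<subseteq> V" "nodes os \<subseteq> V"
    and "set D \<subseteq> V" "\<forall>c \<in> set cls. length c \<le> N \<and> set c \<subseteq> V"
  shows "set D' \<subseteq> V \<and> (\<forall>c \<in> set cls'. length c \<le> N \<and> set c \<subseteq> V) \<and>
     length D' \<le> length D + k \<and> length cls' \<le> length cls + k"
  using assms
proof (induction k os F D cls rule: branch_induct)
  case (Nil k F D cls)
  then show ?case by simp
next
  case (drop k v ps os F D cls)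
  have "\<forall>e \<in> set (pend_off v F). length (snd (snd e)) + length os \<le> N \<and> set (snd (snd e)) \<subseteq> V"
    using drop.prems(2) by auto
  then show ?case using drop by (simp add: branch_eqs(1))
next
  case (push k v ps os F D cls y C)
  have "(v, y, C) \<in> set F" using arg_cong[OF push(1), of set] by auto
  then have C: "length C + length os < N" "set C \<subseteq> V" using push.prems(2) by force+
  have "\<forall>e \<in> set (push ps y (v # C) (pend_off v F)). length (snd (snd e)) + length os \<le> N \<and>
      set (snd (snd e)) \<subseteq> V"
  proof
    fix e assume "e \<in> set (push ps y (v # C) (pend_off v F))"
    then have "e \<in> set F \<or> snd (snd e) = v # C" by (auto simp: push_def split: list.splits)
    then show "length (snd (snd e)) + length os \<le> N \<and> set (snd (snd e)) \<subseteq> V"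
      using push.prems(2,3) C by force
  qed
  from push(2)[OF push.prems(1)[unfolded branch_eqs(2)[OF push(1)]] this _ push.prems(4,5)]
  show ?case using push.prems(3) by simp
next
  case (split k v ps os F D cls y1 C1 y2 C2 L)
  note at = split.hyps and IH = split.IH and pr = split.prems
  have "set F = set (pend_at v F) \<union> set (pend_off v F)" by auto
  then have s: "set F = set ((v, y1, C1) # (v, y2, C2) # L @ pend_off v F)"
    unfolding at by (simp only: set_append[symmetric] append_Cons)
  have R: "\<forall>e \<in> set ((v, y1, C1) # (v, y2, C2) # L @ pend_off v F).
      length (snd (snd e)) + length ((v, ps) # os) \<le> N \<and> set (snd (snd e)) \<subseteq> V"
    using pr(2) unfolding s .
  from pr(1) consider
      k' where "k = Suc k'" "(D', cls') \<in> set (branch k' os (pend_off v F) (v # D) cls)"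
    | k' where "k = Suc k'" "(D', cls') \<in> set (branch k' ((v, ps) # os) ((v, y2, C2) # L @ pend_off v F)
        D (C1 # cls))"
    | k' where "k = Suc k'" "(D', cls') \<in> set (branch k' ((v, ps) # os) ((v, y1, C1) # L @ pend_off v F)
        D (C2 # cls))"
    | "y1 \<noteq> y2" "(D', cls') \<in> set (branch k ((v, ps) # os) ((v, y1, []) # relab y2 y1 (L @ pend_off v
        F)) D cls)"
    unfolding branch_eqs(3)[OF at] by (auto split: nat.splits if_splits)
  then show ?case
  proof cases
    case 1
    have "\<forall>e \<in> set (pend_off v F). length (snd (snd e)) + length os \<le> N \<and> set (snd (snd e)) \<subseteq> V"
        using pr(2) by fastforce
    from IH(1)[OF 1(1,2) this] pr show ?thesis using 1(1) by simp
  next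
    case 2
    from IH(2)[OF 2(1,2)] R pr show ?thesis using 2(1) by auto
  next
    case 3
    from IH(3)[OF 3(1,2)] R pr show ?thesis using 3(1) by auto
  next
    case 4
    have "length (snd (snd e)) + length ((v, ps) # os) \<le> N \<and> set (snd (snd e)) \<subseteq> V"
      if "e \<in> set ((v, y1, []) # relab y2 y1 (L @ pend_off v F))" for e
    proof (cases "e = (v, y1, [])")
      case True
      then show ?thesis using R by auto
    next
      case False
      then have "e \<in> set (relab y2 y1 (L @ pend_off v F))" using that by simp
      then obtain e' where "e' \<in> set (L @ pend_off v F)" "snd (snd e) = snd (snd e')"
        by (rule relab_elem)
      then show ?thesis using R by (metis list.set_intros(2))
    qed
    from IH(4)[OF 4] this pr show ?thesis by blast
  qed
qed

section \<open>The algorithm\<close>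

definition pair_edges :: "(nat \<times> nat) list \<Rightarrow> nat multiset multiset" where
  "pair_edges E = mset (map (\<lambda>(a, b). {#a, b#}) E)"

lemma pair_edges_simps [simp]:
  "pair_edges [] = {#}" "pair_edges ((a, b) # E) = add_mset {#a, b#} (pair_edges E)"
  by (simp_all add: pair_edges_def)

definition avoid :: "nat set \<Rightarrow> (nat \<times> nat) list \<Rightarrow> (nat \<times> nat) list" where
  "avoid S E = filter (\<lambda>(a, b). a \<notin> S \<and> b \<notin> S) E"

lemma avoid_simps [simp]:
  "avoid S [] = []" "avoid S ((a, b) # E) = (if a \<notin> S \<and> b \<notin> S then (a, b) # avoid S E else avoid S E)"
  by (simp_all add: avoid_def)

fun nbrs :: "nat \<Rightarrow> (nat \<times> nat) list \<Rightarrow> nat list" where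
  "nbrs v [] = []"
| "nbrs v ((a, b) # E) = (if a = v then b # nbrs v E else if b = v then a # nbrs v E else nbrs v E)"

fun pick :: "nat list \<Rightarrow> (nat \<times> nat) list \<Rightarrow> nat option" where
  "pick [] E = None"
| "pick (v # vs) E = (if length (nbrs v E) \<le> 1 then Some v else pick vs E)"

lemma pick_Some: "pick vs E = Some v \<Longrightarrow> v \<in> set vs \<and> length (nbrs v E) \<le> 1"
  by (induction vs) (auto split: if_splits)

lemma pick_None: "pick vs E = None \<Longrightarrow> v \<in> set vs \<Longrightarrow> length (nbrs v E) > 1"
  by (induction vs) (auto split: if_splits)

function elim_order :: "nat list \<Rightarrow> (nat \<times> nat) list \<Rightarrow> (nat \<times> nat list) list" where
  "elim_order vs E = (case pick vs E of None \<Rightarrow> [] |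
     Some v \<Rightarrow> (v, nbrs v E) # elim_order (filter (\<lambda>x. x \<noteq> v) vs) (avoid {v} E))"
  by auto
termination
  by (relation "measure (\<lambda>(vs, E). length vs)")
    (auto dest!: pick_Some intro: length_filter_less)

declare elim_order.simps [simp del]

text \<open>Only an inequality, since a loop contributes one entry to the list but two to the
  degree.\<close>

lemma length_nbrs_le: "length (nbrs v E) \<le> count (\<Sum>\<^sub># (pair_edges E)) v"
  by (induction v E rule: nbrs.induct) auto

lemma set_nbrs: "p \<in> set (nbrs v E) \<Longrightarrow> (v, p) \<in> set E \<or> (p, v) \<in> set E"
  by (induction v E rule: nbrs.induct) (auto split: if_splits)

lemma oe_Cons: "oe S v (p # ps) = (if v \<notin> S \<and> p \<notin> S then {#{#v, p#}#} else {#}) + oe S v ps"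
  by (simp add: oe_def)

lemma pair_edges_split_at:
  "pair_edges (avoid S E) = oe S v (nbrs v E) + pair_edges (avoid S (avoid {v} E))"
proof (induction v E rule: nbrs.induct)
  case (1 v)
  then show ?case by (simp add: oe_def)
next
  case (2 v a b E)
  then show ?case by (auto simp: oe_Cons add_mset_commute)
qed

lemma loop_free:
  assumes "acyc (pair_edges E)" "(a, b) \<in> set E"
  shows "a \<noteq> b"
proof
  assume "a = b"
  then have "{#a, a#} \<in># pair_edges E" using assms(2) by (force simp: pair_edges_def)
  then show False using assms(1) not_acyc_loop by (metis multi_member_split)
qed

lemma pair_edges_avoid_subset: "pair_edges (avoid S E) \<subseteq># pair_edges E"
  unfolding pair_edges_def avoid_def by (simp add: image_mset_subseteq_mono)

text \<open>A nonempty acyclic edge multiset has a vertex of degree one, so \<open>pick\<close>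
  fails only when no vertex is left. The edge equation holds for every \<open>S\<close> at once;
  hence one order, computed before the branching, serves all deletions.\<close>

lemma order_correct:
  assumes "acyc (pair_edges E)" "\<forall>(a, b) \<in> set E. a \<in> set vs \<and> b \<in> set vs"
  shows "ordered (elim_order vs E) \<and> nodes (elim_order vs E) = set vs \<and> length (elim_order vs E) \<le> length vs \<and>
    (\<forall>S. ord_edges S (elim_order vs E) = pair_edges (avoid S E))"
  using assms
proof (induction vs E rule: elim_order.induct)
  case (1 vs E)
  show ?case
  proof (cases "pick vs E")
    case None
    have "vs = []"
    proof (rule ccontr)
      assume "vs \<noteq> []"
      moreover have "E \<noteq> []" using \<open>vs \<noteq> []\<close> pick_None[OF None, of "hd vs"] by fastforce
      then have "pair_edges E \<noteq> {#}" by (cases E) auto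
      then obtain v where v: "count (\<Sum>\<^sub># (pair_edges E)) v = 1"
        using 1(2) unfolding acyc_def by blast
      then have "v \<in># \<Sum>\<^sub># (pair_edges E)" by (metis count_eq_zero_iff zero_neq_one)
      then have "v \<in> set vs" using 1(3) unfolding pair_edges_def by auto
      from pick_None[OF None this] length_nbrs_le[of v E] v show False by simp
    qed
    moreover have "E = []" using 1(3) \<open>vs = []\<close> by (cases E) auto
    ultimately show ?thesis by (simp add: elim_order.simps)
  next
    case (Some v)
    note pk = pick_Some[OF Some]
    let ?vs = "filter (\<lambda>x. x \<noteq> v) vs" and ?E = "avoid {v} E"
    have "acyc (pair_edges ?E)"
      using 1(2) pair_edges_avoid_subset acyc_antimono by blast
    moreover have "\<forall>(a, b) \<in> set ?E. a \<in> set ?vs \<and> b \<in> set ?vs"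
      using 1(3) by (auto simp: avoid_def)
    ultimately have ih: "ordered (elim_order ?vs ?E) \<and> nodes (elim_order ?vs ?E) = set ?vs \<and>
        length (elim_order ?vs ?E) \<le> length ?vs \<and>
        (\<forall>S. ord_edges S (elim_order ?vs ?E) = pair_edges (avoid S ?E))"
      using 1(1)[OF Some] by blast
    have eq: "elim_order vs E = (v, nbrs v E) # elim_order ?vs ?E" using Some by (simp add: elim_order.simps)
    have "set (nbrs v E) \<subseteq> set ?vs"
      using 1(3) set_nbrs[of _ v E] loop_free[OF 1(2)] by fastforce
    moreover have "Suc (length ?vs) \<le> length vs" 
      using pk length_filter_less[of v vs "\<lambda>x. x \<noteq> v"] by auto
    ultimately show ?thesis
      using ih pk pair_edges_split_at[of _ E v] unfolding eq by (auto simp del: set_filter simp: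
          insert_absorb) auto
  qed
qed

section \<open>Contraction of the undeletable vertices and the initial state of a colour\<close>

definition relab_pairs :: "nat \<Rightarrow> nat \<Rightarrow> (nat \<times> nat) list \<Rightarrow> (nat \<times> nat) list" where
  "relab_pairs b a E = map (\<lambda>(x, y). ((id(b := a)) x, (id(b := a)) y)) E"

lemma length_relab_pairs [simp]: "length (relab_pairs b a E) = length E"
  by (simp add: relab_pairs_def)

lemma pair_edges_relab:
  "pair_edges (relab_pairs b a E) = image_mset (image_mset (id(b := a))) (pair_edges E)"
  by (induction E) (auto simp: relab_pairs_def)

text \<open>Edges inside \<open>Y\<close> are contracted one at a time. A loop appears when the kept
  vertices already induce a cycle; then this guess fails, which is reported by
  \<open>None\<close>.\<close>

function contr :: "(nat \<times> nat) list \<Rightarrow> pend list \<Rightarrow> pend list option" where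
  "contr [] F = Some F"
| "contr ((a, b) # E) F = (if a = b then None else contr (relab_pairs b a E) (relab b a F))"
  by pat_completeness auto
termination by (relation "measure (\<lambda>(E, F). length E)") auto

lemma map_fst_relab: "map fst (relab b a F) = map fst F"
  by (induction F) (auto simp: relab_def)

lemma contr_shape:
  "contr E F = Some F' \<Longrightarrow> map fst F' = map fst F \<and> map (snd \<circ> snd) F' = map (snd \<circ> snd) F"
  by (induction E F rule: contr.induct)
    (auto split: if_splits simp: map_classes_relab map_fst_relab)

lemma contr_labels:
  assumes "contr E F = Some F'" "\<forall>(a, b) \<in> set E. a \<in> Lb \<and> b \<in> Lb" "\<forall>e \<in> set F. fst (snd e) \<in> Lb"
  shows "\<forall>e \<in> set F'. fst (snd e) \<in> Lb"
  using assms
proof (induction E F rule: contr.induct)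
  case (2 a b E F)
  then have "a \<noteq> b" by auto
  moreover have "\<forall>(x, y) \<in> set (relab_pairs b a E). x \<in> Lb \<and> y \<in> Lb"
    using 2(3) by (auto simp: relab_pairs_def)
  moreover have "\<forall>e \<in> set (relab b a F). fst (snd e) \<in> Lb"
    using 2(3,4) by (auto simp: relab_def)
  ultimately show ?case using 2 by simp
qed simp

text \<open>\<open>Q\<close> takes the place of the forest outside \<open>Y\<close>. It shares no
  vertex with the labels, so the contractions leave it alone.\<close>

lemma contr_acyc:
  assumes "\<forall>(a, b) \<in> set E. a \<in> Lb \<and> b \<in> Lb" "Lb \<inter> fst ` set F = {}" "set_mset (\<Sum>\<^sub># Q) \<inter> Lb = {}"
  shows "acyc (pair_edges E + pend_edges S F + Q) \<longleftrightarrow>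
    (case contr E F of None \<Rightarrow> False | Some F' \<Rightarrow> acyc (pend_edges S F' + Q))"
  using assms
proof (induction E F rule: contr.induct)
  case (2 a b E F)
  show ?case
  proof (cases "a = b")
    case True
    then show ?thesis by (simp add: not_acyc_loop)
  next
    case False
    have ab: "a \<in> Lb" "b \<in> Lb" using 2(2) by auto
    have 1: "\<forall>(x, y) \<in> set (relab_pairs b a E). x \<in> Lb \<and> y \<in> Lb"
      using 2(2) by (auto simp: relab_pairs_def)
    have 2: "Lb \<inter> fst ` set (relab b a F) = {}"
      using 2(3) map_fst_relab[of b a F] by (metis set_map)
    have bF: "b \<notin> fst ` set F" "b \<notin># \<Sum>\<^sub># Q" using ab \<open>Lb \<inter> fst ` set F = {}\<close> "2.prems"(3) by auto
    have "acyc (pair_edges ((a, b) # E) + pend_edges S F + Q) \<longleftrightarrow>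
       acyc (add_mset {#a, b#} (pair_edges E + pend_edges S F + Q))" by simp
    also have "\<dots> \<longleftrightarrow> acyc (pair_edges (relab_pairs b a E) + pend_edges S (relab b a F) + Q)"
      unfolding acyc_contract[OF False]
      by (simp add: pair_edges_relab pend_edges_relab[OF bF(1)] image_mset_image_mset_id[OF bF(2)])
    also have "\<dots> \<longleftrightarrow> (case contr (relab_pairs b a E) (relab b a F) of None \<Rightarrow> False
        | Some F' \<Rightarrow> acyc (pend_edges S F' + Q))"
      using "2.IH"[OF False 1 2 "2.prems"(3)] .
    finally show ?thesis using False by simp
  qed
qed simp

definition colour_pairs :: "nat \<Rightarrow> nat list \<Rightarrow> (nat \<times> nat \<times> nat) list \<Rightarrow> (nat \<times> nat) list" where
  "colour_pairs c X es = map snd (filter (\<lambda>(i, u, v). i = c \<and> u \<notin> set X \<and> v \<notin> set X) es)"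

definition inner_pairs :: "nat list \<Rightarrow> (nat \<times> nat) list \<Rightarrow> (nat \<times> nat) list" where
  "inner_pairs Y E = filter (\<lambda>(a, b). a \<in> set Y \<and> b \<in> set Y) E"

fun cross_pairs :: "nat list \<Rightarrow> (nat \<times> nat) list \<Rightarrow> pend list" where
  "cross_pairs Y [] = []"
| "cross_pairs Y ((a, b) # E) =
    (if a \<in> set Y then (if b \<in> set Y then cross_pairs Y E else (b, a, []) # cross_pairs Y E)
     else (if b \<in> set Y then (a, b, []) # cross_pairs Y E else cross_pairs Y E))"

lemma cross_pairs_elem:
  "e \<in> set (cross_pairs Y E) \<Longrightarrow> fst e \<notin> set Y \<and> fst (snd e) \<in> set Y \<and> snd (snd e) = [] \<and>
     ((fst e, fst (snd e)) \<in> set E \<or> (fst (snd e), fst e) \<in> set E)"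
  by (induction Y E rule: cross_pairs.induct) (auto split: if_splits)

lemma length_cross_pairs: "length (cross_pairs Y E) \<le> length E"
  by (induction Y E rule: cross_pairs.induct) auto

lemma pair_edges_classify:
  assumes "S \<inter> set Y = {}"
  shows "pair_edges (avoid S E) =
     pair_edges (inner_pairs Y E) + pend_edges S (cross_pairs Y E) + pair_edges (avoid S (avoid (set Y) E))"
  using assms by (induction Y E rule: cross_pairs.induct)
    (auto simp: inner_pairs_def add_mset_commute disjoint_iff)

lemma filter_mset_subset_filter:
  assumes "\<And>x. P x \<Longrightarrow> Q x" "M \<subseteq># N"
  shows "filter_mset P M \<subseteq># filter_mset Q N"
proof -
  have "filter_mset P M = filter_mset P (filter_mset Q M)"
    using assms(1) by (metis (mono_tags, lifting) filter_filter_mset filter_mset_cong)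
  also have "\<dots> \<subseteq># filter_mset Q M" by (rule multiset_filter_subset)
  also have "\<dots> \<subseteq># filter_mset Q N" using assms(2) by (rule multiset_filter_mono)
  finally show ?thesis .
qed

text \<open>The inclusion needed for soundness, where the set is not known to avoid
  \<open>Y\<close>. Pending edges do not test their labels, so vertices of \<open>S\<close> in
  \<open>Y\<close> can only remove further edges on the left.\<close>

lemma pair_edges_classify_subset:
  "pair_edges (avoid S E) \<subseteq>#
     pair_edges (inner_pairs Y E) + pend_edges S (cross_pairs Y E) + pair_edges (avoid S (avoid (set Y) E))"
proof -
  have "pair_edges (avoid S E) \<subseteq># pair_edges (avoid (S - set Y) E)"
    unfolding pair_edges_def avoid_def mset_map mset_filter
    by (intro image_mset_subseteq_mono filter_mset_subset_filter) auto
  moreover have "pend_edges (S - set Y) (cross_pairs Y E) = pend_edges S (cross_pairs Y E)"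
    by (induction Y E rule: cross_pairs.induct) auto
  moreover have "avoid (S - set Y) (avoid (set Y) E) = avoid S (avoid (set Y) E)"
    unfolding avoid_def filter_filter by (intro filter_cong) auto
  ultimately show ?thesis using pair_edges_classify[of "S - set Y" Y E]
    by (simp add: Int_commute)
qed

definition setup_colour :: "nat \<Rightarrow> nat list \<Rightarrow> nat list \<Rightarrow> (nat \<times> nat \<times> nat) list \<Rightarrow> nat list \<Rightarrow>
    ((nat \<times> nat list) list \<times> pend list) option" where
  "setup_colour c X Y es vs = map_option (Pair (elim_order vs (avoid (set Y) (colour_pairs c X es))))
     (contr (inner_pairs Y (colour_pairs c X es)) (cross_pairs Y (colour_pairs c X es)))"

lemma col_edges_pairs:
  "col_edges c (set X \<union> S) es = pair_edges (avoid S (colour_pairs c X es))"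
  by (induction es) (auto simp: col_edges_def colour_pairs_def)

text \<open>Only the completeness parts ask \<open>S\<close> to avoid \<open>Y\<close>: a sought
  solution agrees with the guess, whereas soundness has to hold for whatever set the hitting set
  step produces.\<close>

lemma setup_colour_correct:
  fixes Y X :: "nat list" and c :: nat and es :: "(nat \<times> nat \<times> nat) list"
  defines "E \<equiv> colour_pairs c X es"
  assumes ac: "acyc (pair_edges (avoid (set Y) E))"
    and ends: "\<forall>(a, b) \<in> set E. a \<in> set vs \<union> set Y \<and> b \<in> set vs \<union> set Y"
    and vs: "set vs \<inter> set Y = {}"
  shows "setup_colour c X Y es vs = None \<Longrightarrow> S \<inter> set Y = {} \<Longrightarrow> \<not> acyc (pair_edges (avoid S E))"
    and "setup_colour c X Y es vs = Some (os, F) \<Longrightarrow> acyc (st_edges os F S) \<Longrightarrow> acyc (pair_edges (avoid S E))"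
    and "setup_colour c X Y es vs = Some (os, F) \<Longrightarrow> S \<inter> set Y = {} \<Longrightarrow>
      acyc (pair_edges (avoid S E)) \<Longrightarrow> acyc (st_edges os F S)"
    and "setup_colour c X Y es vs = Some (os, F) \<Longrightarrow> state_inv (set Y) os F \<and> nodes os = set vs \<and>
      length os \<le> length vs \<and> length F \<le> length es \<and> (\<forall>e \<in> set F. snd (snd e) = [])"
proof -
  have ff: "\<forall>(a, b) \<in> set (avoid (set Y) E). a \<in> set vs \<and> b \<in> set vs"
    using ends by (auto simp: avoid_def)
  note ord = order_correct[OF ac ff]
  have in_ff: "set_mset (\<Sum>\<^sub># (pair_edges (avoid S (avoid (set Y) E)))) \<inter> set Y = {}" for S
    by (auto simp: pair_edges_def avoid_def)
  have inn: "\<forall>(a, b) \<in> set (inner_pairs Y E). a \<in> set Y \<and> b \<in> set Y" by (auto simp: inner_pairs_def)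
  have crs: "set Y \<inter> fst ` set (cross_pairs Y E) = {}" using cross_pairs_elem by fastforce
  note con = contr_acyc[OF inn crs in_ff]
  show "\<not> acyc (pair_edges (avoid S E))" if "setup_colour c X Y es vs = None" "S \<inter> set Y = {}"
    using that con[of S S] pair_edges_classify[OF that(2), of E]
    by (auto simp: setup_colour_def E_def split: option.splits)
  {
    assume so: "setup_colour c X Y es vs = Some (os, F)"
    then have F: "contr (inner_pairs Y E) (cross_pairs Y E) = Some F"
      and os: "os = elim_order vs (avoid (set Y) E)" by (auto simp: setup_colour_def E_def)
    have st: "acyc (st_edges os F S) \<longleftrightarrow> acyc (pair_edges (inner_pairs Y E) +
        pend_edges S (cross_pairs Y E) + pair_edges (avoid S (avoid (set Y) E)))"
      using con[of S S] ord by (simp add: F st_edges_def os add.commute)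
    show "acyc (pair_edges (avoid S E))" if "acyc (st_edges os F S)"
      using that pair_edges_classify_subset acyc_antimono unfolding st by blast
    show "acyc (st_edges os F S)" if "S \<inter> set Y = {}" "acyc (pair_edges (avoid S E))"
      using that(2) unfolding st pair_edges_classify[OF that(1), of E] .
    note sh = contr_shape[OF F]
    have lenF: "length F = length (cross_pairs Y E)"
      using sh by (metis length_map)
    have "(snd \<circ> snd) ` set F = (snd \<circ> snd) ` set (cross_pairs Y E)"
      "fst ` set F = fst ` set (cross_pairs Y E)"
      using sh by (metis set_map)+
    moreover have "(snd \<circ> snd) ` set (cross_pairs Y E) \<subseteq> {[]}"
      using cross_pairs_elem[of _ Y E] by auto
    moreover have "fst ` set (cross_pairs Y E) \<subseteq> set vs"
      using cross_pairs_elem[of _ Y E] ends by fastforce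
    ultimately have F': "(snd \<circ> snd) ` set F \<subseteq> {[]}" "fst ` set F \<subseteq> set vs" by auto
    have labs: "\<forall>e \<in> set F. fst (snd e) \<in> set Y"
      using contr_labels[OF F inn] cross_pairs_elem[of _ Y E] by blast
    have "concat (map (snd \<circ> snd) F) = []" using F'(1) by auto
    then have dist: "distinct (concat (map (snd \<circ> snd) F))" by (metis distinct.simps(1))
    have "length F \<le> length es"
      using lenF length_cross_pairs[of Y E] unfolding E_def colour_pairs_def
      by (metis (no_types, lifting) le_trans length_filter_le length_map)
    then show "state_inv (set Y) os F \<and> nodes os = set vs \<and> length os \<le> length vs \<and> length F \<le> length es \<and>
        (\<forall>e \<in> set F. snd (snd e) = [])"
      using ord vs F' dist labs unfolding state_inv_def os by (auto simp: image_subset_iff)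
  }
qed

section \<open>Combination of the colours, hitting sets and the compression loop\<close>

definition expand :: "nat \<Rightarrow> (nat \<times> nat list) list \<Rightarrow> pend list \<Rightarrow> family list \<Rightarrow> family list" where
  "expand k os F fs = concat (map (\<lambda>(D, cls). branch k os F D cls) fs)"

text \<open>Each colour extends every family found so far, again with the full budget
  \<open>k\<close>, because a vertex paid for in one colour may be needed in the next one as
  well.\<close>

primrec all_colours :: "nat list \<Rightarrow> nat list \<Rightarrow> (nat \<times> nat \<times> nat) list \<Rightarrow> nat list \<Rightarrow> nat \<Rightarrow> nat \<Rightarrow>
    family list \<Rightarrow> family list" where
  "all_colours X Y es vs k 0 fs = fs"
| "all_colours X Y es vs k (Suc c) fs = all_colours X Y es vs k c
     (case setup_colour c X Y es vs of None \<Rightarrow> [] | Some (os, F) \<Rightarrow> expand k os F fs)"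

fun best :: "nat list option \<Rightarrow> nat list option \<Rightarrow> nat list option" where
  "best None b = b"
| "best (Some a) None = Some a"
| "best (Some a) (Some b) = (if length a \<le> length b then Some a else Some b)"

text \<open>Taken literally this recursion is exponential in the number of vertices. However, only
  subsequences of the initial classes occur as \<open>R\<close>, so the program tabulates the values
  over these subsequences.\<close>

fun min_hit :: "nat list \<Rightarrow> nat list list \<Rightarrow> nat list option" where
  "min_hit [] R = (if R = [] then Some [] else None)"
| "min_hit (v # vs) R = best (min_hit vs R) (map_option (Cons v) (min_hit vs (filter (\<lambda>c. v \<notin> set c) R)))"

primrec down :: "nat \<Rightarrow> nat list" where
  "down 0 = []"
| "down (Suc n) = n # down n"

text \<open>Classes already met by \<open>D\<close> need no further vertex. Duplicates are removed
  before the size test, since different colours may have put the same vertex into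
  \<open>D\<close>.\<close>

definition finish :: "nat \<Rightarrow> nat \<Rightarrow> nat list \<Rightarrow> family \<Rightarrow> nat list option" where
  "finish n k X f = (case min_hit (down n) (filter (\<lambda>c. set c \<inter> set (fst f) = {}) (snd f)) of
     None \<Rightarrow> None
   | Some w \<Rightarrow> (let R = remdups (X @ fst f @ w) in if length R \<le> k then Some R else None))"

fun search :: "nat \<Rightarrow> nat \<Rightarrow> nat list \<Rightarrow> family list \<Rightarrow> nat list option" where
  "search n k X [] = None"
| "search n k X (f # fs) = (case finish n k X f of None \<Rightarrow> search n k X fs | Some R \<Rightarrow> Some R)"

text \<open>Two budgets: \<open>k0\<close> bounds the whole solution and is tested at the end,
  \<open>k\<close> is what remains for the branching after the guessed deletions.\<close>

definition leaf :: "nat \<Rightarrow> nat \<Rightarrow> nat \<Rightarrow> (nat \<times> nat \<times> nat) list \<Rightarrow> nat list \<Rightarrow> nat \<Rightarrow> nat list \<Rightarrow> nat list \<Rightarrow>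
    nat list option" where
  "leaf n \<alpha> k0 es vs k X Y = search n k0 X (all_colours X Y es vs k \<alpha> [([], [])])"

fun guess :: "nat \<Rightarrow> nat \<Rightarrow> nat \<Rightarrow> (nat \<times> nat \<times> nat) list \<Rightarrow> nat list \<Rightarrow> nat list \<Rightarrow> nat \<Rightarrow> nat list \<Rightarrow> nat list \<Rightarrow>
    nat list option" where
  "guess n \<alpha> k0 es vs [] k X Y = leaf n \<alpha> k0 es vs k X Y"
| "guess n \<alpha> k0 es vs (w # W) k X Y =
    (case (if k = 0 then None else guess n \<alpha> k0 es vs W (k - 1) (w # X) Y) of
       None \<Rightarrow> guess n \<alpha> k0 es vs W k X (w # Y)
     | Some R \<Rightarrow> Some R)"

text \<open>Deleting \<open>u\<close> repairs the solution for the new edge. Since a returned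
  solution has length at most \<open>k\<close>, the guessing starts only from length exactly
  \<open>k\<close>, so that \<open>u # S\<close> exceeds the budget by one.\<close>

fun solve :: "nat \<Rightarrow> nat \<Rightarrow> nat \<Rightarrow> (nat \<times> nat \<times> nat) list \<Rightarrow> nat list option" where
  "solve n \<alpha> k [] = Some []"
| "solve n \<alpha> k ((i, u, v) # es) = (case solve n \<alpha> k es of None \<Rightarrow> None
   | Some S \<Rightarrow> if u \<in> set S then Some S else if length S < k then Some (u # S)
       else guess n \<alpha> k ((i, u, v) # es) (filter (\<lambda>x. x \<notin> set (u # S)) (down n)) (u # S) k [] [])"

section \<open>Correctness for a fixed guess\<close>

lemma set_down [simp]: "set (down n) = {..<n}" by (induction n) (simp_all add: lessThan_Suc)
lemma length_down [simp]: "length (down n) = n" by (induction n) auto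

lemma hits_filter_disjoint:
  assumes "hits S' cls" "D \<subseteq> S'"
  shows "hits (S' - D) (filter (\<lambda>c. set c \<inter> D = {}) cls)"
  using assms unfolding hits_def by auto

lemma min_hit_sound: "min_hit vs R = Some w \<Longrightarrow> hits (set w) R \<and> set w \<subseteq> set vs"
proof (induction vs arbitrary: R w)
  case Nil
  then show ?case by (auto split: if_splits)
next
  case (Cons v vs)
  let ?R = "filter (\<lambda>c. v \<notin> set c) R"
  from Cons.prems have "min_hit vs R = Some w \<or> (\<exists>w'. w = v # w' \<and> min_hit vs ?R = Some w')"
    by (cases "min_hit vs R"; cases "min_hit vs ?R") (auto split: if_splits)
  then show ?case
  proof
    assume "min_hit vs R = Some w"
    then show ?thesis using Cons.IH by auto
  next
    assume "\<exists>w'. w = v # w' \<and> min_hit vs ?R = Some w'"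
    then obtain w' where "w = v # w'" "hits (set w') ?R" "set w' \<subseteq> set vs" using Cons.IH by blast
    then show ?thesis by (auto simp: hits_def)
  qed
qed

lemma min_hit_complete:
  assumes "finite A" "A \<subseteq> set vs" "hits A R"
  shows "\<exists>w. min_hit vs R = Some w \<and> length w \<le> card A"
  using assms
proof (induction vs arbitrary: A R)
  case Nil
  then have "R = []" by (cases R) auto
  then show ?case by simp
next
  case (Cons v vs)
  let ?R = "filter (\<lambda>c. v \<notin> set c) R"
  show ?case
  proof (cases "v \<in> A")
    case False
    then have "A \<subseteq> set vs" using Cons.prems(2) by auto
    then obtain w where "min_hit vs R = Some w" "length w \<le> card A"
      using Cons.IH Cons.prems(1,3) by blast
    then show ?thesis by (cases "min_hit vs ?R") auto
  next
    case True
    have "hits (A - {v}) ?R" using Cons.prems(3) by (auto simp: hits_def)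
    moreover have "finite (A - {v})" "A - {v} \<subseteq> set vs"
      using Cons.prems(1,2) by (simp_all add: subset_insert_iff True)
    ultimately obtain w where w: "min_hit vs ?R = Some w" "length w \<le> card (A - {v})"
      using Cons.IH by blast
    have "Suc (length w) \<le> card A"
      using w(2) card.remove[OF Cons.prems(1) True] by linarith
    then show ?thesis using w(1) by (cases "min_hit vs R") auto
  qed
qed

locale compression =
  fixes n :: nat and es :: "(nat \<times> nat \<times> nat) list" and X Y vs :: "nat list"
  assumes sol: "solution es (set X \<union> set Y)"
    and es_n: "\<forall>(i, u, v) \<in> set es. u < n \<and> v < n"
    and vs: "set vs = {..<n} - (set X \<union> set Y)"
begin

lemma colour_hyps:
  "acyc (pair_edges (avoid (set Y) (colour_pairs c X es)))"
  "\<forall>(a, b) \<in> set (colour_pairs c X es). a \<in> set vs \<union> set Y \<and> b \<in> set vs \<union> set Y"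
  "set vs \<inter> set Y = {}"
  using sol es_n vs unfolding solution_def col_edges_pairs by (auto simp: colour_pairs_def)

lemmas colour_setup = setup_colour_correct[OF colour_hyps]

lemma all_colours_sound:
  assumes "(D, cls) \<in> set (all_colours X Y es vs k c fs)" "set D \<subseteq> S" "hits S cls"
  shows "(\<forall>i < c. acyc (pair_edges (avoid S (colour_pairs i X es)))) \<and>
    (\<exists>(D', cls') \<in> set fs. set D' \<subseteq> S \<and> hits S cls')"
  using assms(1)
proof (induction c arbitrary: fs)
  case 0
  then show ?case using assms by auto
next
  case (Suc c)
  let ?fs = "case setup_colour c X Y es vs of None \<Rightarrow> [] | Some (os, F) \<Rightarrow> expand k os F fs"
  from Suc obtain D' cls' where ih: "\<forall>i < c. acyc (pair_edges (avoid S (colour_pairs i X es)))"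
    "(D', cls') \<in> set ?fs" "set D' \<subseteq> S" "hits S cls'"
    using Suc.IH[of ?fs] Suc.prems by auto
  then obtain os F where so: "setup_colour c X Y es vs = Some (os, F)"
    by (cases "setup_colour c X Y es vs") auto
  with ih obtain D0 cls0 where f: "(D0, cls0) \<in> set fs" "(D', cls') \<in> set (branch k os F D0 cls0)"
    by (auto simp: expand_def)
  have "state_inv (set Y) os F" using colour_setup(4)[OF so] by blast
  from branch_sound[OF this f(2) ih(3,4)] colour_setup(2)[OF so]
  show ?case using ih(1) f(1) less_Suc_eq by auto
qed

text \<open>One and the same \<open>S\<close> is followed through all colours; having at most
  \<open>k\<close> elements, it fits the budget of each of them separately.\<close>

lemma all_colours_complete:
  assumes "finite S" "card S \<le> k" "S \<inter> set Y = {}" "S \<subseteq> S0"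
    and "\<And>i. acyc (pair_edges (avoid S (colour_pairs i X es)))"
    and "\<exists>(D, cls) \<in> set fs. set D \<subseteq> S \<and> hits S cls"
  shows "\<exists>(D, cls) \<in> set (all_colours X Y es vs k c fs). set D \<subseteq> S \<and> hits S cls"
  using assms(6)
proof (induction c arbitrary: fs)
  case (Suc c)
  obtain os F where so: "setup_colour c X Y es vs = Some (os, F)"
    using colour_setup(1)[of c S] assms(3,5) by fastforce
  obtain D cls where f: "(D, cls) \<in> set fs" "set D \<subseteq> S" "hits S cls" using Suc.prems by blast
  have "state_inv (set Y) os F" using colour_setup(4)[OF so] by blast
  from branch_complete[OF this assms(1) colour_setup(3)[OF so assms(3,5)] assms(2) order_refl f(2,3)]
  have "\<exists>(D, cls) \<in> set (expand k os F fs). set D \<subseteq> S \<and> hits S cls"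
    using f(1) unfolding expand_def by (auto intro!: bexI[OF _ f(1)])
  then show ?case using Suc.IH[of "expand k os F fs"] so by simp
qed simp

lemma all_colours_bounds:
  assumes "(D, cls) \<in> set (all_colours X Y es vs k c fs)"
    and "\<forall>(D, cls) \<in> set fs. set D \<subseteq> {..<n} \<and> (\<forall>C \<in> set cls. length C \<le> length vs \<and> set C \<subseteq> {..<n}) \<and>
      length D \<le> N \<and> length cls \<le> N"
  shows "set D \<subseteq> {..<n} \<and> (\<forall>C \<in> set cls. length C \<le> length vs \<and> set C \<subseteq> {..<n}) \<and>
      length D \<le> N + c * k \<and> length cls \<le> N + c * k"
  using assms
proof (induction c arbitrary: fs N)
  case (Suc c)
  let ?fs = "case setup_colour c X Y es vs of None \<Rightarrow> [] | Some (os, F) \<Rightarrow> expand k os F fs"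
  have "set D' \<subseteq> {..<n} \<and> (\<forall>C \<in> set cls'. length C \<le> length vs \<and> set C \<subseteq> {..<n}) \<and>
      length D' \<le> N + k \<and> length cls' \<le> N + k" if h: "(D', cls') \<in> set ?fs" for D' cls'
  proof -
    from h obtain os F where so: "setup_colour c X Y es vs = Some (os, F)"
      by (cases "setup_colour c X Y es vs") auto
    with h obtain D0 cls0 where f: "(D0, cls0) \<in> set fs" "(D', cls') \<in> set (branch k os F D0 cls0)"
      by (auto simp: expand_def)
    note st = colour_setup(4)[OF so]
    have a: "\<forall>e \<in> set F. length (snd (snd e)) + length os \<le> length vs \<and> set (snd (snd e)) \<subseteq> {..<n}"
      using st by auto
    have b: "nodes os \<subseteq> {..<n}" using st vs by auto
    have c: "set D0 \<subseteq> {..<n}" "\<forall>C \<in> set cls0. length C \<le> length vs \<and> set C \<subseteq> {..<n}"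
      "length D0 \<le> N" "length cls0 \<le> N"
      using bspec[OF Suc.prems(2) f(1)] by simp_all
    show ?thesis using branch_bounds[OF f(2) a b c(1,2)] c(3,4) by simp
  qed
  then have "\<forall>(D', cls') \<in> set ?fs. set D' \<subseteq> {..<n} \<and>
      (\<forall>C \<in> set cls'. length C \<le> length vs \<and> set C \<subseteq> {..<n}) \<and>
      length D' \<le> N + k \<and> length cls' \<le> N + k" by blast
  from Suc.IH[OF _ this] Suc.prems(1) show ?case by (simp add: add.assoc)
next
  case 0
  from bspec[OF 0(2), of "(D, cls)"] 0(1) show ?case by simp
qed

text \<open>The bound of \<open>branch_weight\<close> is proportional to the weight of the family it
  starts from, so all families grow by the same factor.\<close>

lemma weight_expand:
  assumes "setup_colour c X Y es vs = Some (os, F)" "length Y \<le> Suc p"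
  shows "weight (expand k os F fs) \<le> weight fs * (10 ^ k * 2 ^ p)"
proof (induction fs)
  case (Cons f fs)
  obtain D cls where f: "f = (D, cls)" by (cases f)
  have "state_inv (set Y) os F" using colour_setup(4)[OF assms(1)] by blast
  then have "weight (branch k os F D cls) \<le> 2 ^ length cls * 10 ^ k * 2 ^ p"
    using branch_weight[of "set Y" os F p] assms(2) card_length[of Y] by force
  then show ?case using Cons f by (simp add: expand_def algebra_simps)
qed (simp add: expand_def)

lemma weight_all_colours:
  assumes "length Y \<le> Suc p"
  shows "weight (all_colours X Y es vs k c fs) \<le> weight fs * (10 ^ k * 2 ^ p) ^ c"
proof (induction c arbitrary: fs)
  case (Suc c)
  let ?fs = "case setup_colour c X Y es vs of None \<Rightarrow> [] | Some (os, F) \<Rightarrow> expand k os F fs"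
  have "weight ?fs \<le> weight fs * (10 ^ k * 2 ^ p)"
    using weight_expand[OF _ assms] by (auto split: option.splits)
  then have "weight ?fs * (10 ^ k * 2 ^ p) ^ c \<le> weight fs * (10 ^ k * 2 ^ p) * (10 ^ k * 2 ^ p) ^ c"
    by (intro mult_right_mono) auto
  then show ?case using le_trans[OF Suc.IH[of ?fs]] by (simp add: mult.assoc)
qed simp

lemma leaf_sound:
  assumes "leaf n \<alpha> k0 es vs k X Y = Some R" "set X \<subseteq> {..<n}" "\<forall>(i, u, v) \<in> set es. i < \<alpha>"
  shows "solution es (set R) \<and> set R \<subseteq> {..<n} \<and> length R \<le> k0 \<and> distinct R"
proof -
  have "\<exists>f \<in> set fs. finish n k0 X f = Some R" if "search n k0 X fs = Some R" for fs
    using that by (induction fs) (auto split: option.splits)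
  then obtain D cls where f: "(D, cls) \<in> set (all_colours X Y es vs k \<alpha> [([], [])])"
    "finish n k0 X (D, cls) = Some R" using assms(1) unfolding leaf_def by fast
  from f(2) obtain w where w: "min_hit (down n) (filter (\<lambda>c. set c \<inter> set D = {}) cls) = Some w"
    and R: "R = remdups (X @ D @ w)" "length R \<le> k0"
    by (auto simp: finish_def Let_def split: option.splits if_splits)
  note mh = min_hit_sound[OF w]
  let ?S = "set D \<union> set w"
  have hit: "hits ?S cls" using mh unfolding hits_def by fastforce
  have D: "set D \<subseteq> {..<n}" using all_colours_bounds[OF f(1), of 0] by auto
  have "acyc (col_edges c (set X \<union> ?S) es)" for c
  proof (cases "c < \<alpha>")
    case True
    then show ?thesis using all_colours_sound[OF f(1) _ hit] unfolding col_edges_pairs by auto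
  next
    case False
    then have "col_edges c (set X \<union> ?S) es = {#}"
      using assms(3) by (auto simp: col_edges_def filter_empty_conv)
    then show ?thesis by simp
  qed
  then show ?thesis using R mh D assms(2) unfolding solution_def by (auto simp: Un_assoc)
qed

text \<open>A family describing \<open>S' = S - set X\<close> has \<open>D\<close> inside
  \<open>S'\<close>, and \<open>S' - D\<close> hits the classes that \<open>D\<close> misses. So the
  minimum hitting set \<open>w\<close> is no larger than \<open>S' - D\<close>, and
  \<open>X\<close>, \<open>D\<close> and \<open>w\<close> together have at most
  \<open>card S\<close> elements.\<close>

lemma leaf_complete:
  assumes "S \<subseteq> {..<n}" "solution es S" "card S \<le> k0" "set X \<subseteq> S" "set Y \<inter> S = {}"
    and "k0 = k + length X" "distinct X"
  shows "leaf n \<alpha> k0 es vs k X Y \<noteq> None"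
proof -
  have fin: "finite S" using assms(1) finite_subset by blast
  define S' where "S' = S - set X"
  have S: "set X \<union> S' = S" using assms(4) by (auto simp: S'_def)
  have card: "card S = length X + card S'"
    using card_Diff_subset[of "set X" S] card_mono[OF fin assms(4)] assms(4,7)
    by (simp add: S'_def distinct_card)
  have "acyc (pair_edges (avoid S' (colour_pairs i X es)))" for i
    using assms(2) unfolding solution_def col_edges_pairs[symmetric] S by blast
  moreover have "finite S'" "card S' \<le> k" "S' \<inter> set Y = {}"
    using fin card assms(3,5,6) by (auto simp: S'_def)
  ultimately obtain D cls where f: "(D, cls) \<in> set (all_colours X Y es vs k \<alpha> [([], [])])"
    "set D \<subseteq> S'" "hits S' cls" using all_colours_complete[of S' k S' "[([], [])]" \<alpha>] by auto
  have "finish n k0 X (D, cls) \<noteq> None"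
  proof -
    have "S' - set D \<subseteq> set (down n)" using assms(1) by (auto simp: S'_def)
    then obtain w where w: "min_hit (down n) (filter (\<lambda>c. set c \<inter> set D = {}) cls) = Some w"
      "length w \<le> card (S' - set D)"
      using min_hit_complete[of "S' - set D"] hits_filter_disjoint[OF f(3,2)] \<open>finite S'\<close> by blast
    have "length (remdups (X @ D @ w)) = card (set X \<union> (set D \<union> set w))"
      by (simp add: length_remdups_card_conv)
    also have "\<dots> \<le> card (set X) + (card (set D) + card (set w))"
      by (meson add_left_mono card_Un_le le_trans)
    also have "\<dots> \<le> length X + (card (set D) + card (S' - set D))"
      using w(2) card_length[of X] card_length[of w] by linarith
    also have "\<dots> = card S" using card f(2) \<open>finite S'\<close>
      by (simp add: card_Diff_subset card_mono)
    finally show ?thesis using w(1) assms(3) by (simp add: finish_def Let_def)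
  qed
  moreover have "search n k0 X fs \<noteq> None" if "g \<in> set fs" "finish n k0 X g \<noteq> None" for fs g
    using that by (induction fs) (auto split: option.splits)
  ultimately show ?thesis using f(1) unfolding leaf_def by blast
qed

end

section \<open>Correctness of the guesses and of the iteration over the edges\<close>

lemma guess_sound:
  assumes "guess n \<alpha> k0 es vs W k X Y = Some R" "solution es (set W \<union> set X \<union> set Y)"
    and "\<forall>(i, u, v) \<in> set es. i < \<alpha> \<and> u < n \<and> v < n"
    and "set vs = {..<n} - (set W \<union> set X \<union> set Y)" "set W \<union> set X \<subseteq> {..<n}"
  shows "solution es (set R) \<and> set R \<subseteq> {..<n} \<and> length R \<le> k0 \<and> distinct R"
  using assms
proof (induction n \<alpha> k0 es vs W k X Y rule: guess.induct)
  case (1 n \<alpha> k0 es vs k X Y)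
  then interpret compression n es X Y vs by unfold_locales auto
  have "\<forall>(i, u, v) \<in> set es. i < \<alpha>" using 1(3) by auto
  then show ?case using leaf_sound[of \<alpha> k0 k R] 1(1,5) by simp
next
  case (2 n \<alpha> k0 es vs w W k X Y)
  have s: "set (w # W) \<union> set X \<union> set Y = set W \<union> set (w # X) \<union> set Y"
    "set (w # W) \<union> set X \<union> set Y = set W \<union> set X \<union> set (w # Y)" by auto
  show ?case
  proof (cases "k \<noteq> 0 \<and> guess n \<alpha> k0 es vs W (k - 1) (w # X) Y = Some R")
    case True
    then show ?thesis using 2(1)[OF _ _ _ 2(5)] 2(4,6,7) unfolding s(1) by auto
  next
    case False
    then have "guess n \<alpha> k0 es vs W k X (w # Y) = Some R"
      "(if k = 0 then None else guess n \<alpha> k0 es vs W (k - 1) (w # X) Y) = None"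
      using 2(3) by (auto split: option.splits if_splits)
    then show ?thesis using 2(2)[OF _ _ _ 2(5)] 2(4,6,7) unfolding s(2) by auto
  qed
qed

lemma guess_complete:
  assumes "solution es (set W \<union> set X \<union> set Y)" "\<forall>(i, u, v) \<in> set es. u < n \<and> v < n"
    and "set vs = {..<n} - (set W \<union> set X \<union> set Y)"
    and "S \<subseteq> {..<n}" "solution es S" "card S \<le> k0" "set X \<subseteq> S" "set Y \<inter> S = {}"
    and "k0 = k + length X" "distinct (W @ X)"
  shows "guess n \<alpha> k0 es vs W k X Y \<noteq> None"
  using assms
proof (induction n \<alpha> k0 es vs W k X Y rule: guess.induct)
  case (1 n \<alpha> k0 es vs k X Y)
  then interpret compression n es X Y vs by unfold_locales auto
  show ?case using leaf_complete[of S k0 k] 1 by simp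
next
  case (2 n \<alpha> k0 es vs w W k X Y)
  have s: "set (w # W) \<union> set X \<union> set Y = set W \<union> set (w # X) \<union> set Y"
    "set (w # W) \<union> set X \<union> set Y = set W \<union> set X \<union> set (w # Y)" by auto
  have fin: "finite S" using 2(6) finite_subset by blast
  show ?case
  proof (cases "w \<in> S")
    case True
    \<comment> \<open>The guessed deletions together with \<open>w\<close> lie in \<open>S\<close>,
      so \<open>length X + 1 \<le> k0\<close>, and budget is left for deleting
      \<open>w\<close>.\<close>
    have "card (set (w # X)) \<le> card S" using True 2(9) fin by (intro card_mono) auto
    moreover have "card (set (w # X)) = Suc (length X)" using 2(12) by (simp add: distinct_card)
    ultimately have "k \<noteq> 0" using 2(8,11) by auto
    then have "guess n \<alpha> k0 es vs W (k - 1) (w # X) Y \<noteq> None"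
      using 2(1)[OF _ _ 2(4) _ 2(6,7,8)] 2(3,5,9-12) True unfolding s(1) by auto
    then show ?thesis using \<open>k \<noteq> 0\<close> by auto
  next
    case False
    have "guess n \<alpha> k0 es vs W k X (w # Y) \<noteq> None"
      if "(if k = 0 then None else guess n \<alpha> k0 es vs W (k - 1) (w # X) Y) = None"
      using 2(2)[OF that _ 2(4) _ 2(6,7,8,9)] 2(3,5,10-12) False unfolding s(2) by auto
    then show ?thesis by (auto split: option.splits)
  qed
qed

lemma col_edges_antimono:
  assumes "S \<subseteq> S'" "mset es \<subseteq># mset es'"
  shows "col_edges c S' es \<subseteq># col_edges c S es'"
  unfolding col_edges_def mset_map mset_filter
  by (intro image_mset_subseteq_mono filter_mset_subset_filter) (use assms in auto)

lemma solution_Cons: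
  assumes "solution es S"
  shows "solution ((i, u, v) # es) (insert u S)"
proof -
  have "col_edges c (insert u S) ((i, u, v) # es) \<subseteq># col_edges c S es" for c
    using col_edges_antimono[of S "insert u S" es es c] by (auto simp: col_edges_def)
  then show ?thesis using assms acyc_antimono unfolding solution_def by blast
qed

lemma solve_correct:
  assumes "\<forall>(i, u, v) \<in> set es. i < \<alpha> \<and> u < n \<and> v < n"
  shows "case solve n \<alpha> k es of
      None \<Rightarrow> \<nexists>S. S \<subseteq> {..<n} \<and> solution es S \<and> card S \<le> k
    | Some S \<Rightarrow> solution es (set S) \<and> set S \<subseteq> {..<n} \<and> length S \<le> k \<and> distinct S"
  using assms
proof (induction n \<alpha> k es rule: solve.induct)
  case (1 n \<alpha> k)
  then show ?case by (simp add: solution_def col_edges_def)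
next
  case (2 n \<alpha> k i u v es)
  let ?es = "(i, u, v) # es"
  have ih: "case solve n \<alpha> k es of
      None \<Rightarrow> \<nexists>S. S \<subseteq> {..<n} \<and> solution es S \<and> card S \<le> k
    | Some S \<Rightarrow> solution es (set S) \<and> set S \<subseteq> {..<n} \<and> length S \<le> k \<and> distinct S"
    using 2 by auto
  \<comment> \<open>A solution for the longer edge list also solves the shorter one, so a failure on
    the shorter list is final.\<close>
  have mono: "solution es S" if "solution ?es S" for S
    using that col_edges_antimono[of S S es ?es] acyc_antimono unfolding solution_def by fastforce
  show ?case
  proof (cases "solve n \<alpha> k es")
    case None
    then show ?thesis using ih mono by auto
  next
    case (Some S)
    then have S: "solution es (set S)" "set S \<subseteq> {..<n}" "length S \<le> k" "distinct S" using ih by auto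
    have u: "u < n" using 2(2) by simp
    have ins: "solution ?es (set (u # S))" using solution_Cons[OF S(1)] by simp
    show ?thesis
    proof (cases "u \<in> set S \<or> length S < k")
      case True
      then show ?thesis using Some S ins u by (auto simp: insert_absorb)
    next
      case False
      let ?vs = "filter (\<lambda>x. x \<notin> set (u # S)) (down n)"
      have vs: "set ?vs = {..<n} - (set (u # S) \<union> set [] \<union> set [])" by auto
      have ins': "solution ?es (set (u # S) \<union> set [] \<union> set [])" using ins by simp
      have eq: "solve n \<alpha> k ?es = guess n \<alpha> k ?es ?vs (u # S) k [] []"
        using False Some by simp
      show ?thesis
      proof (cases "guess n \<alpha> k ?es ?vs (u # S) k [] []")
        case None
        have "\<nexists>S. S \<subseteq> {..<n} \<and> solution ?es S \<and> card S \<le> k"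
        proof
          assume "\<exists>S. S \<subseteq> {..<n} \<and> solution ?es S \<and> card S \<le> k"
          then obtain T where T: "T \<subseteq> {..<n}" "solution ?es T" "card T \<le> k" by blast
          have "guess n \<alpha> k ?es ?vs (u # S) k [] [] \<noteq> None"
            by (rule guess_complete[OF ins' _ vs T]) (use 2(2) S False in auto)
          then show False using None by simp
        qed
        then show ?thesis using eq None by simp
      next
        case (Some R)
        from guess_sound[OF this ins' 2(2) vs] show ?thesis using S u eq Some by simp
      qed
    qed
  qed
qed

section \<open>The program\<close>

text \<open>The postcondition sees the number of steps as well, so one symbolic execution yields
  termination, result and cost.\<close>

definition wp :: "prog \<Rightarrow> tree list \<Rightarrow> expr \<Rightarrow> (nat \<Rightarrow> tree \<Rightarrow> bool) \<Rightarrow> bool" where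
  "wp P env e Q \<longleftrightarrow> (\<exists>t v. eval P env e t v \<and> Q t v)"

definition wps :: "prog \<Rightarrow> tree list \<Rightarrow> expr list \<Rightarrow> (nat \<Rightarrow> tree list \<Rightarrow> bool) \<Rightarrow> bool" where
  "wps P env es Q \<longleftrightarrow> (\<exists>t vs. evals P env es t vs \<and> Q t vs)"

text \<open>A call is split into termination, result and cost. Determinism makes the last two
  functions of the arguments, so that they can be rewritten inside the calling body.\<close>

definition halts_in :: "prog \<Rightarrow> nat \<Rightarrow> tree list \<Rightarrow> bool" where
  "halts_in P f xs \<longleftrightarrow> f < length P \<and> (\<exists>t v. eval P xs (P ! f) t v)"

definition res_in :: "prog \<Rightarrow> nat \<Rightarrow> tree list \<Rightarrow> tree" where
  "res_in P f xs = (THE v. \<exists>t. eval P xs (P ! f) t v)"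

definition cost_in :: "prog \<Rightarrow> nat \<Rightarrow> tree list \<Rightarrow> nat" where
  "cost_in P f xs = (THE t. \<exists>v. eval P xs (P ! f) t v)"

lemma res_cost_eq:
  assumes "eval P xs (P ! f) t v"
  shows "res_in P f xs = v" "cost_in P f xs = t"
  unfolding res_in_def cost_in_def using assms eval_deterministic(1)[OF assms] by blast+

inductive_cases eval_VarE: "eval P env (Var i) t v"
inductive_cases eval_NilE: "eval P env ENil t v"
inductive_cases eval_ConsE: "eval P env (ECons a b) t v"
inductive_cases eval_HdE: "eval P env (EHd a) t v"
inductive_cases eval_TlE: "eval P env (ETl a) t v"
inductive_cases eval_IfE: "eval P env (EIf a b c) t v"
inductive_cases eval_CallE: "eval P env (Call f as) t v"
inductive_cases evals_NilE: "evals P env [] t vs"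
inductive_cases evals_ConsE: "evals P env (a # as) t vs"

text \<open>
  Since evaluation is deterministic, these are equivalences, and the simplifier executes a function body
  symbolically, including its step count.
\<close>

lemma wp_simps [simp]:
  "wp P env (Var i) Q \<longleftrightarrow> i < length env \<and> Q 1 (env ! i)"
  "wp P env ENil Q \<longleftrightarrow> Q 1 Leaf"
  "wp P env (ECons a b) Q \<longleftrightarrow> wp P env a (\<lambda>s x. wp P env b (\<lambda>t y. Q (Suc (s + t)) (Node x y)))"
  "wp P env (EHd a) Q \<longleftrightarrow> wp P env a (\<lambda>t x. Q (Suc t) (left x))"
  "wp P env (ETl a) Q \<longleftrightarrow> wp P env a (\<lambda>t x. Q (Suc t) (right x))"
  "wp P env (EIf a b c) Q \<longleftrightarrow> wp P env a (\<lambda>s x. if x = Leaf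
     then wp P env c (\<lambda>t y. Q (Suc (s + t)) y) else wp P env b (\<lambda>t y. Q (Suc (s + t)) y))"
  "wps P env [] R \<longleftrightarrow> R 0 []"
  "wps P env (a # as) R \<longleftrightarrow> wp P env a (\<lambda>s x. wps P env as (\<lambda>t xs. R (s + t) (x # xs)))"
  unfolding wp_def wps_def
  subgoal by (rule iffI; (elim exE conjE eval_VarE)?) (force intro: eval_Var)+
  subgoal by (rule iffI; (elim exE conjE eval_NilE)?) (force intro: eval_Nil)+
  subgoal by (blast intro: eval_evals.intros elim: eval_ConsE)
  subgoal by (blast intro: eval_evals.intros elim: eval_HdE)
  subgoal by (blast intro: eval_evals.intros elim: eval_TlE)
  subgoal
  proof (rule iffI; (elim exE conjE eval_IfE)?)
    fix t v s x ta
    assume "Q t v" "t = Suc (s + ta)" "eval P env a s x" "x \<noteq> Leaf" "eval P env b ta v"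
    then show "\<exists>t v. eval P env a t v \<and>
      (if v = Leaf then \<exists>ta v. eval P env c ta v \<and> Q (Suc (t + ta)) v
       else \<exists>ta v. eval P env b ta v \<and> Q (Suc (t + ta)) v)" by (metis (full_types))
  next
    fix t v s ta
    assume "Q t v" "t = Suc (s + ta)" "eval P env a s Leaf" "eval P env c ta v"
    then show "\<exists>t v. eval P env a t v \<and>
      (if v = Leaf then \<exists>ta v. eval P env c ta v \<and> Q (Suc (t + ta)) v
       else \<exists>ta v. eval P env b ta v \<and> Q (Suc (t + ta)) v)" by (metis (full_types))
  next
    fix t v
    assume "eval P env a t v" "if v = Leaf then \<exists>ta v. eval P env c ta v \<and> Q (Suc (t + ta)) v
       else \<exists>ta v. eval P env b ta v \<and> Q (Suc (t + ta)) v"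
    then show "\<exists>t v. eval P env (EIf a b c) t v \<and> Q t v"
      by (cases "v = Leaf") (auto dest: eval_If_True eval_If_False)
  qed
  subgoal by (rule iffI; (elim exE conjE evals_NilE)?) (force intro: evals_Nil)+
  subgoal by (blast intro: eval_evals.intros elim: evals_ConsE)
  done

lemma wp_Call [simp]:
  "wp P env (Call f as) Q \<longleftrightarrow>
     wps P env as (\<lambda>s xs. halts_in P f xs \<and> Q (Suc (s + cost_in P f xs)) (res_in P f xs))"
proof
  assume "wp P env (Call f as) Q"
  then obtain t v where "eval P env (Call f as) t v" "Q t v" unfolding wp_def by blast
  then obtain s xs u where "evals P env as s xs" "f < length P" "eval P xs (P ! f) u v" "t = Suc (s + u)"
    by (auto elim: eval_CallE)
  then show "wps P env as (\<lambda>s xs. halts_in P f xs \<and> Q (Suc (s + cost_in P f xs)) (res_in P f xs))"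
    using \<open>Q t v\<close> unfolding wps_def halts_in_def by (metis res_cost_eq)
next
  assume "wps P env as (\<lambda>s xs. halts_in P f xs \<and> Q (Suc (s + cost_in P f xs)) (res_in P f xs))"
  then obtain s xs t v where "evals P env as s xs" "f < length P" "eval P xs (P ! f) t v"
    "Q (Suc (s + t)) v" unfolding wps_def halts_in_def by (metis res_cost_eq)
  then show "wp P env (Call f as) Q" unfolding wp_def by (blast intro: eval_Call)
qed

lemma wp_body:
  assumes "P ! f = b" "f < length P" "wp P xs b Q"
  shows "halts_in P f xs \<and> Q (cost_in P f xs) (res_in P f xs)"
  using assms unfolding wp_def halts_in_def by (auto simp: res_cost_eq)

abbreviation yes :: expr where "yes \<equiv> ECons ENil ENil"

text \<open>
  \<open>b_x\<close> is the body at position \<open>f_x\<close>. Numbered functions such as \<open>order1\<close> replace the local bindings that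
  the language lacks.
\<close>

definition f_main :: nat where "f_main = 0"
definition f_eq :: nat where "f_eq = 1"
definition f_mem :: nat where "f_mem = 2"
definition f_app :: nat where "f_app = 3"
definition f_down :: nat where "f_down = 4"
definition f_diff :: nat where "f_diff = 5"
definition f_leq :: nat where "f_leq = 6"
definition f_colour :: nat where "f_colour = 7"
definition f_avoid :: nat where "f_avoid = 8"
definition f_inner :: nat where "f_inner = 9"
definition f_cross :: nat where "f_cross = 10"
definition f_nbrs :: nat where "f_nbrs = 11"
definition f_pick :: nat where "f_pick = 12"
definition f_order :: nat where "f_order = 13"
definition f_order1 :: nat where "f_order1 = 14"
definition f_ren :: nat where "f_ren = 15"
definition f_relabp :: nat where "f_relabp = 16"
definition f_relab :: nat where "f_relab = 17"
definition f_contr :: nat where "f_contr = 18"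
definition f_at :: nat where "f_at = 19"
definition f_off :: nat where "f_off = 20"
definition f_push :: nat where "f_push = 21"
definition f_branch :: nat where "f_branch = 22"
definition f_branch1 :: nat where "f_branch1 = 23"
definition f_hit :: nat where "f_hit = 24"
definition f_merge :: nat where "f_merge = 25"
definition f_expand :: nat where "f_expand = 26"
definition f_all :: nat where "f_all = 27"
definition f_step :: nat where "f_step = 28"
definition f_step1 :: nat where "f_step1 = 29"
definition f_rdup :: nat where "f_rdup = 30"
definition f_disj :: nat where "f_disj = 31"
definition f_filt :: nat where "f_filt = 32"
definition f_base :: nat where "f_base = 33"
definition f_cons :: nat where "f_cons = 34"
definition f_best :: nat where "f_best = 35"
definition f_upd :: nat where "f_upd = 36"
definition f_tab :: nat where "f_tab = 37"
definition f_tab1 :: nat where "f_tab1 = 38"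
definition f_top :: nat where "f_top = 39"
definition f_minhit :: nat where "f_minhit = 40"
definition f_finish :: nat where "f_finish = 41"
definition f_finish1 :: nat where "f_finish1 = 42"
definition f_finish2 :: nat where "f_finish2 = 43"
definition f_search :: nat where "f_search = 44"
definition f_search1 :: nat where "f_search1 = 45"
definition f_guess :: nat where "f_guess = 46"
definition f_guess1 :: nat where "f_guess1 = 47"
definition f_solve :: nat where "f_solve = 48"
definition f_solve1 :: nat where "f_solve1 = 49"
definition f_solve2 :: nat where "f_solve2 = 50"

definition b_main :: expr where "b_main =
  EIf (Call f_solve [EHd (ETl (ETl (Var 0))), EHd (Var 0), EHd (ETl (Var 0)), ETl (ETl (ETl (Var 0)))])
      yes ENil"

definition b_eq :: expr where "b_eq =
  EIf (Var 0) (EIf (Var 1) (Call f_eq [ETl (Var 0), ETl (Var 1)]) ENil) (EIf (Var 1) ENil yes)"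

definition b_mem :: expr where "b_mem =
  EIf (Var 1) (EIf (Call f_eq [Var 0, EHd (Var 1)]) yes (Call f_mem [Var 0, ETl (Var 1)])) ENil"

definition b_app :: expr where "b_app =
  EIf (Var 0) (ECons (EHd (Var 0)) (Call f_app [ETl (Var 0), Var 1])) (Var 1)"

definition b_down :: expr where "b_down =
  EIf (Var 0) (ECons (ETl (Var 0)) (Call f_down [ETl (Var 0)])) ENil"

definition b_diff :: expr where "b_diff =
  EIf (Var 0) (EIf (Call f_mem [EHd (Var 0), Var 1]) (Call f_diff [ETl (Var 0), Var 1])
     (ECons (EHd (Var 0)) (Call f_diff [ETl (Var 0), Var 1]))) ENil"

definition b_leq :: expr where "b_leq =
  EIf (Var 0) (EIf (Var 1) (Call f_leq [ETl (Var 0), ETl (Var 1)]) ENil) yes"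

definition b_colour :: expr where "b_colour =
  EIf (Var 2) (EIf (Call f_eq [EHd (EHd (Var 2)), Var 0])
     (EIf (Call f_mem [EHd (ETl (EHd (Var 2))), Var 1]) (Call f_colour [Var 0, Var 1, ETl (Var 2)])
       (EIf (Call f_mem [ETl (ETl (EHd (Var 2))), Var 1]) (Call f_colour [Var 0, Var 1, ETl (Var 2)])
         (ECons (ETl (EHd (Var 2))) (Call f_colour [Var 0, Var 1, ETl (Var 2)]))))
     (Call f_colour [Var 0, Var 1, ETl (Var 2)])) ENil"

definition b_avoid :: expr where "b_avoid =
  EIf (Var 1) (EIf (Call f_mem [EHd (EHd (Var 1)), Var 0]) (Call f_avoid [Var 0, ETl (Var 1)])
     (EIf (Call f_mem [ETl (EHd (Var 1)), Var 0]) (Call f_avoid [Var 0, ETl (Var 1)])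
       (ECons (EHd (Var 1)) (Call f_avoid [Var 0, ETl (Var 1)])))) ENil"

definition b_inner :: expr where "b_inner =
  EIf (Var 1) (EIf (Call f_mem [EHd (EHd (Var 1)), Var 0])
     (EIf (Call f_mem [ETl (EHd (Var 1)), Var 0])
       (ECons (EHd (Var 1)) (Call f_inner [Var 0, ETl (Var 1)]))
       (Call f_inner [Var 0, ETl (Var 1)]))
     (Call f_inner [Var 0, ETl (Var 1)])) ENil"

definition b_cross :: expr where "b_cross =
  EIf (Var 1) (EIf (Call f_mem [EHd (EHd (Var 1)), Var 0])
     (EIf (Call f_mem [ETl (EHd (Var 1)), Var 0]) (Call f_cross [Var 0, ETl (Var 1)])
       (ECons (ECons (ETl (EHd (Var 1))) (ECons (EHd (EHd (Var 1))) ENil)) (Call f_cross [Var 0, ETl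
           (Var 1)])))
     (EIf (Call f_mem [ETl (EHd (Var 1)), Var 0])
       (ECons (ECons (EHd (EHd (Var 1))) (ECons (ETl (EHd (Var 1))) ENil)) (Call f_cross [Var 0, ETl
           (Var 1)]))
       (Call f_cross [Var 0, ETl (Var 1)]))) ENil"

definition b_nbrs :: expr where "b_nbrs =
  EIf (Var 1) (EIf (Call f_eq [EHd (EHd (Var 1)), Var 0])
     (ECons (ETl (EHd (Var 1))) (Call f_nbrs [Var 0, ETl (Var 1)]))
     (EIf (Call f_eq [ETl (EHd (Var 1)), Var 0])
       (ECons (EHd (EHd (Var 1))) (Call f_nbrs [Var 0, ETl (Var 1)]))
       (Call f_nbrs [Var 0, ETl (Var 1)]))) ENil"

definition b_pick :: expr where "b_pick =
  EIf (Var 0) (EIf (ETl (Call f_nbrs [EHd (Var 0), Var 1])) (Call f_pick [ETl (Var 0), Var 1])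
     (ECons (EHd (Var 0)) ENil)) ENil"

definition b_order :: expr where "b_order =
  Call f_order1 [Call f_pick [Var 0, Var 1], Var 0, Var 1]"

definition b_order1 :: expr where "b_order1 =
  EIf (Var 0) (ECons (ECons (EHd (Var 0)) (Call f_nbrs [EHd (Var 0), Var 2]))
     (Call f_order [Call f_diff [Var 1, ECons (EHd (Var 0)) ENil],
       Call f_avoid [ECons (EHd (Var 0)) ENil, Var 2]])) ENil"

definition b_ren :: expr where "b_ren =
  EIf (Call f_eq [Var 2, Var 0]) (Var 1) (Var 2)"

definition b_relabp :: expr where "b_relabp =
  EIf (Var 2) (ECons (ECons (Call f_ren [Var 0, Var 1, EHd (EHd (Var 2))]) (Call f_ren [Var 0, Var 1,
      ETl (EHd (Var 2))]))
     (Call f_relabp [Var 0, Var 1, ETl (Var 2)])) ENil"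

definition b_relab :: expr where "b_relab =
  EIf (Var 2) (ECons (ECons (EHd (EHd (Var 2)))
       (ECons (Call f_ren [Var 0, Var 1, EHd (ETl (EHd (Var 2)))]) (ETl (ETl (EHd (Var 2))))))
     (Call f_relab [Var 0, Var 1, ETl (Var 2)])) ENil"

definition b_contr :: expr where "b_contr =
  EIf (Var 0) (EIf (Call f_eq [EHd (EHd (Var 0)), ETl (EHd (Var 0))]) ENil
     (Call f_contr [Call f_relabp [ETl (EHd (Var 0)), EHd (EHd (Var 0)), ETl (Var 0)],
       Call f_relab [ETl (EHd (Var 0)), EHd (EHd (Var 0)), Var 1]])) (ECons (Var 1) ENil)"

definition b_at :: expr where "b_at =
  EIf (Var 1) (EIf (Call f_eq [EHd (EHd (Var 1)), Var 0]) (ECons (EHd (Var 1)) (Call f_at [Var 0, ETl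
      (Var 1)]))
     (Call f_at [Var 0, ETl (Var 1)])) ENil"

definition b_off :: expr where "b_off =
  EIf (Var 1) (EIf (Call f_eq [EHd (EHd (Var 1)), Var 0]) (Call f_off [Var 0, ETl (Var 1)])
     (ECons (EHd (Var 1)) (Call f_off [Var 0, ETl (Var 1)]))) ENil"

definition b_push :: expr where "b_push =
  EIf (Var 0) (ECons (ECons (EHd (Var 0)) (ECons (Var 1) (Var 2))) (Var 3)) (Var 3)"

definition b_branch :: expr where "b_branch =
  EIf (Var 1) (Call f_branch1 [Call f_at [EHd (EHd (Var 1)), Var 2], Call f_off [EHd (EHd (Var 1)), Var 2],
     Var 0, Var 1, Var 3, Var 4]) (ECons (ECons (Var 3) (Var 4)) ENil)"

definition b_branch1 :: expr where "b_branch1 =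
  EIf (Var 0) (EIf (ETl (Var 0))
       (Call f_app [Call f_hit [Var 0, Var 1, Var 2, Var 3, Var 4, Var 5],
         Call f_merge [Var 0, Var 1, Var 2, Var 3, Var 4, Var 5]])
       (Call f_branch [Var 2, ETl (Var 3), Call f_push [ETl (EHd (Var 3)), EHd (ETl (EHd (Var 0))),
         ECons (EHd (EHd (Var 3))) (ETl (ETl (EHd (Var 0)))), Var 1], Var 4, Var 5]))
     (Call f_branch [Var 2, ETl (Var 3), Var 1, Var 4, Var 5])"

definition b_hit :: expr where "b_hit =
  EIf (Var 2) (Call f_app [Call f_branch [ETl (Var 2), ETl (Var 3), Var 1, ECons (EHd (EHd (Var 3)))
      (Var 4), Var 5],
     Call f_app [
       Call f_branch [ETl (Var 2), Var 3, ECons (EHd (ETl (Var 0))) (Call f_app [ETl (ETl (Var 0)), Var 1]),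
         Var 4, ECons (ETl (ETl (EHd (Var 0)))) (Var 5)],
       Call f_branch [ETl (Var 2), Var 3, ECons (EHd (Var 0)) (Call f_app [ETl (ETl (Var 0)), Var 1]),
         Var 4, ECons (ETl (ETl (EHd (ETl (Var 0))))) (Var 5)]]]) ENil"

definition b_merge :: expr where "b_merge =
  EIf (Call f_eq [EHd (ETl (EHd (Var 0))), EHd (ETl (EHd (ETl (Var 0))))]) ENil
     (Call f_branch [Var 2, Var 3, ECons (ECons (EHd (EHd (Var 3))) (ECons (EHd (ETl (EHd (Var 0)))) ENil))
       (Call f_relab [EHd (ETl (EHd (ETl (Var 0)))), EHd (ETl (EHd (Var 0))),
         Call f_app [ETl (ETl (Var 0)), Var 1]]), Var 4, Var 5])"

definition b_expand :: expr where "b_expand =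
  EIf (Var 3) (Call f_app [Call f_branch [Var 0, Var 1, Var 2, EHd (EHd (Var 3)), ETl (EHd (Var 3))],
     Call f_expand [Var 0, Var 1, Var 2, ETl (Var 3)]]) ENil"

definition b_all :: expr where "b_all =
  EIf (Var 5) (Call f_all [Var 0, Var 1, Var 2, Var 3, Var 4, ETl (Var 5),
     Call f_step [Var 1, Var 3, Var 4, Call f_colour [ETl (Var 5), Var 0, Var 2], Var 6]]) (Var 6)"

definition b_step :: expr where "b_step =
  Call f_step1 [Var 2, Call f_contr [Call f_inner [Var 0, Var 3], Call f_cross [Var 0, Var 3]],
     Call f_order [Var 1, Call f_avoid [Var 0, Var 3]], Var 4]"

definition b_step1 :: expr where "b_step1 =
  EIf (Var 1) (Call f_expand [Var 0, Var 2, EHd (Var 1), Var 3]) ENil"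

definition b_rdup :: expr where "b_rdup =
  EIf (Var 0) (EIf (Call f_mem [EHd (Var 0), ETl (Var 0)]) (Call f_rdup [ETl (Var 0)])
     (ECons (EHd (Var 0)) (Call f_rdup [ETl (Var 0)]))) ENil"

definition b_disj :: expr where "b_disj =
  EIf (Var 0) (EIf (Call f_mem [EHd (Var 0), Var 1]) ENil (Call f_disj [ETl (Var 0), Var 1])) yes"

definition b_filt :: expr where "b_filt =
  EIf (Var 1) (EIf (Call f_disj [EHd (Var 1), Var 0]) (ECons (EHd (Var 1)) (Call f_filt [Var 0, ETl (Var 1)]))
     (Call f_filt [Var 0, ETl (Var 1)])) ENil"

definition b_base :: expr where "b_base =
  EIf (Var 1) (ECons (Call f_base [Var 0, ETl (Var 1)]) (Call f_base [ENil, ETl (Var 1)]))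
     (EIf (Var 0) (ECons ENil ENil) ENil)"

definition b_cons :: expr where "b_cons =
  EIf (Var 1) (ECons (ECons (Var 0) (EHd (Var 1))) ENil) ENil"

definition b_best :: expr where "b_best =
  EIf (Var 0) (EIf (Var 1) (EIf (Call f_leq [EHd (Var 0), EHd (Var 1)]) (Var 0) (Var 1)) (Var 0)) (Var 1)"

definition b_upd :: expr where "b_upd =
  EIf (Var 1) (ECons (Call f_upd [Var 0, ETl (Var 1), EHd (Var 2), EHd (Var 3)])
     (Call f_upd [Var 0, ETl (Var 1), ETl (Var 2),
       EIf (Call f_mem [Var 0, EHd (Var 1)]) (EHd (Var 3)) (ETl (Var 3))]))
     (Call f_best [Var 2, Call f_cons [Var 0, Var 3]])"

definition b_tab :: expr where "b_tab =
  EIf (Var 0) (Call f_tab1 [EHd (Var 0), Var 1, Call f_tab [ETl (Var 0), Var 1]]) (Call f_base [yes, Var 1])"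

definition b_tab1 :: expr where "b_tab1 =
  Call f_upd [Var 0, Var 1, Var 2, Var 2]"

definition b_top :: expr where "b_top =
  EIf (Var 0) (Call f_top [ETl (Var 0), ETl (Var 1)]) (Var 1)"

definition b_minhit :: expr where "b_minhit =
  Call f_top [Var 1, Call f_tab [Var 0, Var 1]]"

definition b_finish :: expr where "b_finish =
  Call f_finish1 [Var 1, Var 2, EHd (Var 3),
     Call f_minhit [Call f_down [Var 0], Call f_filt [EHd (Var 3), ETl (Var 3)]]]"

definition b_finish1 :: expr where "b_finish1 =
  EIf (Var 3) (Call f_finish2 [Var 0, Call f_rdup [Call f_app [Var 1, Call f_app [Var 2, EHd (Var
      3)]]]]) ENil"

definition b_finish2 :: expr where "b_finish2 =
  EIf (Call f_leq [Var 1, Var 0]) (ECons (Var 1) ENil) ENil"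

definition b_search :: expr where "b_search =
  EIf (Var 3) (Call f_search1 [Call f_finish [Var 0, Var 1, Var 2, EHd (Var 3)], Var 0, Var 1, Var 2,
      ETl (Var 3)]) ENil"

definition b_search1 :: expr where "b_search1 =
  EIf (Var 0) (Var 0) (Call f_search [Var 1, Var 2, Var 3, Var 4])"

definition b_guess :: expr where "b_guess =
  EIf (Var 5) (Call f_guess1 [
       EIf (Var 6) (Call f_guess [Var 0, Var 1, Var 2, Var 3, Var 4, ETl (Var 5), ETl (Var 6),
         ECons (EHd (Var 5)) (Var 7), Var 8]) ENil,
       Var 0, Var 1, Var 2, Var 3, Var 4, Var 5, Var 6, Var 7, Var 8])
     (Call f_search [Var 0, Var 2, Var 7, Call f_all [Var 7, Var 8, Var 3, Var 4, Var 6, Var 1,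
       ECons (ECons ENil ENil) ENil]])"

definition b_guess1 :: expr where "b_guess1 =
  EIf (Var 0) (Var 0) (Call f_guess [Var 1, Var 2, Var 3, Var 4, Var 5, ETl (Var 6), Var 7, Var 8,
     ECons (EHd (Var 6)) (Var 9)])"

definition b_solve :: expr where "b_solve =
  EIf (Var 3) (Call f_solve1 [Var 0, Var 1, Var 2, Var 3, Call f_solve [Var 0, Var 1, Var 2, ETl (Var 3)]])
     (ECons ENil ENil)"

definition b_solve1 :: expr where "b_solve1 =
  EIf (Var 4) (Call f_solve2 [Var 0, Var 1, Var 2, Var 3, EHd (Var 4), EHd (ETl (EHd (Var 3)))]) ENil"

definition b_solve2 :: expr where "b_solve2 =
  EIf (Call f_mem [Var 5, Var 4]) (ECons (Var 4) ENil)
     (EIf (Call f_leq [ECons ENil (Var 4), Var 2]) (ECons (ECons (Var 5) (Var 4)) ENil)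
       (Call f_guess [Var 0, Var 1, Var 2, Var 3,
         Call f_diff [Call f_down [Var 0], ECons (Var 5) (Var 4)], ECons (Var 5) (Var 4), Var 2, ENil,
            ENil]))"

definition prog :: prog where "prog = [b_main, b_eq, b_mem, b_app, b_down, b_diff, b_leq, b_colour,
  b_avoid, b_inner, b_cross, b_nbrs, b_pick, b_order, b_order1, b_ren,
  b_relabp, b_relab, b_contr, b_at, b_off, b_push, b_branch, b_branch1,
  b_hit, b_merge, b_expand, b_all, b_step, b_step1, b_rdup, b_disj,
  b_filt, b_base, b_cons, b_best, b_upd, b_tab, b_tab1, b_top,
  b_minhit, b_finish, b_finish1, b_finish2, b_search, b_search1, b_guess, b_guess1,
  b_solve, b_solve1, b_solve2]"

lemma code:
  "prog ! f_main = b_main" "f_main < length prog"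
  "prog ! f_eq = b_eq" "f_eq < length prog"
  "prog ! f_mem = b_mem" "f_mem < length prog"
  "prog ! f_app = b_app" "f_app < length prog"
  "prog ! f_down = b_down" "f_down < length prog"
  "prog ! f_diff = b_diff" "f_diff < length prog"
  "prog ! f_leq = b_leq" "f_leq < length prog"
  "prog ! f_colour = b_colour" "f_colour < length prog"
  "prog ! f_avoid = b_avoid" "f_avoid < length prog"
  "prog ! f_inner = b_inner" "f_inner < length prog"
  "prog ! f_cross = b_cross" "f_cross < length prog"
  "prog ! f_nbrs = b_nbrs" "f_nbrs < length prog"
  "prog ! f_pick = b_pick" "f_pick < length prog"
  "prog ! f_order = b_order" "f_order < length prog"
  "prog ! f_order1 = b_order1" "f_order1 < length prog"
  "prog ! f_ren = b_ren" "f_ren < length prog"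
  "prog ! f_relabp = b_relabp" "f_relabp < length prog"
  "prog ! f_relab = b_relab" "f_relab < length prog"
  "prog ! f_contr = b_contr" "f_contr < length prog"
  "prog ! f_at = b_at" "f_at < length prog"
  "prog ! f_off = b_off" "f_off < length prog"
  "prog ! f_push = b_push" "f_push < length prog"
  "prog ! f_branch = b_branch" "f_branch < length prog"
  "prog ! f_branch1 = b_branch1" "f_branch1 < length prog"
  "prog ! f_hit = b_hit" "f_hit < length prog"
  "prog ! f_merge = b_merge" "f_merge < length prog"
  "prog ! f_expand = b_expand" "f_expand < length prog"
  "prog ! f_all = b_all" "f_all < length prog"
  "prog ! f_step = b_step" "f_step < length prog"
  "prog ! f_step1 = b_step1" "f_step1 < length prog"
  "prog ! f_rdup = b_rdup" "f_rdup < length prog"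
  "prog ! f_disj = b_disj" "f_disj < length prog"
  "prog ! f_filt = b_filt" "f_filt < length prog"
  "prog ! f_base = b_base" "f_base < length prog"
  "prog ! f_cons = b_cons" "f_cons < length prog"
  "prog ! f_best = b_best" "f_best < length prog"
  "prog ! f_upd = b_upd" "f_upd < length prog"
  "prog ! f_tab = b_tab" "f_tab < length prog"
  "prog ! f_tab1 = b_tab1" "f_tab1 < length prog"
  "prog ! f_top = b_top" "f_top < length prog"
  "prog ! f_minhit = b_minhit" "f_minhit < length prog"
  "prog ! f_finish = b_finish" "f_finish < length prog"
  "prog ! f_finish1 = b_finish1" "f_finish1 < length prog"
  "prog ! f_finish2 = b_finish2" "f_finish2 < length prog"
  "prog ! f_search = b_search" "f_search < length prog"
  "prog ! f_search1 = b_search1" "f_search1 < length prog"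
  "prog ! f_guess = b_guess" "f_guess < length prog"
  "prog ! f_guess1 = b_guess1" "f_guess1 < length prog"
  "prog ! f_solve = b_solve" "f_solve < length prog"
  "prog ! f_solve1 = b_solve1" "f_solve1 < length prog"
  "prog ! f_solve2 = b_solve2" "f_solve2 < length prog"
  by (simp_all add: prog_def f_main_def f_eq_def f_mem_def f_app_def f_down_def f_diff_def f_leq_def
      f_colour_def f_avoid_def f_inner_def f_cross_def f_nbrs_def f_pick_def f_order_def f_order1_def
          f_ren_def f_relabp_def f_relab_def f_contr_def f_at_def f_off_def f_push_def f_branch_def
            f_branch1_def f_hit_def f_merge_def f_expand_def f_all_def f_step_def f_step1_def f_rdup_def
            f_disj_def f_filt_def f_base_def f_cons_def f_best_def f_upd_def f_tab_def f_tab1_def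
            f_top_def f_minhit_def f_finish_def f_finish1_def f_finish2_def f_search_def f_search1_def
            f_guess_def f_guess1_def f_solve_def f_solve1_def f_solve2_def)

abbreviation halts :: "nat \<Rightarrow> tree list \<Rightarrow> bool" where "halts \<equiv> halts_in prog"
abbreviation res :: "nat \<Rightarrow> tree list \<Rightarrow> tree" where "res \<equiv> res_in prog"
abbreviation cost :: "nat \<Rightarrow> tree list \<Rightarrow> nat" where "cost \<equiv> cost_in prog"

section \<open>Running times\<close>

lemma bool_tree_simps [simp]:
  "bool_tree True = Node Leaf Leaf" "bool_tree False = Leaf" "bool_tree b = Leaf \<longleftrightarrow> \<not> b"
  by (simp_all add: bool_tree_def)

abbreviation nl :: "nat list \<Rightarrow> tree" where "nl \<equiv> enc_list enc_nat"

definition enc_pr :: "('a \<Rightarrow> tree) \<Rightarrow> ('b \<Rightarrow> tree) \<Rightarrow> 'a \<times> 'b \<Rightarrow> tree" where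
  "enc_pr f g e = Node (f (fst e)) (g (snd e))"

lemma enc_pr_simps [simp]:
  "enc_pr f g (a, b) = Node (f a) (g b)" "left (enc_pr f g e) = f (fst e)" "right (enc_pr f g e) = g (snd e)"
  "enc_pr f g e \<noteq> Leaf"
  by (simp_all add: enc_pr_def)

lemma enc_edge_eq: "enc_edge = enc_pr enc_nat (enc_pr enc_nat enc_nat)"
  by (rule ext) (auto simp: enc_edge_def)

abbreviation enc_pairs :: "(nat \<times> nat) list \<Rightarrow> tree" where
  "enc_pairs \<equiv> enc_list (enc_pr enc_nat enc_nat)"

abbreviation enc_es :: "(nat \<times> nat \<times> nat) list \<Rightarrow> tree" where
  "enc_es \<equiv> enc_list (enc_pr enc_nat (enc_pr enc_nat enc_nat))"

abbreviation enc_pends :: "pend list \<Rightarrow> tree" where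
  "enc_pends \<equiv> enc_list (enc_pr enc_nat (enc_pr enc_nat nl))"

abbreviation enc_ord :: "(nat \<times> nat list) list \<Rightarrow> tree" where
  "enc_ord \<equiv> enc_list (enc_pr enc_nat nl)"

abbreviation enc_cls :: "nat list list \<Rightarrow> tree" where
  "enc_cls \<equiv> enc_list nl"

abbreviation enc_fams :: "family list \<Rightarrow> tree" where
  "enc_fams \<equiv> enc_list (enc_pr nl enc_cls)"

definition enc_opt :: "('a \<Rightarrow> tree) \<Rightarrow> 'a option \<Rightarrow> tree" where
  "enc_opt f x = (case x of None \<Rightarrow> Leaf | Some a \<Rightarrow> Node (f a) Leaf)"

lemma enc_opt_simps [simp]:
  "enc_opt f None = Leaf" "enc_opt f (Some a) = Node (f a) Leaf" "enc_opt f x = Leaf \<longleftrightarrow> x = None"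
  by (simp_all add: enc_opt_def split: option.splits)

lemma enc_list_Leaf [simp]: "enc_list f xs = Leaf \<longleftrightarrow> xs = []" by (cases xs) auto
lemma enc_nat_Leaf [simp]: "enc_nat n = Leaf \<longleftrightarrow> n = 0" by (cases n) auto
lemma right_enc_list [simp]: "right (enc_list f xs) = enc_list f (tl xs)" by (cases xs) auto
lemma right_enc_nat [simp]: "right (enc_nat n) = enc_nat (n - 1)" by (cases n) auto

text \<open>Numbers and lists have the same kind of spine, so a single comparison serves both, and
  the length of a list can be compared with a number without being computed.\<close>

primrec spine :: "tree \<Rightarrow> nat" where
  "spine Leaf = 0" | "spine (Node a b) = Suc (spine b)"

lemma spine_enc [simp]: "spine (enc_list f xs) = length xs" "spine (enc_nat n) = n"
  by (induction xs, simp_all) (induction n, simp_all)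

abbreviation yields :: "nat \<Rightarrow> tree list \<Rightarrow> tree \<Rightarrow> bool" where
  "yields f xs y \<equiv> halts f xs \<and> res f xs = y"

text \<open>The condition \<open>A\<close> guards the cost only. Termination and result hold
  unconditionally and become simplification rules, while cost bounds are supplied where the sizes
  are known.\<close>

abbreviation runs_to :: "nat \<Rightarrow> tree list \<Rightarrow> tree \<Rightarrow> bool \<Rightarrow> nat \<Rightarrow> bool" where
  "runs_to f xs y A T \<equiv> halts f xs \<and> res f xs = y \<and> (A \<longrightarrow> cost f xs \<le> T)"

lemma runs_toI:
  assumes "prog ! f = b" "f < length prog" "wp prog xs b (\<lambda>t v. v = y \<and> (A \<longrightarrow> t \<le> T))"
  shows "runs_to f xs y A T"
  using wp_body[OF assms] by blast

lemma runs_toD: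
  assumes "runs_to f xs y A T"
  shows "halts f xs" "res f xs = y" "A \<Longrightarrow> cost f xs \<le> T"
  using assms by blast+

lemma costD: "runs_to f xs y True T \<Longrightarrow> cost f xs \<le> T" by blast

section \<open>Numbers and lists\<close>

lemma eq_spec: "runs_to f_eq [enc_nat a, enc_nat b] (bool_tree (a = b)) True (12 * Suc a)"
proof (induction a arbitrary: b)
  case 0
  show ?case by (rule runs_toI, (rule code)+) (auto simp: b_eq_def)
next
  case (Suc a)
  show ?case by (rule runs_toI, (rule code)+) (use Suc[of "b - 1"] in \<open>cases b; auto simp: b_eq_def\<close>)
qed

lemmas eq_run [simp] = eq_spec[THEN runs_toD(1)] eq_spec[THEN runs_toD(2)]
lemmas eq_cost = eq_spec[THEN costD]

lemma mem_spec: "runs_to f_mem [enc_nat x, nl xs]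
      (bool_tree (x \<in> set xs)) True
      (Suc (length xs) * (12 * Suc x + 20))"
proof (induction xs)
  case Nil
  show ?case by (rule runs_toI, (rule code)+) (auto simp: b_mem_def)
next
  case (Cons a xs)
  show ?case by (rule runs_toI, (rule code)+) (use Cons eq_cost[of x a] in \<open>auto simp: b_mem_def\<close>)
qed

lemmas mem_run [simp] = mem_spec[THEN runs_toD(1)] mem_spec[THEN runs_toD(2)]
lemmas mem_cost = mem_spec[THEN costD]

lemma app_spec: "runs_to f_app [enc_list f xs, enc_list f ys] (enc_list f (xs @ ys)) True (10 * Suc
    (length xs))"
proof (induction xs)
  case Nil
  show ?case by (rule runs_toI, (rule code)+) (auto simp: b_app_def)
next
  case (Cons a xs)
  show ?case by (rule runs_toI, (rule code)+) (use Cons in \<open>auto simp: b_app_def\<close>)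
qed

lemmas app_run [simp] = app_spec[THEN runs_toD(1)] app_spec[THEN runs_toD(2)]
lemmas app_cost = app_spec[THEN costD]

lemma down_spec: "runs_to f_down [enc_nat n] (nl (down n)) True (10 * Suc n)"
proof (induction n)
  case 0
  show ?case by (rule runs_toI, (rule code)+) (auto simp: b_down_def)
next
  case (Suc n)
  show ?case by (rule runs_toI, (rule code)+) (use Suc in \<open>auto simp: b_down_def\<close>)
qed

lemmas down_run [simp] = down_spec[THEN runs_toD(1)] down_spec[THEN runs_toD(2)]
lemmas down_cost = down_spec[THEN costD]

text \<open>The bound depends on the first argument alone. Comparing a short list with
  \<open>k\<close> is therefore cheap however large \<open>k\<close> is.\<close>

lemma leq_spec: "runs_to f_leq [x, y] (bool_tree (spine x \<le> spine y)) True (12 * Suc (spine x))"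
proof (induction x arbitrary: y)
  case Leaf
  show ?case by (rule runs_toI, (rule code)+) (auto simp: b_leq_def)
next
  case (Node x1 x2)
  show ?case by (rule runs_toI, (rule code)+) (use Node(2)[of "right y"] in \<open>cases y; auto simp: b_leq_def\<close>)
qed

lemmas leq_run [simp] = leq_spec[THEN runs_toD(1)] leq_spec[THEN runs_toD(2)]
lemmas leq_cost = leq_spec[THEN costD]

text \<open>
  From here on \<open>M\<close> bounds all vertices, colours and list lengths, and \<open>T_x M\<close> is a polynomial step bound for the
  function \<open>x\<close> or for one unit of its work.
\<close>

definition T_eq :: "nat \<Rightarrow> nat" where "T_eq M = 12 * M"
definition T_mem :: "nat \<Rightarrow> nat" where "T_mem M = M * (T_eq M + 20)"

lemma eq_cost_le: "a < M \<Longrightarrow> cost f_eq [enc_nat a, enc_nat b] \<le> T_eq M"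
  using eq_cost[of a b] by (simp add: T_eq_def)

lemma mem_cost_le:
  assumes "x < M" "length xs < M"
  shows "cost f_mem [enc_nat x, nl xs] \<le> T_mem M"
proof -
  have "Suc (length xs) * (12 * Suc x + 20) \<le> M * (T_eq M + 20)"
    using assms by (intro mult_le_mono) (auto simp: T_eq_def)
  then show ?thesis using mem_cost[of x xs] by (simp add: T_mem_def)
qed

lemma diff_spec: "runs_to f_diff [nl vs, nl W]
      (nl (filter (\<lambda>v. v \<notin> set W) vs)) ((\<forall>v \<in> set vs. v < M) \<and> length W < M)
      (Suc (length vs) * (T_mem M + 40))"
proof (induction vs)
  case Nil
  show ?case by (rule runs_toI, (rule code)+) (auto simp: b_diff_def)
next
  case (Cons v vs)
  show ?case by (rule runs_toI, (rule code)+)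
    (use Cons mem_cost_le[of v M W] in \<open>auto simp: b_diff_def\<close>)
qed

lemmas diff_run [simp] = diff_spec[THEN runs_toD(1)] diff_spec[THEN runs_toD(2)]
lemmas diff_cost = diff_spec[THEN runs_toD(3), OF conjI]

section \<open>Cost of preparing one colour\<close>

lemma colour_spec: "runs_to f_colour [enc_nat c, nl X, enc_es es]
      (enc_pairs (colour_pairs c X es)) ((\<forall>(i, u, v) \<in> set es. i < M \<and> u < M \<and> v < M) \<and> length X < M)
      (Suc (length es) * (T_eq M + 2 * T_mem M + 60))"
proof (induction es)
  case Nil
  show ?case by (rule runs_toI, (rule code)+) (auto simp: b_colour_def colour_pairs_def)
next
  case (Cons e es)
  obtain i u v where e: "e = (i, u, v)" by (cases e)
  show ?case unfolding e by (rule runs_toI, (rule code)+)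
    (use Cons mem_cost_le[of u M X] mem_cost_le[of v M X] eq_cost_le[of i M c]
     in \<open>auto simp: b_colour_def colour_pairs_def\<close>)
qed

lemmas colour_run [simp] = colour_spec[THEN runs_toD(1)] colour_spec[THEN runs_toD(2)]
lemmas colour_cost = colour_spec[THEN runs_toD(3), OF conjI]

definition below :: "nat \<Rightarrow> (nat \<times> nat) list \<Rightarrow> bool" where
  "below M E \<longleftrightarrow> (\<forall>(a, b) \<in> set E. a < M \<and> b < M)"

lemma below_simps [simp]: "below M []" "below M ((a, b) # E) \<longleftrightarrow> a < M \<and> b < M \<and> below M E"
  by (auto simp: below_def)

lemma avoid_spec: "runs_to f_avoid [nl Y, enc_pairs E]
      (enc_pairs (avoid (set Y) E)) (below M E \<and> length Y < M)
      (Suc (length E) * (2 * T_mem M + 60))"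
proof (induction E)
  case Nil
  show ?case by (rule runs_toI, (rule code)+) (auto simp: b_avoid_def)
next
  case (Cons e E)
  obtain u v where e: "e = (u, v)" by (cases e)
  show ?case unfolding e by (rule runs_toI, (rule code)+)
    (use Cons mem_cost_le[of u M Y] mem_cost_le[of v M Y] in \<open>auto simp: b_avoid_def\<close>)
qed

lemmas avoid_run [simp] = avoid_spec[THEN runs_toD(1)] avoid_spec[THEN runs_toD(2)]
lemmas avoid_cost = avoid_spec[THEN runs_toD(3), OF conjI]

lemma inner_spec: "runs_to f_inner [nl Y, enc_pairs E]
      (enc_pairs (inner_pairs Y E)) (below M E \<and> length Y < M)
      (Suc (length E) * (2 * T_mem M + 60))"
proof (induction E)
  case Nil
  show ?case by (rule runs_toI, (rule code)+) (auto simp: b_inner_def inner_pairs_def)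
next
  case (Cons e E)
  obtain u v where e: "e = (u, v)" by (cases e)
  show ?case unfolding e by (rule runs_toI, (rule code)+)
    (use Cons mem_cost_le[of u M Y] mem_cost_le[of v M Y] in \<open>auto simp: b_inner_def inner_pairs_def\<close>)
qed

lemmas inner_run [simp] = inner_spec[THEN runs_toD(1)] inner_spec[THEN runs_toD(2)]
lemmas inner_cost = inner_spec[THEN runs_toD(3), OF conjI]

lemma cross_spec: "runs_to f_cross [nl Y, enc_pairs E]
      (enc_pends (cross_pairs Y E)) (below M E \<and> length Y < M)
      (Suc (length E) * (2 * T_mem M + 60))"
proof (induction E)
  case Nil
  show ?case by (rule runs_toI, (rule code)+) (auto simp: b_cross_def)
next
  case (Cons e E)
  obtain u v where e: "e = (u, v)" by (cases e)
  show ?case unfolding e by (rule runs_toI, (rule code)+)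
    (use Cons mem_cost_le[of u M Y] mem_cost_le[of v M Y] in \<open>auto simp: b_cross_def\<close>)
qed

lemmas cross_run [simp] = cross_spec[THEN runs_toD(1)] cross_spec[THEN runs_toD(2)]
lemmas cross_cost = cross_spec[THEN runs_toD(3), OF conjI]

lemma nbrs_spec: "runs_to f_nbrs [enc_nat v, enc_pairs E]
      (nl (nbrs v E)) (below M E)
      (Suc (length E) * (2 * T_eq M + 60))"
proof (induction E)
  case Nil
  show ?case by (rule runs_toI, (rule code)+) (auto simp: b_nbrs_def)
next
  case (Cons e E)
  obtain a b where e: "e = (a, b)" by (cases e)
  show ?case unfolding e by (rule runs_toI, (rule code)+)
    (use Cons eq_cost_le[of a M v] eq_cost_le[of b M v] in \<open>auto simp: b_nbrs_def\<close>)
qed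

lemmas nbrs_run [simp] = nbrs_spec[THEN runs_toD(1)] nbrs_spec[THEN runs_toD(2)]
lemmas nbrs_cost = nbrs_spec[THEN runs_toD(3)]

lemma tl_eq_Nil_iff: "tl xs = [] \<longleftrightarrow> length xs \<le> 1"
  by (cases xs) auto

definition T_nbrs :: "nat \<Rightarrow> nat" where "T_nbrs M = M * (2 * T_eq M + 60)"

lemma nbrs_cost_le:
  assumes "below M E" "length E < M"
  shows "cost f_nbrs [enc_nat v, enc_pairs E] \<le> T_nbrs M"
proof -
  have "Suc (length E) * (2 * T_eq M + 60) \<le> M * (2 * T_eq M + 60)"
    using assms by (intro mult_le_mono) auto
  then show ?thesis using nbrs_cost[OF assms(1), of v] by (simp add: T_nbrs_def)
qed

lemma pick_spec: "runs_to f_pick [nl vs, enc_pairs E]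
      (enc_opt enc_nat (pick vs E)) (below M E \<and> length E < M)
      (Suc (length vs) * (T_nbrs M + 40))"
proof (induction vs)
  case Nil
  show ?case by (rule runs_toI, (rule code)+) (auto simp: b_pick_def)
next
  case (Cons v vs)
  show ?case by (rule runs_toI, (rule code)+)
    (use Cons nbrs_cost_le[of M E v] in \<open>auto simp: b_pick_def tl_eq_Nil_iff\<close>)
qed

lemmas pick_run [simp] = pick_spec[THEN runs_toD(1)] pick_spec[THEN runs_toD(2)]
lemmas pick_cost = pick_spec[THEN runs_toD(3), OF conjI]

definition T_order1 :: "nat \<Rightarrow> nat" where
  "T_order1 M = M * (T_nbrs M + 40) + T_nbrs M + M * (T_mem M + 40) + M * (2 * T_mem M + 60) + 100"

lemma length_avoid_le: "length (avoid S E) \<le> length E" by (simp add: avoid_def)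
lemma below_avoid: "below M E \<Longrightarrow> below M (avoid S E)" by (auto simp: avoid_def below_def)

lemma order_spec: "runs_to f_order [nl vs, enc_pairs E]
      (enc_ord (elim_order vs E)) (below M E \<and> length E < M \<and> (\<forall>v \<in> set vs. v < M) \<and> length vs < M \<and> 1 < M)
      (Suc (length vs) * T_order1 M)"
proof (induction vs E rule: elim_order.induct)
  case (1 vs E)
  let ?A = "below M E \<and> length E < M \<and> (\<forall>v \<in> set vs. v < M) \<and> length vs < M \<and> 1 < M"
  have pc: "?A \<longrightarrow> cost f_pick [nl vs, enc_pairs E] \<le> M * (T_nbrs M + 40)"
  proof
    assume A: ?A
    have "Suc (length vs) * (T_nbrs M + 40) \<le> M * (T_nbrs M + 40)"
      using A by (intro mult_le_mono) auto
    then show "cost f_pick [nl vs, enc_pairs E] \<le> M * (T_nbrs M + 40)"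
      using pick_cost[of M E vs] A by linarith
  qed
  have o1: "halts f_order1 [enc_opt enc_nat (pick vs E), nl vs, enc_pairs E] \<and>
    res f_order1 [enc_opt enc_nat (pick vs E), nl vs, enc_pairs E] = enc_ord (elim_order vs E) \<and>
    (?A \<longrightarrow> cost f_order1 [enc_opt enc_nat (pick vs E), nl vs, enc_pairs E] + M * (T_nbrs M + 40) + 40
       \<le> Suc (length vs) * T_order1 M)"
  proof (cases "pick vs E")
    case None
    have "runs_to f_order1 [enc_opt enc_nat (pick vs E), nl vs, enc_pairs E]
      (enc_ord (elim_order vs E)) True
      60"
      by (rule runs_toI, (rule code)+) (auto simp: b_order1_def None elim_order.simps)
    then show ?thesis by (auto simp: T_order1_def)
  next
    case (Some v)
    note pk = pick_Some[OF Some]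
    let ?vs = "filter (\<lambda>x. x \<noteq> v) vs" and ?E = "avoid {v} E"
    have lv: "Suc (length ?vs) \<le> length vs"
      using pk length_filter_less[of v vs "\<lambda>x. x \<noteq> v"] by auto
    have dc: "?A \<longrightarrow> cost f_diff [nl vs, nl [v]] \<le> M * (T_mem M + 40)"
    proof
      assume A: ?A
      have "Suc (length vs) * (T_mem M + 40) \<le> M * (T_mem M + 40)"
        using A by (intro mult_le_mono) auto
      then show "cost f_diff [nl vs, nl [v]] \<le> M * (T_mem M + 40)"
        using diff_cost[of vs M "[v]"] A by simp
    qed
    have ac: "?A \<longrightarrow> cost f_avoid [nl [v], enc_pairs E] \<le> M * (2 * T_mem M + 60)"
    proof
      assume A: ?A
      have "Suc (length E) * (2 * T_mem M + 60) \<le> M * (2 * T_mem M + 60)"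
        using A by (intro mult_le_mono) auto
      then show "cost f_avoid [nl [v], enc_pairs E] \<le> M * (2 * T_mem M + 60)"
        using avoid_cost[of M E "[v]"] A by simp
    qed
    have ih: "?A \<longrightarrow> cost f_order [nl ?vs, enc_pairs ?E] \<le> length vs * T_order1 M"
    proof
      assume A: ?A
      have "Suc (length ?vs) * T_order1 M \<le> length vs * T_order1 M"
        using lv by (rule mult_le_mono1)
      moreover have "length ?E < M" "below M ?E" "length ?vs < M"
        using A length_avoid_le[of "{v}" E] below_avoid lv by auto
      ultimately show "cost f_order [nl ?vs, enc_pairs ?E] \<le> length vs * T_order1 M"
        using 1[OF Some] A by auto
    qed
    have nc: "?A \<longrightarrow> cost f_nbrs [enc_nat v, enc_pairs E] \<le> T_nbrs M" using nbrs_cost_le by blast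
    have "runs_to f_order1 [enc_opt enc_nat (pick vs E), nl vs, enc_pairs E]
      (enc_ord (elim_order vs E)) ?A
      (60 + T_nbrs M + M * (T_mem M + 40) + M * (2 * T_mem M + 60) + length vs * T_order1 M)"
      by (rule runs_toI, (rule code)+)
        (use dc ac ih nc 1[OF Some] diff_spec[of vs "[v]" M] avoid_spec[of "[v]" E M]
            elim_order.simps[of vs E] Some
          in \<open>auto simp: b_order1_def\<close>)
    then show ?thesis by (auto simp: T_order1_def)
  qed
  show ?case by (rule runs_toI, (rule code)+) (use o1 pc in \<open>auto simp: b_order_def\<close>)
qed

lemmas order_run [simp] = order_spec[THEN runs_toD(1)] order_spec[THEN runs_toD(2)]

lemma ren_spec: "runs_to f_ren [enc_nat b, enc_nat a, enc_nat x] (enc_nat ((id(b :=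
    a)) x)) (x < M) (T_eq M + 10)"
  by (rule runs_toI, (rule code)+) (use eq_cost_le[of x M b] in \<open>auto simp: b_ren_def\<close>)

lemmas ren_run [simp] = ren_spec[THEN runs_toD(1)] ren_spec[THEN runs_toD(2)]
lemmas ren_cost = ren_spec[THEN runs_toD(3)]

lemma relabp_spec: "runs_to f_relabp [enc_nat b, enc_nat a, enc_pairs E]
      (enc_pairs (relab_pairs b a E)) (below M E)
      (Suc (length E) * (2 * T_eq M + 60))"
proof (induction E)
  case Nil
  show ?case by (rule runs_toI, (rule code)+) (auto simp: b_relabp_def relab_pairs_def)
next
  case (Cons e E)
  obtain x y where e: "e = (x, y)" by (cases e)
  show ?case unfolding e by (rule runs_toI, (rule code)+)
    (use Cons ren_cost[of x M b a] ren_cost[of y M b a] in \<open>auto simp: b_relabp_def relab_pairs_def\<close>)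
qed

lemmas relabp_run [simp] = relabp_spec[THEN runs_toD(1)] relabp_spec[THEN runs_toD(2)]
lemmas relabp_cost = relabp_spec[THEN runs_toD(3)]

definition pbelow :: "nat \<Rightarrow> pend list \<Rightarrow> bool" where
  "pbelow M F \<longleftrightarrow> (\<forall>e \<in> set F. fst e < M \<and> fst (snd e) < M)"

lemma pbelow_simps [simp]: "pbelow M []"
  "pbelow M ((u, y, C) # F) \<longleftrightarrow> u < M \<and> y < M \<and> pbelow M F"
  "pbelow M (F @ F') \<longleftrightarrow> pbelow M F \<and> pbelow M F'"
  by (auto simp: pbelow_def)

lemma relab_spec: "runs_to f_relab [enc_nat b, enc_nat a, enc_pends F]
      (enc_pends (relab b a F)) (pbelow M F)
      (Suc (length F) * (T_eq M + 60))"
proof (induction F)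
  case Nil
  show ?case by (rule runs_toI, (rule code)+) (auto simp: b_relab_def relab_def)
next
  case (Cons e F)
  obtain u y C where e: "e = (u, y, C)" by (cases e)
  show ?case unfolding e by (rule runs_toI, (rule code)+)
    (use Cons ren_cost[of y M b a] in \<open>auto simp: b_relab_def relab_def\<close>)
qed

lemmas relab_run [simp] = relab_spec[THEN runs_toD(1)] relab_spec[THEN runs_toD(2)]
lemmas relab_cost = relab_spec[THEN runs_toD(3)]

lemma below_relab: "below M E \<Longrightarrow> a < M \<Longrightarrow> below M (relab_pairs b a E)"
  by (auto simp: below_def relab_pairs_def)
lemma pbelow_relab: "pbelow M F \<Longrightarrow> a < M \<Longrightarrow> pbelow M (relab b a F)"
  by (auto simp: pbelow_def relab_def)

definition T_contr1 :: "nat \<Rightarrow> nat" where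
  "T_contr1 M = M * (2 * T_eq M + 60) + M * (T_eq M + 60) + T_eq M + 100"

lemma contr_spec: "runs_to f_contr [enc_pairs E, enc_pends F]
      (enc_opt enc_pends (contr E F)) (below M E \<and> pbelow M F \<and> length E < M \<and> length F < M)
      (Suc (length E) * T_contr1 M)"
proof (induction E F rule: contr.induct)
  case (1 F)
  show ?case by (rule runs_toI, (rule code)+) (auto simp: b_contr_def T_contr1_def)
next
  case (2 a b E F)
  let ?A = "below M ((a, b) # E) \<and> pbelow M F \<and> length ((a, b) # E) < M \<and> length F < M"
  have c1: "?A \<longrightarrow> cost f_relabp [enc_nat b, enc_nat a, enc_pairs E] \<le> M * (2 * T_eq M + 60)"
  proof
    assume A: ?A
    have "Suc (length E) * (2 * T_eq M + 60) \<le> M * (2 * T_eq M + 60)"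
      using A by (intro mult_le_mono) auto
    then show "cost f_relabp [enc_nat b, enc_nat a, enc_pairs E] \<le> M * (2 * T_eq M + 60)"
      using relabp_cost[of M E b a] A by simp
  qed
  have c2: "?A \<longrightarrow> cost f_relab [enc_nat b, enc_nat a, enc_pends F] \<le> M * (T_eq M + 60)"
  proof
    assume A: ?A
    have "Suc (length F) * (T_eq M + 60) \<le> M * (T_eq M + 60)"
      using A by (intro mult_le_mono) auto
    then show "cost f_relab [enc_nat b, enc_nat a, enc_pends F] \<le> M * (T_eq M + 60)"
      using relab_cost[of M F b a] A by simp
  qed
  have c3: "?A \<longrightarrow> cost f_eq [enc_nat a, enc_nat b] \<le> T_eq M" using eq_cost_le by simp
  have c4: "?A \<longrightarrow> a \<noteq> b \<longrightarrow> cost f_contr [enc_pairs (relab_pairs b a E), enc_pends (relab b a F)]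
      \<le> Suc (length E) * T_contr1 M"
    using 2 below_relab[of M E a b] pbelow_relab[of M F a b] by auto
  show ?case
    by (rule runs_toI, (rule code)+)
      (use c1 c2 c3 c4 2 in \<open>cases "a = b"; auto simp: b_contr_def T_contr1_def\<close>)
qed

lemmas contr_run [simp] = contr_spec[THEN runs_toD(1)] contr_spec[THEN runs_toD(2)]

lemma at_spec: "runs_to f_at [enc_nat v, enc_pends F]
      (enc_pends (pend_at v F)) (pbelow M F)
      (Suc (length F) * (T_eq M + 40))"
proof (induction F)
  case Nil
  show ?case by (rule runs_toI, (rule code)+) (auto simp: b_at_def)
next
  case (Cons e F)
  obtain u y C where e: "e = (u, y, C)" by (cases e)
  show ?case unfolding e by (rule runs_toI, (rule code)+)
    (use Cons eq_cost_le[of u M v] in \<open>auto simp: b_at_def\<close>)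
qed

lemmas at_run [simp] = at_spec[THEN runs_toD(1)] at_spec[THEN runs_toD(2)]
lemmas at_cost = at_spec[THEN runs_toD(3)]

lemma off_spec: "runs_to f_off [enc_nat v, enc_pends F]
      (enc_pends (pend_off v F)) (pbelow M F)
      (Suc (length F) * (T_eq M + 40))"
proof (induction F)
  case Nil
  show ?case by (rule runs_toI, (rule code)+) (auto simp: b_off_def)
next
  case (Cons e F)
  obtain u y C where e: "e = (u, y, C)" by (cases e)
  show ?case unfolding e by (rule runs_toI, (rule code)+)
    (use Cons eq_cost_le[of u M v] in \<open>auto simp: b_off_def\<close>)
qed

lemmas off_run [simp] = off_spec[THEN runs_toD(1)] off_spec[THEN runs_toD(2)]
lemmas off_cost = off_spec[THEN runs_toD(3)]

lemma push_spec: "runs_to f_push [nl ps, enc_nat y, nl C, enc_pends R] (enc_pends (push ps y C R)) True 20"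
  by (rule runs_toI, (rule code)+) (auto simp: b_push_def push_def split: list.split)

lemmas push_run [simp] = push_spec[THEN runs_toD(1)] push_spec[THEN runs_toD(2)]
lemmas push_cost = push_spec[THEN costD]

section \<open>Cost of the branching\<close>

abbreviation br_args :: "nat \<Rightarrow> (nat \<times> nat list) list \<Rightarrow> pend list \<Rightarrow> nat list \<Rightarrow> nat list list \<Rightarrow> tree list" where
  "br_args k os F D cls \<equiv> [enc_nat k, enc_ord os, enc_pends F, nl D, enc_cls cls]"

abbreviation br_ok :: "nat \<Rightarrow> (nat \<times> nat list) list \<Rightarrow> pend list \<Rightarrow> nat list \<Rightarrow> nat list list \<Rightarrow> bool" where
  "br_ok k os F D cls \<equiv> yields f_branch (br_args k os F D cls) (enc_fams (branch k os F D cls))"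

abbreviation split_args where
  "split_args L R k os D cls \<equiv> [enc_pends L, enc_pends R, enc_nat k, enc_ord os, nl D, enc_cls cls]"

abbreviation hit_res where
  "hit_res L R k v y1 C1 y2 C2 ps os D cls \<equiv> (case k of 0 \<Rightarrow> [] | Suc k' \<Rightarrow>
        branch k' os R (v # D) cls @
        branch k' ((v, ps) # os) ((v, y2, C2) # L @ R) D (C1 # cls) @
        branch k' ((v, ps) # os) ((v, y1, C1) # L @ R) D (C2 # cls))"

abbreviation merge_res where
  "merge_res L R k v y1 y2 ps os D cls \<equiv> (if y1 = y2 then [] else
        branch k ((v, ps) # os) ((v, y1, []) # relab y2 y1 (L @ R)) D cls)"

text \<open>In this and the following step lemmas the costs of recursive calls stay symbolic.
  Termination and results then follow by induction without the invariants on which the numerical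
  bound relies.\<close>

lemma hit_step:
  assumes "\<And>k'. k = Suc k' \<Longrightarrow> br_ok k' os R (v # D) cls"
    and "\<And>k'. k = Suc k' \<Longrightarrow> br_ok k' ((v, ps) # os) ((v, y2, C2) # L @ R) D (C1 # cls)"
    and "\<And>k'. k = Suc k' \<Longrightarrow> br_ok k' ((v, ps) # os) ((v, y1, C1) # L @ R) D (C2 # cls)"
  shows "runs_to f_hit (split_args ((v, y1, C1) # (v, y2, C2) # L) R k ((v, ps) # os) D cls)
      (enc_fams (hit_res L R k v y1 C1 y2 C2 ps os D cls)) True
      ((case k of 0 \<Rightarrow> 0 | Suc k' \<Rightarrow> cost f_branch (br_args k' os R (v # D) cls) +
          cost f_branch (br_args k' ((v, ps) # os) ((v, y2, C2) # L @ R) D (C1 # cls)) +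
            cost f_branch (br_args k' ((v, ps) # os) ((v, y1, C1) # L @ R) D (C2 # cls))) +
            10 * length (hit_res L R k v y1 C1 y2 C2 ps os D cls) + 20 * length L + 150)"
proof (cases k)
  case 0
  show ?thesis by (rule runs_toI, (rule code)+) (simp add: b_hit_def 0)
next
  case (Suc k')
  let ?B1 = "branch k' os R (v # D) cls"
  let ?B2 = "branch k' ((v, ps) # os) ((v, y2, C2) # L @ R) D (C1 # cls)"
  let ?B3 = "branch k' ((v, ps) # os) ((v, y1, C1) # L @ R) D (C2 # cls)"
  show ?thesis
    by (rule runs_toI, (rule code)+)
      (use assms[OF Suc] Suc app_cost[of "enc_pr enc_nat (enc_pr enc_nat nl)" L R]
        app_cost[of "enc_pr nl enc_cls" ?B2 ?B3] app_cost[of "enc_pr nl enc_cls" ?B1 "?B2 @ ?B3"]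
       in \<open>simp add: b_hit_def\<close>)
qed

lemma merge_step:
  assumes "y1 \<noteq> y2 \<Longrightarrow> br_ok k ((v, ps) # os) ((v, y1, []) # relab y2 y1 (L @ R)) D cls"
  shows "runs_to f_merge (split_args ((v, y1, C1) # (v, y2, C2) # L) R k ((v, ps) # os) D cls)
      (enc_fams (merge_res L R k v y1 y2 ps os D cls)) (pbelow M (L @ R) \<and> y1 < M)
      ((if y1 = y2 then 0 else cost f_branch (br_args k ((v, ps) # os) ((v, y1, []) # relab y2 y1 (L @
          R)) D cls)) + Suc (length (L @ R)) * (T_eq M + 60) + 10 * length L + T_eq M + 100)"
  by (rule runs_toI, (rule code)+)
    (use assms app_cost[of "enc_pr enc_nat (enc_pr enc_nat nl)" L R] relab_cost[of M "L @ R" y2 y1]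
      eq_cost_le[of y1 M y2]
     in \<open>cases "y1 = y2"; auto simp: b_merge_def\<close>)

lemma branch_drop_step:
  assumes "pend_at v F = []"
    and "br_ok k os (pend_off v F) D cls"
  shows "runs_to f_branch (br_args k ((v, ps) # os) F D cls) (enc_fams (branch k ((v, ps) # os) F D cls)) True
    (cost f_at [enc_nat v, enc_pends F] + cost f_off [enc_nat v, enc_pends F] +
      cost f_branch (br_args k os (pend_off v F) D cls) + 80)"
proof -
  have b1: "runs_to f_branch1 (split_args [] (pend_off v F) k ((v, ps) # os) D cls)
      (enc_fams (branch k os (pend_off v F) D cls)) True (cost f_branch (br_args k os (pend_off v F) D
          cls) + 30)"
    by (rule runs_toI, (rule code)+) (use assms(2) in \<open>simp add: b_branch1_def\<close>)
  show ?thesis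
    by (rule runs_toI, (rule code)+) (use b1 assms(1) in \<open>simp add: b_branch_def branch_eqs(1)\<close>)
qed

lemma branch_push_step:
  fixes v y C ps F
  defines "R \<equiv> push ps y (v # C) (pend_off v F)"
  assumes "pend_at v F = [(v, y, C)]"
    and "br_ok k os R D cls"
  shows "runs_to f_branch (br_args k ((v, ps) # os) F D cls) (enc_fams (branch k ((v, ps) # os) F D cls)) True
    (cost f_at [enc_nat v, enc_pends F] + cost f_off [enc_nat v, enc_pends F] +
      cost f_branch (br_args k os R D cls) + 120)"
proof -
  have b1: "runs_to f_branch1 (split_args [(v, y, C)] (pend_off v F) k ((v, ps) # os) D cls)
      (enc_fams (branch k os R D cls)) True (cost f_branch (br_args k os R D cls) + 70)"
    by (rule runs_toI, (rule code)+)
      (use assms(3) push_run[of ps y "v # C" "pend_off v F"] push_cost[of ps y "v # C" "pend_off v F"]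
        in \<open>simp add: b_branch1_def R_def\<close>)
  show ?thesis
    by (rule runs_toI, (rule code)+) (use b1 assms(2) in \<open>simp add: b_branch_def branch_eqs(2) R_def\<close>)
qed

lemma branch_split_step:
  assumes at: "pend_at v F = (v, y1, C1) # (v, y2, C2) # L"
    and ok: "\<And>k'. k = Suc k' \<Longrightarrow> br_ok k' os (pend_off v F) (v # D) cls"
      "\<And>k'. k = Suc k' \<Longrightarrow> br_ok k' ((v, ps) # os) ((v, y2, C2) # L @ pend_off v F) D (C1 # cls)"
      "\<And>k'. k = Suc k' \<Longrightarrow> br_ok k' ((v, ps) # os) ((v, y1, C1) # L @ pend_off v F) D (C2 # cls)"
      "y1 \<noteq> y2 \<Longrightarrow> br_ok k ((v, ps) # os) ((v, y1, []) # relab y2 y1 (L @ pend_off v F)) D cls"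
  shows "runs_to f_branch (br_args k ((v, ps) # os) F D cls) (enc_fams (branch k ((v, ps) # os) F D cls))
    (pbelow M F) (cost f_at [enc_nat v, enc_pends F] + cost f_off [enc_nat v, enc_pends F] +
    (case k of 0 \<Rightarrow> 0 | Suc k' \<Rightarrow>
       cost f_branch (br_args k' os (pend_off v F) (v # D) cls) +
       cost f_branch (br_args k' ((v, ps) # os) ((v, y2, C2) # L @ pend_off v F) D (C1 # cls)) +
       cost f_branch (br_args k' ((v, ps) # os) ((v, y1, C1) # L @ pend_off v F) D (C2 # cls))) +
    (if y1 = y2 then 0 else
       cost f_branch (br_args k ((v, ps) # os) ((v, y1, []) # relab y2 y1 (L @ pend_off v F)) D cls)) +
    20 * length (branch k ((v, ps) # os) F D cls) + Suc (length F) * (T_eq M + 60) + 30 * length F +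
        T_eq M + 400)"
    (is "runs_to _ _ _ _ (?A + ?O + ?H + ?G + _ + _ + _ + _ + _)")
proof -
  let ?R = "pend_off v F"
  let ?L = "(v, y1, C1) # (v, y2, C2) # L"
  let ?hr = "hit_res L ?R k v y1 C1 y2 C2 ps os D cls" and ?mr = "merge_res L ?R k v y1 y2 ps os D cls"
  have h: "runs_to f_hit (split_args ?L ?R k ((v, ps) # os) D cls)
      (enc_fams ?hr) True
      (?H + 10 * length ?hr + 20 * length L + 150)"
    by (rule hit_step) (use ok in blast)+
  have m: "runs_to f_merge (split_args ?L ?R k ((v, ps) # os) D cls)
      (enc_fams ?mr) (pbelow M (L @ ?R) \<and> y1 < M)
      (?G + Suc (length (L @ ?R)) * (T_eq M + 60) + 10 * length L + T_eq M + 100)"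
    by (rule merge_step) (use ok in blast)
  have F: "set F = set ?L \<union> set ?R" "length F = length ?L + length ?R"
    using length_at_off[of v F] unfolding at[symmetric] by auto
  have sub: "set (L @ ?R) \<subseteq> set F" "(v, y1, C1) \<in> set F" using equalityD2[OF F(1)] by auto
  have m': "cost f_merge (split_args ?L ?R k ((v, ps) # os) D cls) \<le>
      ?G + Suc (length (L @ ?R)) * (T_eq M + 60) + 10 * length L + T_eq M + 100" if pb: "pbelow M F"
  proof -
    have "pbelow M (L @ ?R)" using sub(1) pb unfolding pbelow_def by blast
    moreover have "y1 < M" using bspec[OF pb[unfolded pbelow_def] sub(2)] by simp
    ultimately show ?thesis using m by blast
  qed
  have b1: "runs_to f_branch1 (split_args ?L ?R k ((v, ps) # os) D cls)
      (enc_fams (?hr @ ?mr)) True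
      (cost f_hit (split_args ?L ?R k ((v, ps) # os) D cls) + cost f_merge (split_args ?L ?R k ((v, ps)
          # os) D cls) + 10 * length ?hr + 60)"
    by (rule runs_toI, (rule code)+)
      (use h m app_cost[of "enc_pr nl enc_cls" ?hr ?mr] in \<open>simp add: b_branch1_def\<close>)
  have br: "runs_to f_branch (br_args k ((v, ps) # os) F D cls)
      (enc_fams (branch k ((v, ps) # os) F D cls)) True
      (?A + ?O + cost f_branch1 (split_args ?L ?R k ((v, ps) # os) D cls) + 50)"
    by (rule runs_toI, (rule code)+)
      (use b1 at in \<open>simp add: b_branch_def branch_eqs(3)\<close>)
  have l1: "length ?hr \<le> length (branch k ((v, ps) # os) F D cls)"
    unfolding branch_eqs(3)[OF at] by simp
  have l2: "Suc (length (L @ ?R)) * (T_eq M + 60) \<le> Suc (length F) * (T_eq M + 60)"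
    using F(2) by (intro mult_le_mono1) simp
  have l3: "length L \<le> length F" using F(2) by simp
  \<comment> \<open>Stated over variables, so that linear arithmetic meets atoms instead of large
    terms.\<close>
  have arith: "br \<le> A + O' + H + G + 20 * lb + SF + 30 * lF + T + 400"
    if "br \<le> A + O' + b + 50" "b \<le> hc + mc + 10 * l + 60" "hc \<le> H + 10 * l + 20 * lL + 150"
      "mc \<le> G + SL + 10 * lL + T + 100" "l \<le> lb" "SL \<le> SF" "lL \<le> lF"
    for br A O' H G lb SF lF T b hc mc l lL SL :: nat
    using that by linarith
  show ?thesis
    using br arith[OF br[THEN costD] b1[THEN costD] h[THEN costD] m' l1 l2 l3] by blast
qed

lemma branch_Nil_step:
  "runs_to f_branch (br_args k [] F D cls) (enc_fams (branch k [] F D cls)) True 20"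
  by (rule runs_toI, (rule code)+) (simp add: b_branch_def)

lemma branch_run: "br_ok k os F D cls"
proof (induction k os F D cls rule: branch_induct)
  case (Nil k F D cls)
  show ?case using branch_Nil_step by blast
next
  case (drop k v ps os F D cls)
  show ?case using branch_drop_step[OF drop] by blast
next
  case (push k v ps os F D cls y C)
  show ?case using branch_push_step[OF push] by blast
next
  case (split k v ps os F D cls y1 C1 y2 C2 L)
  show ?case using branch_split_step[OF split.hyps split.IH] by blast
qed

lemma branch_run_simps [simp]:
  "halts f_branch (br_args k os F D cls)" "res f_branch (br_args k os F D cls) =
      enc_fams (branch k os F D cls)"
  using branch_run by blast+

lemma length_le_weight: "length fs \<le> weight fs"
proof (induction fs)
  case (Cons f fs)
  obtain D cls where f: "f = (D, cls)" by (cases f)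
  have "(1 :: nat) \<le> 2 ^ length cls" by simp
  then show ?case using Cons unfolding f weight_simps list.size by linarith
qed simp

definition T_node :: "nat \<Rightarrow> nat" where
  "T_node M = 3 * (M * (T_eq M + 60)) + T_eq M + 30 * M + 500"

lemma inv_pbelow: "state_inv Lb os F \<Longrightarrow> Lb \<union> nodes os \<subseteq> {..<M} \<Longrightarrow> pbelow M F"
  unfolding state_inv_def pbelow_def by (meson UnCI lessThan_iff subsetD)

text \<open>Every recursive call shortens the state by at least one vertex or edge, and the weight
  bounds of the children add up to at most that of the parent. So one layer of
  \<open>T_node\<close>, multiplied by the weight, pays for the local work at each level.\<close>

lemma branch_cost:
  assumes "state_inv Lb os F" "Lb \<union> nodes os \<subseteq> {..<M}" "card Lb \<le> Suc p" "length F < M"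
  shows "cost f_branch (br_args k os F D cls) \<le>
    Suc (length os + length F) * (2 ^ length cls * 10 ^ k * 2 ^ p * T_node M)"
  using assms
proof (induction k os F D cls arbitrary: Lb p rule: branch_induct)
  case (Nil k F D cls)
  have "1 * (1 * 20) \<le> Suc (length [] + length F) * (2 ^ length cls * 10 ^ k * 2 ^ p * T_node M)"
    by (intro mult_le_mono) (auto simp: T_node_def)
  then show ?case using branch_Nil_step[of k F D cls, THEN costD] by simp
next
  case (drop k v ps os F D cls)
  let ?W = "2 ^ length cls * 10 ^ k * 2 ^ p :: nat"
  have W: "T_node M \<le> ?W * T_node M" by simp
  have pb: "pbelow M F" by (rule inv_pbelow[OF drop.prems(1,2)])
  have ao: "Suc (length F) * (T_eq M + 40) \<le> M * (T_eq M + 60)"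
    using drop.prems(4) by (intro mult_le_mono) auto
  have F: "length (pend_off v F) = length F" using length_at_off[of v F] drop.hyps by simp
  have "cost f_branch (br_args k os (pend_off v F) D cls) \<le> Suc (length os + length F) * (?W * T_node M)"
    using drop.IH[OF inv_drop[OF drop.prems(1)] _ drop.prems(3)] drop.prems(2,4) unfolding F by auto
  then have "cost f_branch (br_args k ((v, ps) # os) F D cls) \<le> Suc (length os +
      length F) * (?W * T_node M) + T_node M"
    using branch_drop_step[where k = k and ps = ps and os = os and D = D and cls =
        cls, OF drop.hyps branch_run, THEN costD] at_cost[OF pb, of v] off_cost[OF pb, of v] ao
    unfolding T_node_def[of M] by linarith
  moreover have "Suc (length ((v, ps) # os) + length F) * (?W * T_node M) =
      Suc (length os + length F) * (?W * T_node M) + ?W * T_node M" by simp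
  ultimately show ?case using W by linarith
next
  case (push k v ps os F D cls y C)
  let ?W = "2 ^ length cls * 10 ^ k * 2 ^ p :: nat" and ?F = "push ps y (v # C) (pend_off v F)"
  have W: "T_node M \<le> ?W * T_node M" by simp
  have pb: "pbelow M F" by (rule inv_pbelow[OF push.prems(1,2)])
  have ao: "Suc (length F) * (T_eq M + 40) \<le> M * (T_eq M + 60)"
    using push.prems(4) by (intro mult_le_mono) auto
  have F: "length ?F \<le> length F" using length_at_off[of v F] push.hyps
    by (auto simp: push_def split: list.split)
  have "cost f_branch (br_args k os ?F D cls) \<le> Suc (length os + length ?F) * (?W * T_node M)"
    using push.IH[OF inv_push[OF push.prems(1) push.hyps] _ push.prems(3)] push.prems(2,4) F by auto
  also have "\<dots> \<le> Suc (length os + length F) * (?W * T_node M)" using F by (intro mult_le_mono1) simp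
  finally have "cost f_branch (br_args k ((v, ps) # os) F D cls) \<le> Suc (length os +
      length F) * (?W * T_node M) + T_node M"
    using branch_push_step[where k = k and ps = ps and os = os and D = D and cls =
        cls, OF push.hyps branch_run, THEN costD] at_cost[OF pb, of v] off_cost[OF pb, of v] ao
    unfolding T_node_def[of M] by linarith
  moreover have "Suc (length ((v, ps) # os) + length F) * (?W * T_node M) =
      Suc (length os + length F) * (?W * T_node M) + ?W * T_node M" by simp
  ultimately show ?case using W by linarith
next
  case (split k v ps os F D cls y1 C1 y2 C2 L)
  note i = split.prems(1) and at = split.hyps
  let ?W = "2 ^ length cls * 10 ^ k * 2 ^ p :: nat" and ?R = "pend_off v F"
  let ?s = "Suc (length os + length F)"
  have W: "T_node M \<le> ?W * T_node M" by simp
  have pb: "pbelow M F" by (rule inv_pbelow[OF i split.prems(2)])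
  have ao: "Suc (length F) * (T_eq M + 40) \<le> M * (T_eq M + 60)"
    "Suc (length F) * (T_eq M + 60) \<le> M * (T_eq M + 60)"
    using split.prems(4) by (intro mult_le_mono; auto)+
  have F: "length F = Suc (Suc (length L + length ?R))" using length_at_off[of v F] at by simp
  have nd: "Lb \<union> nodes os \<subseteq> {..<M}" using split.prems(2) by auto
  \<comment> \<open>Appending the results of the children costs time in proportion to the number of
    families, which is at most their weight.\<close>
  have len: "20 * length (branch k ((v, ps) # os) F D cls) \<le> 20 * ?W"
    using le_trans[OF length_le_weight branch_weight[OF i split.prems(3)]] by simp
  have mrg: "2 * (if y1 = y2 then 0 else
      cost f_branch (br_args k ((v, ps) # os) ((v, y1, []) # relab y2 y1 (L @ ?R)) D cls)) \<le>
          ?s * (?W * T_node M)"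
  proof (cases "y1 = y2")
    case False
    obtain p' where p': "p = Suc p'" "card (Lb - {y2}) \<le> Suc p'"
      using card_labels_merge[OF i at False split.prems(3)] by blast
    have c: "cost f_branch (br_args k ((v, ps) # os) ((v, y1, []) # relab y2 y1 (L @ ?R)) D cls) \<le>
      Suc (length ((v, ps) # os) + length ((v, y1, []) # relab y2 y1 (L @ ?R))) *
        (2 ^ length cls * 10 ^ k * 2 ^ p' * T_node M)"
      by (rule split.IH(4)[OF False inv_merge(1)[OF i at False] _ p'(2)])
        (use split.prems(2,4) F in auto)
    have "Suc (length ((v, ps) # os) + length ((v, y1, []) # relab y2 y1 (L @ ?R))) = ?s"
      using F by simp
    note c[unfolded this]
    moreover have "?s * (?W * T_node M) = 2 * (?s * (2 ^ length cls * 10 ^ k * 2 ^ p' * T_node M))"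
      unfolding p'(1) by simp
    ultimately show ?thesis unfolding if_not_P[OF False] by linarith
  qed simp
  have hit: "2 * (case k of 0 \<Rightarrow> 0 | Suc k' \<Rightarrow>
       cost f_branch (br_args k' os ?R (v # D) cls) +
       cost f_branch (br_args k' ((v, ps) # os) ((v, y2, C2) # L @ ?R) D (C1 # cls)) +
       cost f_branch (br_args k' ((v, ps) # os) ((v, y1, C1) # L @ ?R) D (C2 # cls))) \<le> ?s * (?W * T_node M)"
  proof (cases k)
    case (Suc k')
    let ?w = "2 ^ length cls * 10 ^ k' * 2 ^ p * T_node M"
    have "cost f_branch (br_args k' os ?R (v # D) cls) \<le> Suc (length os + length ?R) * ?w"
      by (rule split.IH(1)[OF Suc inv_drop[OF i] nd split.prems(3)]) (use F split.prems(4) in simp)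
    also have "\<dots> \<le> ?s * ?w" using F by (intro mult_le_mono1) simp
    finally have c1: "cost f_branch (br_args k' os ?R (v # D) cls) \<le> ?s * ?w" .
    have "cost f_branch (br_args k' ((v, ps) # os) ((v, y2, C2) # L @ ?R) D (C1 # cls)) \<le>
      Suc (length ((v, ps) # os) + length ((v, y2, C2) # L @ ?R)) *
        (2 ^ length (C1 # cls) * 10 ^ k' * 2 ^ p * T_node M)"
      by (rule split.IH(2)[OF Suc inv_cut(1)[OF i at] split.prems(2,3)]) (use F split.prems(4) in simp)
    also have "\<dots> = 2 * (?s * ?w)" using F by (simp add: algebra_simps)
    finally have c2: "cost f_branch (br_args k' ((v, ps) # os) ((v, y2, C2) # L @ ?R) D (C1 # cls)) \<le>
        2 * (?s * ?w)" .
    have "cost f_branch (br_args k' ((v, ps) # os) ((v, y1, C1) # L @ ?R) D (C2 # cls)) \<le>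
      Suc (length ((v, ps) # os) + length ((v, y1, C1) # L @ ?R)) *
        (2 ^ length (C2 # cls) * 10 ^ k' * 2 ^ p * T_node M)"
      by (rule split.IH(3)[OF Suc inv_cut(2)[OF i at] split.prems(2,3)]) (use F split.prems(4) in simp)
    also have "\<dots> = 2 * (?s * ?w)" using F by (simp add: algebra_simps)
    finally have c3: "cost f_branch (br_args k' ((v, ps) # os) ((v, y1, C1) # L @ ?R) D (C2 # cls)) \<le>
        2 * (?s * ?w)" .
    define X where "X = ?s * ?w"
    have W: "?s * (?W * T_node M) = 10 * X" unfolding Suc X_def by simp
    have "2 * (a + b + c) \<le> 10 * x" if "a \<le> x" "b \<le> 2 * x" "c \<le> 2 * x" for a b c x :: nat
      using that by simp
    from this[OF c1 c2 c3] show ?thesis unfolding W[unfolded Suc] X_def[symmetric] Suc nat.case .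
  qed simp
  \<comment> \<open>The last 20 is split off because it must pay, after multiplication by the
    weight, for the appends; the remainder pays for the other work of the call.\<close>
  have T: "T_node M = 3 * (M * (T_eq M + 60)) + T_eq M + 30 * M + 480 + 20" by (simp add: T_node_def)
  have "3 * (M * (T_eq M + 60)) + T_eq M + 30 * M + 480 + 20 * ?W \<le> ?W * T_node M"
    unfolding T distrib_left[of ?W _ 20]
    by (intro add_mono) (auto simp: mult.commute)
  note l4 = this
  have arith: "br \<le> X + WT"
    if "br \<le> A + O' + H + G + 20 * lb + SF + 30 * lF + T + 400" "A \<le> SA" "O' \<le> SA" "SA \<le> MT" "SF \<le> MT"
      "20 * lb \<le> 20 * W" "2 * G \<le> X" "2 * H \<le> X" "lF < M" "3 * MT + T + 30 * M + 480 + 20 * W \<le> WT"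
    for br X WT A O' H G lb SF lF T SA MT W M :: nat
    using that by linarith
  have "cost f_branch (br_args k ((v, ps) # os) F D cls) \<le> ?s * (?W * T_node M) + ?W * T_node M"
    using arith[OF branch_split_step[OF at branch_run branch_run branch_run branch_run, THEN
        runs_toD(3), OF pb] at_cost[OF pb, of v] off_cost[OF pb, of v] ao
      len mrg hit split.prems(4) l4] .
  then show ?case by simp
qed

definition T_exp :: "nat \<Rightarrow> nat" where "T_exp M = 2 * M * T_node M + 100"

lemma expand_spec: "runs_to f_expand [enc_nat k, enc_ord os, enc_pends F, enc_fams fs]
      (enc_fams (expand k os F fs)) (state_inv Lb os F \<and> Lb \<union> nodes os \<subseteq> {..<M} \<and> card Lb \<le> Suc p \<and>
          length F < M \<and> length os < M)
      (20 + weight fs * (10 ^ k * 2 ^ p * T_exp M))"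
proof (induction fs)
  case Nil
  show ?case by (rule runs_toI, (rule code)+) (auto simp: b_expand_def expand_def)
next
  case (Cons f fs)
  obtain D cls where f: "f = (D, cls)" by (cases f)
  let ?A = "state_inv Lb os F \<and> Lb \<union> nodes os \<subseteq> {..<M} \<and> card Lb \<le> Suc p \<and> length F < M \<and> length os < M"
  let ?w = "2 ^ length cls * 10 ^ k * 2 ^ p :: nat"
  have bc: "cost f_branch (br_args k os F D cls) + 10 * length (branch k os F D cls) + 80 \<le>
      ?w * T_exp M" if A: ?A
  proof -
    have "cost f_branch (br_args k os F D cls) \<le> Suc (length os + length F) * (?w * T_node M)"
      by (rule branch_cost[where Lb = Lb]) (use A in auto)
    also have "\<dots> \<le> (2 * M) * (?w * T_node M)" using A by (intro mult_le_mono1) auto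
    finally have c: "cost f_branch (br_args k os F D cls) \<le> ?w * (2 * M * T_node M)" by (simp add: ac_simps)
    have l: "length (branch k os F D cls) \<le> ?w"
      by (rule le_trans[OF length_le_weight branch_weight[where Lb = Lb]]) (use A in auto)
    have "?w * (2 * M * T_node M) + 10 * ?w + 90 * ?w \<le> ?w * T_exp M"
      unfolding T_exp_def by (simp add: algebra_simps)
    moreover have "1 \<le> ?w" by simp
    ultimately show ?thesis using c l by linarith
  qed
  have ex: "expand k os F (f # fs) = branch k os F D cls @ expand k os F fs" by (simp add: expand_def f)
  have w: "weight (f # fs) * (10 ^ k * 2 ^ p * T_exp M) = ?w * T_exp M + weight fs * (10 ^ k * 2 ^ p *
      T_exp M)"
    by (simp add: f algebra_simps)
  have "runs_to f_expand [enc_nat k, enc_ord os, enc_pends F, enc_fams (f # fs)]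
      (enc_fams (expand k os F (f # fs))) True
      (cost f_branch (br_args k os F D cls) + 10 * length (branch k os F D cls) +
          cost f_expand [enc_nat k, enc_ord os, enc_pends F, enc_fams fs] + 60)"
    unfolding ex by (rule runs_toI, (rule code)+)
      (use Cons app_cost[of "enc_pr nl enc_cls" "branch k os F D cls" "expand k os F fs"] f
       in \<open>simp add: b_expand_def\<close>)
  then show ?case using bc Cons unfolding w by (auto simp del: enc_list.simps)
qed

lemmas expand_run [simp] = expand_spec[THEN runs_toD(1)] expand_spec[THEN runs_toD(2)]
lemmas expand_cost = expand_spec[THEN runs_toD(3)]

section \<open>Cost of combining the colours\<close>

definition step_fams where
  "step_fams X Y es vs k c fs =
     (case setup_colour c X Y es vs of None \<Rightarrow> [] | Some (os, F) \<Rightarrow> expand k os F fs)"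

definition T_step :: "nat \<Rightarrow> nat" where
  "T_step M = 3 * (M * (2 * T_mem M + 60)) + M * T_contr1 M + M * T_order1 M + 200"

lemma step_spec:
  fixes X Y vs es c
  defines "E \<equiv> colour_pairs c X es"
  shows "runs_to f_step [nl Y, nl vs, enc_nat k, enc_pairs E, enc_fams fs]
      (enc_fams (step_fams X Y es vs k c fs)) (below M E \<and> length E < M \<and> length Y < M \<and>
          (\<forall>v \<in> set vs. v < M) \<and> length vs < M \<and> 1 < M)
      (T_step M + (case setup_colour c X Y es vs of None \<Rightarrow> 0 | Some (os, F) \<Rightarrow> cost f_expand [enc_nat k,
          enc_ord os, enc_pends F, enc_fams fs]))"
proof -
  let ?os = "elim_order vs (avoid (set Y) E)" and ?co = "contr (inner_pairs Y E) (cross_pairs Y E)"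
  let ?A = "below M E \<and> length E < M \<and> length Y < M \<and> (\<forall>v \<in> set vs. v < M) \<and> length vs < M \<and> 1 < M"
  let ?x = "case setup_colour c X Y es vs of None \<Rightarrow> 0
         | Some (os, F) \<Rightarrow> cost f_expand [enc_nat k, enc_ord os, enc_pends F, enc_fams fs]"
  have so: "setup_colour c X Y es vs = map_option (Pair ?os) ?co" by (simp add: setup_colour_def E_def)
  have s1: "runs_to f_step1 [enc_nat k, enc_opt enc_pends ?co, enc_ord ?os, enc_fams fs]
      (enc_fams (step_fams X Y es vs k c fs)) True
      (?x + 40)"
    by (rule runs_toI, (rule code)+)
      (cases ?co; simp add: b_step1_def step_fams_def so)
  have st: "runs_to f_step [nl Y, nl vs, enc_nat k, enc_pairs E, enc_fams fs]
      (enc_fams (step_fams X Y es vs k c fs)) True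
      (cost f_inner [nl Y, enc_pairs E] + cost f_cross [nl Y, enc_pairs E] +
          cost f_avoid [nl Y, enc_pairs E] + cost f_contr [enc_pairs (inner_pairs Y E), enc_pends
            (cross_pairs Y E)] + cost f_order [nl vs, enc_pairs (avoid (set Y) E)] +
            cost f_step1 [enc_nat k, enc_opt enc_pends ?co, enc_ord ?os, enc_fams fs] + 60)"
    by (rule runs_toI, (rule code)+) (use s1 in \<open>simp add: b_step_def\<close>)
  have "cost f_step [nl Y, nl vs, enc_nat k, enc_pairs E, enc_fams fs] \<le> T_step M + ?x" if A: ?A
  proof -
    have m: "Suc (length E) * (2 * T_mem M + 60) \<le> M * (2 * T_mem M + 60)"
      using A by (intro mult_le_mono1) simp
    have c1: "cost f_inner [nl Y, enc_pairs E] \<le> M * (2 * T_mem M + 60)"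
      using inner_cost[of M E Y] A m by simp
    have c2: "cost f_cross [nl Y, enc_pairs E] \<le> M * (2 * T_mem M + 60)"
      using cross_cost[of M E Y] A m by simp
    have c3: "cost f_avoid [nl Y, enc_pairs E] \<le> M * (2 * T_mem M + 60)"
      using avoid_cost[of M E Y] A m by simp
    have li: "length (inner_pairs Y E) < M" "below M (inner_pairs Y E)"
      using A le_less_trans[OF length_filter_le, of E M] by (auto simp: inner_pairs_def below_def)
    have lc: "length (cross_pairs Y E) < M" "pbelow M (cross_pairs Y E)"
      using A length_cross_pairs[of Y E] cross_pairs_elem[of _ Y E]
      by (auto simp: pbelow_def below_def) fastforce+
    have "cost f_contr [enc_pairs (inner_pairs Y E), enc_pends (cross_pairs Y E)] \<le>
        Suc (length (inner_pairs Y E)) * T_contr1 M" using contr_spec li lc by blast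
    also have "\<dots> \<le> M * T_contr1 M" using li by (intro mult_le_mono1) simp
    finally have c4: "cost f_contr [enc_pairs (inner_pairs Y E), enc_pends (cross_pairs Y E)] \<le>
        M * T_contr1 M" .
    have "length (avoid (set Y) E) < M" using A length_avoid_le[of "set Y" E] by linarith
    then have "cost f_order [nl vs, enc_pairs (avoid (set Y) E)] \<le> Suc (length vs) * T_order1 M"
      using order_spec below_avoid A by blast
    also have "\<dots> \<le> M * T_order1 M" using A by (intro mult_le_mono1) simp
    finally have c5: "cost f_order [nl vs, enc_pairs (avoid (set Y) E)] \<le> M * T_order1 M" .
    have arith: "s \<le> 3 * MM + CC + OD + 200 + x"
      if "s \<le> i + cr + av + co + od + s1 + 60" "i \<le> MM" "cr \<le> MM" "av \<le> MM" "co \<le> CC" "od \<le> OD" "s1 \<le> x + 40"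
      for s MM CC OD x i cr av co od s1 :: nat using that by linarith
    show ?thesis unfolding T_step_def
      by (rule arith[OF st[THEN costD] c1 c2 c3 c4 c5
          s1[THEN costD]])
  qed
  then show ?thesis using st by blast
qed

abbreviation all_args where
  "all_args X Y es vs k c fs \<equiv> [nl X, nl Y, enc_es es, nl vs, enc_nat k, enc_nat c, enc_fams fs]"

lemma all_spec: "runs_to f_all (all_args X Y es vs k c fs)
      (enc_fams (all_colours X Y es vs k c fs)) True
      ((case c of 0 \<Rightarrow> 0 | Suc c' \<Rightarrow> cost f_colour [enc_nat c', nl X, enc_es es] +
          cost f_step [nl Y, nl vs, enc_nat k, enc_pairs (colour_pairs c' X es), enc_fams fs] +
            cost f_all (all_args X Y es vs k c' (step_fams X Y es vs k c' fs))) + 40)"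
proof (induction c arbitrary: fs)
  case 0
  show ?case by (rule runs_toI, (rule code)+) (simp add: b_all_def)
next
  case (Suc c)
  show ?case by (rule runs_toI, (rule code)+)
    (use Suc[of "step_fams X Y es vs k c fs"] step_spec[of Y vs k c X es fs 0]
      in \<open>simp add: b_all_def step_fams_def\<close>)
qed

lemmas all_run [simp] = all_spec[THEN runs_toD(1)] all_spec[THEN runs_toD(2)]

definition T_all :: "nat \<Rightarrow> nat" where
  "T_all M = M * (T_eq M + 2 * T_mem M + 60) + T_step M + T_exp M + 100"

locale bounded_compression = compression +
  fixes M :: nat
  assumes nM: "n < M" and es_M: "length es < M" "\<forall>(i, u, v) \<in> set es. i < M"
    and XY_M: "length X < M" "length Y < M" and vs_M: "length vs < M" and one_M: "1 < M"
    and Yn: "set Y \<subseteq> {..<n}"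
begin

text \<open>The added one keeps the bound positive for an empty list of families, for which the
  remaining colours are still set up.\<close>

lemma all_cost:
  assumes p: "length Y \<le> Suc p"
  shows "cost f_all (all_args X Y es vs k c fs) \<le>
    Suc c * (T_all M * ((weight fs + 1) * (10 ^ k * 2 ^ p) ^ c))"
proof (induction c arbitrary: fs)
  case 0
  have "40 \<le> T_all M * ((weight fs + 1) * (10 ^ k * 2 ^ p) ^ 0)"
    using mult_le_mono[of 40 "T_all M" 1 "weight fs + 1"] by (simp add: T_all_def)
  then show ?case using all_spec[of X Y es vs k 0 fs] by simp
next
  case (Suc c)
  let ?P = "10 ^ k * 2 ^ p :: nat" and ?E = "colour_pairs c X es" and ?fs = "step_fams X Y es vs k c fs"
  have es_below: "\<forall>(i, u, v) \<in> set es. i < M \<and> u < M \<and> v < M" using es_n es_M nM by fastforce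
  have "length ?E \<le> length es" by (simp add: colour_pairs_def)
  moreover have "below M ?E" using es_below by (auto simp: below_def colour_pairs_def)
  moreover have vsM: "\<forall>v \<in> set vs. v < M" using vs nM by auto
  ultimately have A: "below M ?E \<and> length ?E < M \<and> length Y < M \<and> (\<forall>v \<in> set vs. v < M) \<and> length vs < M \<and>
      1 < M"
    using es_M XY_M vs_M one_M by auto
  have "cost f_colour [enc_nat c, nl X, enc_es es] \<le> Suc (length es) * (T_eq M + 2 * T_mem M + 60)"
    using colour_cost[OF es_below XY_M(1)] .
  also have "\<dots> \<le> M * (T_eq M + 2 * T_mem M + 60)" using es_M by (intro mult_le_mono1) simp
  finally have c1: "cost f_colour [enc_nat c, nl X, enc_es es] \<le> M * (T_eq M + 2 * T_mem M + 60)" .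
  have "(case setup_colour c X Y es vs of None \<Rightarrow> 0
         | Some (os, F) \<Rightarrow> cost f_expand [enc_nat k, enc_ord os, enc_pends F, enc_fams fs]) \<le>
      20 + weight fs * (?P * T_exp M)"
  proof (cases "setup_colour c X Y es vs")
    case (Some s)
    obtain os F where s: "s = (os, F)" by (cases s)
    note so = colour_setup(4)[OF Some[unfolded s]]
    have "set Y \<subseteq> {..<M}" using Yn nM by auto
    then have "set Y \<union> nodes os \<subseteq> {..<M}" using so vsM by auto
    moreover have "card (set Y) \<le> Suc p" using card_length[of Y] p by linarith
    moreover have "length F < M" "length os < M" using so es_M vs_M by auto
    ultimately show ?thesis using expand_cost so unfolding Some s by auto
  qed simp
  then have c2: "cost f_step [nl Y, nl vs, enc_nat k, enc_pairs ?E, enc_fams fs] \<le>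
      T_step M + (20 + weight fs * (?P * T_exp M))"
    using step_spec[of Y vs k c X es fs M] A by (meson add_left_mono le_trans)
  have w: "weight ?fs \<le> weight fs * ?P"
    using weight_expand[OF _ p] by (auto simp: step_fams_def split: option.splits)
  have "cost f_all (all_args X Y es vs k c ?fs) \<le> Suc c * (T_all M * ((weight ?fs + 1) * ?P ^ c))"
    by (rule Suc.IH)
  moreover have ww: "(weight ?fs + 1) * ?P ^ c \<le> (weight fs + 1) * ?P * ?P ^ c"
  proof (rule mult_le_mono1)
    have "1 \<le> ?P" by simp
    then show "weight ?fs + 1 \<le> (weight fs + 1) * ?P" using w unfolding distrib_right by linarith
  qed
  have "Suc c * (T_all M * ((weight ?fs + 1) * ?P ^ c)) \<le> Suc c * (T_all M * ((weight fs + 1) * ?P ^ Suc c))"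
    using ww unfolding power_Suc mult.assoc[of "weight fs + 1", symmetric] by (rule mult_le_mono2[OF
        mult_le_mono2])
  ultimately have c3: "cost f_all (all_args X Y es vs k c ?fs) \<le> Suc c * (T_all M * ((weight fs +
      1) * ?P ^ Suc c))" by (rule le_trans)
  have "M * (T_eq M + 2 * T_mem M + 60) + (T_step M + (20 + weight fs * (?P * T_exp M))) + 40 \<le>
      T_all M * ((weight fs + 1) * ?P ^ Suc c)"
  proof -
    let ?K = "M * (T_eq M + 2 * T_mem M + 60) + T_step M + 100" and ?Q = "(weight fs + 1) * ?P ^ Suc c"
    have "0 < ?Q" by simp
    then have "1 \<le> ?Q" by linarith
    then have 1: "?K * 1 \<le> ?K * ?Q" by (intro mult_le_mono2)
    have "1 \<le> ?P ^ c" by simp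
    then have "weight fs * (?P * 1) \<le> (weight fs + 1) * (?P * ?P ^ c)"
      by (intro mult_le_mono) auto
    then have "weight fs * ?P \<le> ?Q" by simp
    then have 2: "(weight fs * ?P) * T_exp M \<le> ?Q * T_exp M" by (rule mult_le_mono1)
    have 3: "T_all M * ?Q = ?K * ?Q + ?Q * T_exp M" unfolding T_all_def by (simp add: algebra_simps)
    have "a + (b + (20 + x)) + 40 \<le> z + y" if "(a + b + 100) * 1 \<le> z" "x \<le> y" for a b x y z :: nat
      using that by simp
    from this[OF 1 2] show ?thesis unfolding 3 mult.assoc .
  qed
  then show ?case using all_spec[of X Y es vs k "Suc c" fs] c1 c2 c3 by simp
qed

end

section \<open>Hitting set tables and the final size test\<close>

lemma rdup_spec: "runs_to f_rdup [nl xs]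
      (nl (remdups xs)) ((\<forall>x \<in> set xs. x < M) \<and> length xs < M)
      (Suc (length xs) * (T_mem M + 40))"
proof (induction xs)
  case Nil
  show ?case by (rule runs_toI, (rule code)+) (auto simp: b_rdup_def)
next
  case (Cons x xs)
  show ?case by (rule runs_toI, (rule code)+)
    (use Cons mem_cost_le[of x M xs] in \<open>auto simp: b_rdup_def\<close>)
qed

lemmas rdup_run [simp] = rdup_spec[THEN runs_toD(1)] rdup_spec[THEN runs_toD(2)]
lemmas rdup_cost = rdup_spec[THEN runs_toD(3), OF conjI]

lemma disj_spec: "runs_to f_disj [nl c, nl D]
      (bool_tree (set c \<inter> set D = {})) ((\<forall>x \<in> set c. x < M) \<and> length D < M)
      (Suc (length c) * (T_mem M + 40))"
proof (induction c)
  case Nil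
  show ?case by (rule runs_toI, (rule code)+) (auto simp: b_disj_def)
next
  case (Cons x c)
  show ?case by (rule runs_toI, (rule code)+)
    (use Cons mem_cost_le[of x M D] in \<open>auto simp: b_disj_def\<close>)
qed

lemmas disj_run [simp] = disj_spec[THEN runs_toD(1)] disj_spec[THEN runs_toD(2)]
lemmas disj_cost = disj_spec[THEN runs_toD(3), OF conjI]

definition T_disj :: "nat \<Rightarrow> nat" where "T_disj M = M * (T_mem M + 40)"

definition small_classes :: "nat \<Rightarrow> nat list list \<Rightarrow> bool" where
  "small_classes M cls \<longleftrightarrow> (\<forall>c \<in> set cls. length c < M \<and> (\<forall>x \<in> set c. x < M))"

lemma small_classes_simps [simp]: "small_classes M []"
  "small_classes M (c # cls) \<longleftrightarrow> length c < M \<and> (\<forall>x \<in> set c. x < M) \<and> small_classes M cls"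
  by (auto simp: small_classes_def)

lemma disj_cost_le:
  assumes "length c < M" "\<forall>x \<in> set c. x < M" "length D < M"
  shows "cost f_disj [nl c, nl D] \<le> T_disj M"
proof -
  have "Suc (length c) * (T_mem M + 40) \<le> M * (T_mem M + 40)" using assms(1) by (intro mult_le_mono1) simp
  then show ?thesis using disj_cost[of c M D] assms by (simp add: T_disj_def)
qed

lemma filt_spec: "runs_to f_filt [nl D, enc_cls cls]
      (enc_cls (filter (\<lambda>c. set c \<inter> set D = {}) cls)) (small_classes M cls \<and> length D < M)
      (Suc (length cls) * (T_disj M + 40))"
proof (induction cls)
  case Nil
  show ?case by (rule runs_toI, (rule code)+) (auto simp: b_filt_def)
next
  case (Cons c cls)
  show ?case by (rule runs_toI, (rule code)+)
    (use Cons disj_cost_le[of c M D] in \<open>auto simp: b_filt_def\<close>)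
qed

lemmas filt_run [simp] = filt_spec[THEN runs_toD(1)] filt_spec[THEN runs_toD(2)]
lemmas filt_cost = filt_spec[THEN runs_toD(3), OF conjI]

text \<open>
  A table of \<open>g\<close> over all subsequences of \<open>cls\<close>: at each level the left subtree omits the class.
\<close>

fun tabf :: "(nat list list \<Rightarrow> tree) \<Rightarrow> nat list list \<Rightarrow> tree" where
  "tabf g [] = g []"
| "tabf g (c # cs) = Node (tabf g cs) (tabf (\<lambda>R. g (c # R)) cs)"

text \<open>The tree tabulates \<open>min_hit []\<close>: only the entry for no remaining class is
  filled, and \<open>b\<close> tells whether all classes so far were omitted. The 30 on the left
  strengthens the induction: two subtrees provide it twice, once for the work at the node and once
  for the claim.\<close>

lemma base_spec: "halts f_base [b, enc_cls cls] \<and>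
    res f_base [b, enc_cls cls] = tabf (\<lambda>R. if R = [] \<and> b \<noteq> Leaf then Node Leaf Leaf else Leaf) cls \<and>
    (True \<longrightarrow> cost f_base [b, enc_cls cls] + 30 \<le> 60 * 2 ^ length cls)"
proof (induction cls arbitrary: b)
  case Nil
  have "runs_to f_base [b, enc_cls []]
      (tabf (\<lambda>R. if R = [] \<and> b \<noteq> Leaf then Node Leaf Leaf else Leaf) []) True
      30"
    by (rule runs_toI, (rule code)+) (simp add: b_base_def)
  then show ?case by simp
next
  case (Cons c cls)
  have "runs_to f_base [b, enc_cls (c # cls)]
      (tabf (\<lambda>R. if R = [] \<and> b \<noteq> Leaf then Node Leaf Leaf else Leaf) (c # cls)) True
      (cost f_base [b, enc_cls cls] + cost f_base [Leaf, enc_cls cls] + 30)"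
    by (rule runs_toI, (rule code)+) (use Cons[of b] Cons[of Leaf] in \<open>simp add: b_base_def\<close>)
  then show ?case using Cons[of b] Cons[of Leaf] by (simp del: enc_list.simps)
qed

lemmas base_run [simp] = base_spec[THEN conjunct1] base_spec[THEN conjunct2, THEN conjunct1]
lemmas base_cost = base_spec[THEN conjunct2, THEN conjunct2, rule_format, OF TrueI]

lemma cons_spec: "runs_to f_cons [enc_nat v, enc_opt nl w] (enc_opt nl (map_option (Cons v) w)) True 20"
  by (rule runs_toI, (rule code)+) (cases w; simp add: b_cons_def)

lemmas cons_run [simp] = cons_spec[THEN runs_toD(1)] cons_spec[THEN runs_toD(2)]
lemmas cons_cost = cons_spec[THEN costD]

lemma best_spec: "runs_to f_best [enc_opt nl a, enc_opt nl b]
      (enc_opt nl (best a b)) (\<forall>w. a = Some w \<longrightarrow> length w < M)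
      (12 * M + 30)"
proof (cases "a = None \<or> b = None")
  case True
  then show ?thesis by - (rule runs_toI, (rule code)+, cases a; cases b; simp add: b_best_def)
next
  case False
  then obtain x y where "a = Some x" "b = Some y" by auto
  then show ?thesis
    by - (rule runs_toI, (rule code)+, use leq_cost[of "nl x" "nl y"] in \<open>auto simp: b_best_def\<close>)
qed

lemmas best_run [simp] = best_spec[THEN runs_toD(1)] best_spec[THEN runs_toD(2)]
lemmas best_cost = best_spec[THEN runs_toD(3)]

definition T_upd :: "nat \<Rightarrow> nat" where "T_upd M = T_mem M + 12 * M + 100"

text \<open>One pass turns the tables for \<open>vs\<close> into the table for
  \<open>v # vs\<close>. Taking \<open>v\<close> removes the classes that contain it, so at such a
  class the lookup in the second table always continues in the subtree that omits the class. The
  summand \<open>T_upd M\<close> on the left is slack for the induction, as in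
  \<open>base_spec\<close>.\<close>

lemma upd_spec: "halts f_upd [enc_nat v, enc_cls cls, tabf (\<lambda>R. enc_opt nl (g R)) cls, tabf (\<lambda>R. enc_opt
    nl (h R)) cls] \<and>
    res f_upd [enc_nat v, enc_cls cls, tabf (\<lambda>R. enc_opt nl (g R)) cls, tabf (\<lambda>R. enc_opt nl (h R)) cls] =
      tabf (\<lambda>R. enc_opt nl (best (g R) (map_option (Cons v) (h (filter (\<lambda>c. v \<notin> set c) R))))) cls \<and>
    (v < M \<and> small_classes M cls \<and> (\<forall>R w. g R = Some w \<longrightarrow> length w < M) \<longrightarrow>
      cost f_upd [enc_nat v, enc_cls cls, tabf (\<lambda>R. enc_opt nl (g R)) cls, tabf (\<lambda>R. enc_opt nl (h R)) cls]
        + T_upd M \<le> 2 * T_upd M * 2 ^ length cls)"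
proof (induction cls arbitrary: g h)
  case Nil
  let ?A = "\<forall>R w. g R = Some w \<longrightarrow> length w < M"
  have "runs_to f_upd [enc_nat v, enc_cls [], enc_opt nl (g []), enc_opt nl (h [])]
      (enc_opt nl (best (g []) (map_option (Cons v) (h [])))) ?A
      (T_upd M)"
    by (rule runs_toI, (rule code)+)
      (use cons_cost[of v "h []"] best_cost[of "g []" M "map_option (Cons v) (h [])"]
        in \<open>auto simp: b_upd_def T_upd_def\<close>)
  then show ?case by auto
next
  case (Cons c cls)
  \<comment> \<open>In the subtree that includes \<open>c\<close>, the second table is read without
    \<open>c\<close> if \<open>v\<close> already meets it.\<close>
  let ?g = "\<lambda>R. g (c # R)" and ?h = "\<lambda>R. if v \<in> set c then h R else h (c # R)"
  let ?T1 = "[enc_nat v, enc_cls cls, tabf (\<lambda>R. enc_opt nl (g R)) cls, tabf (\<lambda>R. enc_opt nl (h R)) cls]"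
  let ?T2 = "[enc_nat v, enc_cls cls, tabf (\<lambda>R. enc_opt nl (?g R)) cls, tabf (\<lambda>R. enc_opt nl (?h R)) cls]"
  let ?T = "[enc_nat v, enc_cls (c # cls), tabf (\<lambda>R. enc_opt nl (g R)) (c # cls), tabf (\<lambda>R. enc_opt nl
      (h R)) (c # cls)]"
  note ih1 = Cons[of g h] and ih2 = Cons[of ?g ?h]
  have "runs_to f_upd ?T
      (tabf (\<lambda>R. enc_opt nl (best (g R) (map_option (Cons v) (h (filter (\<lambda>c. v \<notin> set c) R))))) (c # cls)) True
      (cost f_upd ?T1 + cost f_upd ?T2 + cost f_mem [enc_nat v, nl c] + 60)"
    by (rule runs_toI, (rule code)+)
      (use ih1 ih2 in \<open>cases "v \<in> set c"; simp add: b_upd_def\<close>)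
  moreover have "cost f_upd ?T1 + cost f_upd ?T2 + cost f_mem [enc_nat v, nl c] + 60 + T_upd M \<le>
      2 * T_upd M * 2 ^ length (c # cls)"
    if "v < M \<and> small_classes M (c # cls) \<and> (\<forall>R w. g R = Some w \<longrightarrow> length w < M)"
  proof -
    have "cost f_upd ?T1 + T_upd M \<le> 2 * T_upd M * 2 ^ length cls" using ih1 that by auto
    moreover have "cost f_upd ?T2 + T_upd M \<le> 2 * T_upd M * 2 ^ length cls" 
      by (rule ih2[THEN conjunct2, THEN conjunct2, rule_format]) (use that in auto)
    moreover have "cost f_mem [enc_nat v, nl c] + 60 \<le> T_upd M"
      using mem_cost_le[of v M c] that by (simp add: T_upd_def)
    ultimately show ?thesis by simp
  qed
  ultimately show ?case by (meson add_le_mono1 le_trans)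
qed

lemma length_min_hit: "min_hit vs R = Some w \<Longrightarrow> length w \<le> length vs"
proof (induction vs arbitrary: R w)
  case Nil
  then show ?case by (auto split: if_splits)
next
  case (Cons v vs)
  let ?R = "filter (\<lambda>c. v \<notin> set c) R"
  from Cons.prems have "min_hit vs R = Some w \<or> (\<exists>w'. w = v # w' \<and> min_hit vs ?R = Some w')"
    by (cases "min_hit vs R"; cases "min_hit vs ?R") (auto split: if_splits)
  then show ?case using Cons.IH by fastforce
qed

abbreviation "mh_tab vs cls \<equiv> tabf (\<lambda>R. enc_opt nl (min_hit vs R)) cls"

text \<open>Each vertex costs a single pass over a table with \<open>2 ^ length cls\<close> entries,
  in place of the two recursive calls of \<open>min_hit\<close>.\<close>

lemma tab_spec: "runs_to f_tab [nl vs, enc_cls cls]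
      (mh_tab vs cls) ((\<forall>v \<in> set vs. v < M) \<and> length vs < M \<and> small_classes M cls)
      (Suc (length vs) * (2 * T_upd M * 2 ^ length cls))"
proof (induction vs)
  case Nil
  have eq: "(\<lambda>R. enc_opt nl (min_hit [] R)) = (\<lambda>R. if R = [] then Node Leaf Leaf else Leaf)"
    by (rule ext) simp
  have t: "runs_to f_tab [nl [], enc_cls cls]
      (mh_tab [] cls) True
      (cost f_base [Node Leaf Leaf, enc_cls cls] + 20)"
    unfolding eq by (rule runs_toI, (rule code)+) (simp add: b_tab_def)
  moreover note t[THEN costD]
  moreover have "60 * 2 ^ length cls \<le> 2 * T_upd M * 2 ^ length cls"
    by (intro mult_le_mono1) (simp add: T_upd_def)
  ultimately have "cost f_tab [nl [], enc_cls cls] \<le> 1 * (2 * T_upd M * 2 ^ length cls)"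
    using base_cost[of "Node Leaf Leaf" cls] by linarith
  then show ?case using t by (simp only: list.size One_nat_def simp_thms)
next
  case (Cons v vs)
  let ?t = "[enc_nat v, enc_cls cls, mh_tab vs cls]"
  let ?u = "[enc_nat v, enc_cls cls, mh_tab vs cls, mh_tab vs cls]"
  have t1: "runs_to f_tab1 ?t (mh_tab (v # vs) cls) True (cost f_upd ?u + 20)"
    by (rule runs_toI, (rule code)+)
      (use upd_spec[of v cls "min_hit vs" "min_hit vs"] in \<open>simp add: b_tab1_def\<close>)
  have t: "runs_to f_tab [nl (v # vs), enc_cls cls]
      (mh_tab (v # vs) cls) True
      (cost f_tab [nl vs, enc_cls cls] + cost f_tab1 ?t + 30)"
    by (rule runs_toI, (rule code)+) (use Cons t1 in \<open>simp add: b_tab_def\<close>)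
  have "cost f_tab [nl (v # vs), enc_cls cls] \<le> Suc (length (v # vs)) * (2 * T_upd M * 2 ^ length cls)"
    if A: "(\<forall>x \<in> set (v # vs). x < M) \<and> length (v # vs) < M \<and> small_classes M cls"
  proof -
    have "cost f_upd ?u + T_upd M \<le> 2 * T_upd M * 2 ^ length cls"
      using upd_spec[of v cls "min_hit vs" "min_hit vs" M] A le_less_trans[OF length_min_hit[of vs]] by auto
    moreover have "cost f_tab [nl vs, enc_cls cls] \<le> Suc (length vs) * (2 * T_upd M * 2 ^ length cls)"
      using Cons A by auto
    moreover have "50 \<le> T_upd M" by (simp add: T_upd_def)
    moreover have "Suc (length (v # vs)) * (2 * T_upd M * 2 ^ length cls) =
       2 * T_upd M * 2 ^ length cls + Suc (length vs) * (2 * T_upd M * 2 ^ length cls)" by simp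
    ultimately show ?thesis using t[THEN costD] t1[THEN costD] by linarith
  qed
  then show ?case using t by blast
qed

lemmas tab_run [simp] = tab_spec[THEN runs_toD(1)] tab_spec[THEN runs_toD(2)]
lemmas tab_cost = tab_spec[THEN runs_toD(3)]

text \<open>Right subtrees include the current class, so the rightmost entry belongs to the full
  list.\<close>

lemma top_spec: "runs_to f_top [enc_cls cls, tabf g cls] (g cls) True (20 * Suc (length cls))"
proof (induction cls arbitrary: g)
  case Nil
  show ?case by (rule runs_toI, (rule code)+) (simp add: b_top_def)
next
  case (Cons c cls)
  show ?case by (rule runs_toI, (rule code)+) (use Cons[of "\<lambda>R. g (c # R)"] in \<open>simp add: b_top_def\<close>)
qed

definition T_minhit :: "nat \<Rightarrow> nat" where "T_minhit M = 2 * M * T_upd M + 20 * M + 40"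

lemma minhit_spec: "runs_to f_minhit [nl vs, enc_cls cls]
      (enc_opt nl (min_hit vs cls)) ((\<forall>v \<in> set vs. v < M) \<and> length vs < M \<and> small_classes M cls \<and>
          length cls < M)
      (2 ^ length cls * T_minhit M)"
proof -
  have s: "runs_to f_minhit [nl vs, enc_cls cls]
      (enc_opt nl (min_hit vs cls)) True
      (cost f_tab [nl vs, enc_cls cls] + 20 * Suc (length cls) + 20)"
    by (rule runs_toI, (rule code)+)
      (use top_spec[of cls "\<lambda>R. enc_opt nl (min_hit vs R)"] in \<open>simp add: b_minhit_def\<close>)
  have "cost f_minhit [nl vs, enc_cls cls] \<le> 2 ^ length cls * T_minhit M"
    if A: "(\<forall>v \<in> set vs. v < M) \<and> length vs < M \<and> small_classes M cls \<and> length cls < M"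
  proof -
    have "cost f_tab [nl vs, enc_cls cls] \<le> Suc (length vs) * (2 * T_upd M * 2 ^ length cls)"
      using tab_cost[of vs M cls] A by blast
    also have "\<dots> \<le> M * (2 * T_upd M * 2 ^ length cls)" using A by (intro mult_le_mono1) simp
    finally have "cost f_tab [nl vs, enc_cls cls] \<le> 2 ^ length cls * (2 * M * T_upd M)"
        by (simp add: ac_simps)
    moreover have "1 * (20 * M + 40) \<le> 2 ^ length cls * (20 * M + 40)" by (intro mult_le_mono1) simp
    moreover have "2 ^ length cls * T_minhit M = 2 ^ length cls * (2 * M * T_upd M) +
        2 ^ length cls * (20 * M + 40)"
      by (simp add: T_minhit_def algebra_simps)
    moreover have "20 * Suc (length cls) + 20 \<le> 20 * M + 40" using A by simp
    moreover have "x \<le> z" if "x \<le> t + l + 20" "t \<le> a" "1 * m \<le> b" "z = a + b" "l + 20 \<le> m"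
      for x t l a b m z :: nat using that by linarith
    ultimately show ?thesis using s by blast
  qed
  then show ?thesis using s by blast
qed

lemmas minhit_run [simp] = minhit_spec[THEN runs_toD(1)] minhit_spec[THEN runs_toD(2)]
lemmas minhit_cost = minhit_spec[THEN runs_toD(3)]

definition T_fin :: "nat \<Rightarrow> nat" where
  "T_fin M = M * (T_disj M + 40) + T_minhit M + M * (T_mem M + 40) + 60 * M + 300"

abbreviation "enc_fam \<equiv> enc_pr nl enc_cls"

lemma finish_spec: "runs_to f_finish [enc_nat n, enc_nat k, nl X, enc_fam f]
      (enc_opt nl (finish n k X f)) ((\<forall>x \<in> set X \<union> set (fst f). x < M) \<and> length X + length (fst f) +
          n < M \<and> small_classes M (snd f) \<and> length (snd f) < M)
      (2 ^ length (snd f) * T_fin M)"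
proof -
  obtain D cls where f: "f = (D, cls)" by (cases f)
  let ?cls = "filter (\<lambda>c. set c \<inter> set D = {}) cls"
  let ?w = "min_hit (down n) ?cls"
  let ?A = "(\<forall>x \<in> set X \<union> set D. x < M) \<and> length X + length D + n < M \<and> small_classes M cls \<and> length cls < M"
  let ?a1 = "[enc_nat k, nl X, nl D, enc_opt nl ?w]"
  have f1: "runs_to f_finish1 ?a1 (enc_opt nl (finish n k X f)) ?A (M * (T_mem M + 40) + 50 * M + 150)"
  proof (cases ?w)
    case None
    show ?thesis by (rule runs_toI, (rule code)+) (simp add: b_finish1_def finish_def f None)
  next
    case (Some w)
    let ?R = "remdups (X @ D @ w)"
    have f2: "runs_to f_finish2 [enc_nat k, nl ?R] (enc_opt nl (finish n k X f)) True (12 * Suc (length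
        ?R) + 20)"
      by (rule runs_toI, (rule code)+)
        (use leq_cost[of "nl ?R" "enc_nat k"] in \<open>auto simp: b_finish2_def finish_def f Some Let_def\<close>)
    have a1: "runs_to f_finish1 ?a1
      (enc_opt nl (finish n k X f)) True
      (cost f_app [nl D, nl w] + cost f_app [nl X, nl (D @ w)] + cost f_rdup [nl (X @ D @ w)] +
          cost f_finish2 [enc_nat k, nl ?R] + 40)"
      by (rule runs_toI, (rule code)+) (use f2 in \<open>simp add: b_finish1_def Some\<close>)
    have "cost f_finish1 ?a1 \<le> M * (T_mem M + 40) + 50 * M + 150" if A: ?A
    proof -
      have wl: "length w \<le> n" "set w \<subseteq> {..<n}"
        using length_min_hit[OF Some] min_hit_sound[OF Some] by auto
      then have el: "\<forall>x \<in> set (X @ D @ w). x < M" "length (X @ D @ w) < M"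
        using A by auto
      have "cost f_rdup [nl (X @ D @ w)] \<le> Suc (length (X @ D @ w)) * (T_mem M + 40)"
        using rdup_cost[OF el] .
      also have "\<dots> \<le> M * (T_mem M + 40)" using el(2) by (intro mult_le_mono1) simp
      finally have c1: "cost f_rdup [nl (X @ D @ w)] \<le> M * (T_mem M + 40)" .
      have c2: "cost f_app [nl D, nl w] \<le> 10 * M" "cost f_app [nl X, nl (D @ w)] \<le> 10 * M"
        using app_cost[of enc_nat D w] app_cost[of enc_nat X "D @ w"] A by auto
      have "length ?R < M" using length_remdups_leq[of "X @ D @ w"] el(2) by linarith
      then have c3: "cost f_finish2 [enc_nat k, nl ?R] \<le> 12 * M + 20" using f2 by simp
      show ?thesis using c1 c2 c3 a1[THEN costD] by linarith
    qed
    then show ?thesis using a1 by blast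
  qed
  let ?a = "[enc_nat n, enc_nat k, nl X, enc_fam f]"
  have fi: "runs_to f_finish ?a
      (enc_opt nl (finish n k X f)) True
      (cost f_down [enc_nat n] + cost f_filt [nl D, enc_cls cls] + cost f_minhit [nl (down n), enc_cls
          ?cls] + cost f_finish1 ?a1 + 40)"
    by (rule runs_toI, (rule code)+) (use f1 in \<open>simp add: b_finish_def f\<close>)
  have "cost f_finish ?a \<le> 2 ^ length cls * T_fin M" if A: ?A
  proof -
    have "cost f_filt [nl D, enc_cls cls] \<le> Suc (length cls) * (T_disj M + 40)"
      using filt_cost[of M cls D] A by simp
    also have "\<dots> \<le> M * (T_disj M + 40)" using A by (intro mult_le_mono1) simp
    finally have c1: "cost f_filt [nl D, enc_cls cls] \<le> M * (T_disj M + 40)" .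
    have c2: "cost f_down [enc_nat n] \<le> 10 * M" using down_cost[of n] A by simp
    have lf: "length ?cls \<le> length cls" by simp
    have "small_classes M ?cls" using A by (auto simp: small_classes_def)
    then have "cost f_minhit [nl (down n), enc_cls ?cls] \<le> 2 ^ length ?cls * T_minhit M"
      using minhit_cost[of "down n" M ?cls] A lf by (auto simp: le_less_trans)
    also have "\<dots> \<le> 2 ^ length cls * T_minhit M" using lf by (intro mult_le_mono1 power_increasing) auto
    finally have c3: "cost f_minhit [nl (down n), enc_cls ?cls] \<le> 2 ^ length cls * T_minhit M" .
    have c4: "cost f_finish1 ?a1 \<le> M * (T_mem M + 40) + 50 * M + 150" using f1 A by blast
    have c5: "1 * (M * (T_disj M + 40) + M * (T_mem M + 40) + 60 * M + 300) \<le>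
        2 ^ length cls * (M * (T_disj M + 40) + M * (T_mem M + 40) + 60 * M + 300)"
      by (intro mult_le_mono1) simp
    have "x \<le> mm + z" if "x \<le> d + fl + m + f1 + 40" "fl \<le> a" "d \<le> 10 * M" "m \<le> mm"
      "f1 \<le> b + 50 * M + 150" "1 * (a + b + 60 * M + 300) \<le> z" for x mm z d fl m f1 a b :: nat
      using that by simp
    from this[OF fi[THEN costD] c1 c2 c3 c4 c5]
    show ?thesis unfolding T_fin_def by (simp add: algebra_simps)
  qed
  then show ?thesis using fi unfolding f fst_conv snd_conv by blast
qed

lemmas finish_run [simp] = finish_spec[THEN runs_toD(1)] finish_spec[THEN runs_toD(2)]
lemmas finish_cost = finish_spec[THEN runs_toD(3)]

section \<open>Cost of the search and of the guesses\<close>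

definition fam_ok :: "nat \<Rightarrow> nat \<Rightarrow> nat list \<Rightarrow> family \<Rightarrow> bool" where
  "fam_ok M n X f \<longleftrightarrow> (\<forall>x \<in> set X \<union> set (fst f). x < M) \<and> length X + length (fst f) + n < M \<and>
     small_classes M (snd f) \<and> length (snd f) < M"

lemma search_spec: "runs_to f_search [enc_nat n, enc_nat k, nl X, enc_fams fs]
      (enc_opt nl (search n k X fs)) (\<forall>f \<in> set fs. fam_ok M n X f)
      (weight fs * (T_fin M + 60) + 20)"
proof (induction fs)
  case Nil
  show ?case by (rule runs_toI, (rule code)+) (simp add: b_search_def)
next
  case (Cons f fs)
  let ?a = "[enc_nat n, enc_nat k, nl X, enc_fams fs]"
  let ?a1 = "[enc_opt nl (finish n k X f), enc_nat n, enc_nat k, nl X, enc_fams fs]"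
  have s1: "runs_to f_search1 ?a1 (enc_opt nl (search n k X (f # fs))) True (cost f_search ?a + 20)"
    by (rule runs_toI, (rule code)+) (use Cons in \<open>cases "finish n k X f"; simp add: b_search1_def\<close>)
  have s: "runs_to f_search [enc_nat n, enc_nat k, nl X, enc_fams (f # fs)]
      (enc_opt nl (search n k X (f # fs))) True
      (cost f_finish [enc_nat n, enc_nat k, nl X, enc_fam f] + cost f_search1 ?a1 + 40)"
    by (rule runs_toI, (rule code)+) (use s1 in \<open>simp add: b_search_def\<close>)
  have "cost f_search [enc_nat n, enc_nat k, nl X, enc_fams (f # fs)] \<le> weight (f # fs) * (T_fin M + 60) + 20"
    if A: "\<forall>g \<in> set (f # fs). fam_ok M n X g"
  proof -
    let ?W = "2 ^ length (snd f) :: nat"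
    have c1: "cost f_finish [enc_nat n, enc_nat k, nl X, enc_fam f] \<le> ?W * T_fin M"
      using finish_cost[of X f M n k] A unfolding fam_ok_def by simp
    have c2: "cost f_search ?a \<le> weight fs * (T_fin M + 60) + 20" using Cons A by simp
    have w: "weight (f # fs) = ?W + weight fs" by (cases f) simp
    have w60: "60 \<le> ?W * 60" by simp
    show ?thesis using c1 c2 w60 s[THEN costD] s1[THEN costD]
      unfolding w distrib_right distrib_left by linarith
  qed
  then show ?case using s by blast
qed

lemmas search_run [simp] = search_spec[THEN runs_toD(1)] search_spec[THEN runs_toD(2)]
lemmas search_cost = search_spec[THEN runs_toD(3)]

abbreviation guess_args where
  "guess_args n \<alpha> k0 es vs W k X Y \<equiv> [enc_nat n, enc_nat \<alpha>, enc_nat k0, enc_es es, nl vs, nl W, enc_nat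
      k, nl X, nl Y]"

lemma guess_Nil_spec:
  fixes n \<alpha> k0 es vs k X Y
  defines "fs \<equiv> all_colours X Y es vs k \<alpha> [([], [])]"
  shows "runs_to f_guess (guess_args n \<alpha> k0 es vs [] k X Y)
      (enc_opt nl (guess n \<alpha> k0 es vs [] k X Y)) True
      (cost f_all (all_args X Y es vs k \<alpha> [([], [])]) + cost f_search [enc_nat n, enc_nat k0, nl X,
          enc_fams fs] + 60)"
  by (rule runs_toI, (rule code)+)
    (use all_run[of X Y es vs k \<alpha> "[([], [])]"] in \<open>simp add: b_guess_def leaf_def fs_def\<close>)

lemma guess_Cons_spec:
  assumes "k \<noteq> 0 \<Longrightarrow> halts f_guess (guess_args n \<alpha> k0 es vs W (k - 1) (w # X) Y) \<and>
      res f_guess (guess_args n \<alpha> k0 es vs W (k - 1) (w # X) Y) =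
        enc_opt nl (guess n \<alpha> k0 es vs W (k - 1) (w # X) Y)"
    and "halts f_guess (guess_args n \<alpha> k0 es vs W k X (w # Y)) \<and>
      res f_guess (guess_args n \<alpha> k0 es vs W k X (w # Y)) = enc_opt nl (guess n \<alpha> k0 es vs W k X (w # Y))"
  shows "runs_to f_guess (guess_args n \<alpha> k0 es vs (w # W) k X Y)
      (enc_opt nl (guess n \<alpha> k0 es vs (w # W) k X Y)) True
      ((if k = 0 then 0 else cost f_guess (guess_args n \<alpha> k0 es vs W (k - 1) (w # X) Y)) +
          cost f_guess (guess_args n \<alpha> k0 es vs W k X (w # Y)) + 100)"
proof -
  let ?r = "if k = 0 then None else guess n \<alpha> k0 es vs W (k - 1) (w # X) Y"
  let ?a1 = "enc_opt nl ?r # guess_args n \<alpha> k0 es vs (w # W) k X Y"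
  have g1: "runs_to f_guess1 ?a1
      (enc_opt nl (guess n \<alpha> k0 es vs (w # W) k X Y)) True
      (cost f_guess (guess_args n \<alpha> k0 es vs W k X (w # Y)) + 40)"
    by (rule runs_toI, (rule code)+) (use assms(2) in \<open>cases ?r; simp add: b_guess1_def\<close>)
  show ?thesis
    by (rule runs_toI, (rule code)+) (use assms(1) g1 in \<open>cases "k = 0"; simp add: b_guess_def\<close>)
qed

lemma guess_run: "halts f_guess (guess_args n \<alpha> k0 es vs W k X Y) \<and>
    res f_guess (guess_args n \<alpha> k0 es vs W k X Y) = enc_opt nl (guess n \<alpha> k0 es vs W k X Y)"
proof (induction W arbitrary: k X Y)
  case Nil
  then show ?case using guess_Nil_spec by blast
next
  case (Cons w W)
  then show ?case using guess_Cons_spec[of k n \<alpha> k0 es vs W w X Y] by blast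
qed

lemma guess_run_simps [simp]:
  "halts f_guess (guess_args n \<alpha> k0 es vs W k X Y)"
  "res f_guess (guess_args n \<alpha> k0 es vs W k X Y) = enc_opt nl (guess n \<alpha> k0 es vs W k X Y)"
  using guess_run by blast+

definition T_leaf :: "nat \<Rightarrow> nat" where "T_leaf M = 2 * M * T_all M + T_fin M + 200"

context bounded_compression
begin

text \<open>At a leaf exactly \<open>k + 1\<close> vertices are kept: \<open>W\<close> exceeds the
  budget by one, and each guessed deletion lowers both numbers by one. So the potential is
  \<open>p = k\<close>, and every colour contributes \<open>10^k 2^k = 20^k\<close>.\<close>

lemma leaf_cost:
  assumes Y: "length Y = Suc k" and X: "set X \<subseteq> {..<n}" and M: "length X + \<alpha> * k + n < M" "\<alpha> < M"
  shows "cost f_guess (guess_args n \<alpha> k0 es vs [] k X Y) \<le> T_leaf M * (20 ^ \<alpha>) ^ k"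
proof -
  let ?fs = "all_colours X Y es vs k \<alpha> [([], [])]" and ?Z = "(20 ^ \<alpha>) ^ k :: nat"
  have P: "(10 ^ k * 2 ^ k) ^ \<alpha> = ?Z"
    by (simp add: power_mult_distrib[symmetric] power_mult[symmetric] mult.commute)
  have "fam_ok M n X f" if "f \<in> set ?fs" for f
  proof -
    obtain D cls where f: "f = (D, cls)" by (cases f)
    have b: "set D \<subseteq> {..<n} \<and> (\<forall>C \<in> set cls. length C \<le> length vs \<and> set C \<subseteq> {..<n}) \<and>
        length D \<le> 0 + \<alpha> * k \<and> length cls \<le> 0 + \<alpha> * k"
      by (rule all_colours_bounds[OF that[unfolded f]]) auto
    have "small_classes M cls" unfolding small_classes_def
    proof
      fix C assume "C \<in> set cls"
      then have "length C \<le> length vs" "set C \<subseteq> {..<n}" using b by auto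
      then show "length C < M \<and> (\<forall>x \<in> set C. x < M)" using vs_M nM by auto
    qed
    then show ?thesis using b X M nM unfolding fam_ok_def f by auto
  qed
  then have "cost f_search [enc_nat n, enc_nat k0, nl X, enc_fams ?fs] \<le> weight ?fs * (T_fin M + 60) + 20"
    using search_cost by blast
  also have "weight ?fs \<le> ?Z"
    using weight_all_colours[of k k \<alpha> "[([], [])]"] Y P by simp
  then have "weight ?fs * (T_fin M + 60) + 20 \<le> ?Z * (T_fin M + 60) + 20" by simp
  finally have c1: "cost f_search [enc_nat n, enc_nat k0, nl X, enc_fams ?fs] \<le> ?Z * (T_fin M + 60) + 20" .
  have "cost f_all (all_args X Y es vs k \<alpha> [([], [])]) \<le> Suc \<alpha> * (T_all M * (2 * ?Z))"
    using all_cost[of k k \<alpha> "[([], [])]"] Y unfolding P by (simp add: mult_2)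
  also have "\<dots> \<le> M * (T_all M * (2 * ?Z))" using M(2) by (intro mult_le_mono1) simp
  finally have c2: "cost f_all (all_args X Y es vs k \<alpha> [([], [])]) \<le> ?Z * (2 * M * T_all M)"
      by (simp add: ac_simps)
  have "80 \<le> ?Z * 80" by simp
  then have z: "80 \<le> ?Z * 140" by linarith
  have t: "T_leaf M * ?Z = ?Z * (2 * M * T_all M) + (?Z * (T_fin M + 60)) + ?Z * 140"
    by (simp add: T_leaf_def algebra_simps)
  have "x \<le> p + q + r" if "x \<le> a + s + 60" "a \<le> p" "s \<le> q + 20" "80 \<le> r" for x a s p q r :: nat
    using that by linarith
  from this[OF guess_Nil_spec[THEN costD] c2 c1 z] show ?thesis unfolding t .
qed

end

text \<open>
  The branches of \<open>guess\<close> sum to \<open>Z\<^sup>k (1 + 1 / Z)\<^sup>m\<close> for \<open>Z = 20\<^sup>\<alpha>\<close> and \<open>m\<close> undecided vertices; both sides are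
  multiplied by \<open>Z\<^sup>m\<close> to stay in the natural numbers.
\<close>

lemma guess_cost:
  assumes "solution es (set W \<union> set X \<union> set Y)" "set vs = {..<n} - (set W \<union> set X \<union> set Y)"
    and "set W \<union> set X \<union> set Y \<subseteq> {..<n}" "length W + length X + length Y \<le> Suc n"
    and "length W + length Y = Suc k"
    and es: "\<forall>(i, u, v) \<in> set es. i < \<alpha> \<and> u < n \<and> v < n" "length es < M" "length vs \<le> n"
    and M: "\<alpha> < M" "2 * n + 1 + \<alpha> * n < M"
  shows "cost f_guess (guess_args n \<alpha> k0 es vs W k X Y) * (20 ^ \<alpha>) ^ length W \<le>
    Suc (length W) * (T_leaf M * (20 ^ \<alpha>) ^ k * (20 ^ \<alpha> + 1) ^ length W)"
  using assms(1-5)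
proof (induction W arbitrary: k X Y)
  case Nil
  then have "k \<le> n" by simp
  then have "\<alpha> * k \<le> \<alpha> * n" by simp
  interpret bounded_compression n es X Y vs M
    using Nil es M by unfold_locales (auto intro: less_trans)
  have "cost f_guess (guess_args n \<alpha> k0 es vs [] k X Y) \<le> T_leaf M * (20 ^ \<alpha>) ^ k"
  proof (rule leaf_cost)
    show "length X + \<alpha> * k + n < M" 
    proof -
      have "length X + k \<le> n" using Nil(4,5) by simp
      then show ?thesis using M(2) \<open>\<alpha> * k \<le> \<alpha> * n\<close> by linarith
    qed
  qed (use Nil M in auto)
  then show ?case by simp
next
  case (Cons w W)
  let ?Z = "20 ^ \<alpha> :: nat" and ?m = "length W"
  let ?q = "T_leaf M * ?Z ^ k * (?Z + 1) ^ ?m"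
  let ?c1 = "if k = 0 then 0 else cost f_guess (guess_args n \<alpha> k0 es vs W (k - 1) (w # X) Y)"
  let ?c2 = "cost f_guess (guess_args n \<alpha> k0 es vs W k X (w # Y))"
  have s: "set (w # W) \<union> set X \<union> set Y = set W \<union> set (w # X) \<union> set Y"
    "set (w # W) \<union> set X \<union> set Y = set W \<union> set X \<union> set (w # Y)" by auto
  have c1: "?c1 * ?Z ^ Suc ?m \<le> Suc ?m * ?q"
  proof (cases "k = 0")
    case False
    then obtain k' where k: "k = Suc k'" by (cases k) auto
    have "cost f_guess (guess_args n \<alpha> k0 es vs W k' (w # X) Y) * ?Z ^ ?m \<le>
        Suc ?m * (T_leaf M * ?Z ^ k' * (?Z + 1) ^ ?m)"
      by (rule Cons.IH) (use Cons.prems k s(1) in auto)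
    \<comment> \<open>The spare factor raises the power at the smaller budget \<open>k'\<close> to
      the power at \<open>k\<close>, the gain from deleting \<open>w\<close>.\<close>
    then have "?Z * (cost f_guess (guess_args n \<alpha> k0 es vs W k' (w # X) Y) * ?Z ^ ?m) \<le>
        ?Z * (Suc ?m * (T_leaf M * ?Z ^ k' * (?Z + 1) ^ ?m))" by (rule mult_le_mono2)
    then show ?thesis using k by (simp only: power_Suc diff_Suc_1 nat.distinct if_False ac_simps)
  qed simp
  have "?c2 * ?Z ^ ?m \<le> Suc ?m * ?q"
    by (rule Cons.IH) (use Cons.prems s(2) in auto)
  then have "?Z * (?c2 * ?Z ^ ?m) \<le> ?Z * (Suc ?m * ?q)" by (rule mult_le_mono2)
  then have c2: "?c2 * ?Z ^ Suc ?m \<le> ?Z * (Suc ?m * ?q)" by (simp only: power_Suc ac_simps)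
  have "100 * 1 * ?Z ^ Suc ?m \<le> T_leaf M * ?Z ^ k * (?Z + 1) ^ Suc ?m"
    by (intro mult_le_mono power_mono) (auto simp: T_leaf_def)
  then have c3: "100 * ?Z ^ Suc ?m \<le> (?Z + 1) * ?q" by (simp only: power_Suc ac_simps mult_1)
  have "cost f_guess (guess_args n \<alpha> k0 es vs (w # W) k X Y) \<le> ?c1 + ?c2 + 100"
    using guess_Cons_spec[OF guess_run guess_run] by blast
  then have "cost f_guess (guess_args n \<alpha> k0 es vs (w # W) k X Y) * ?Z ^ Suc ?m \<le>
      (?c1 + ?c2 + 100) * ?Z ^ Suc ?m" by (rule mult_le_mono1)
  also have "\<dots> = ?c1 * ?Z ^ Suc ?m + ?c2 * ?Z ^ Suc ?m + 100 * ?Z ^ Suc ?m" by (simp only: distrib_right)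
  also have "\<dots> \<le> Suc ?m * ?q + ?Z * (Suc ?m * ?q) + (?Z + 1) * ?q" using c1 c2 c3 by (intro add_mono)
  also have "\<dots> = Suc (length (w # W)) * (T_leaf M * ?Z ^ k * (?Z + 1) ^ length (w # W))"
    by (simp add: algebra_simps)
  finally show ?case by simp
qed

lemma guess_cost_total:
  assumes "solution es (set W)" "set vs = {..<n} - set W" "set W \<subseteq> {..<n}"
    and "length W = Suc k" "k \<le> n"
    and "\<forall>(i, u, v) \<in> set es. i < \<alpha> \<and> u < n \<and> v < n" "length es < M" "length vs \<le> n"
    and "\<alpha> < M" "2 * n + 1 + \<alpha> * n < M"
  shows "cost f_guess (guess_args n \<alpha> k0 es vs W k [] []) \<le> 2 * (k + 2) * T_leaf M * (20 ^ \<alpha> + 1) ^ k"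
proof -
  let ?Z = "20 ^ \<alpha> :: nat" and ?c = "cost f_guess (guess_args n \<alpha> k0 es vs W k [] [])"
  have "?c * ?Z ^ length W \<le> Suc (length W) * (T_leaf M * ?Z ^ k * (?Z + 1) ^ length W)"
    by (rule guess_cost) (use assms in auto)
  also have "\<dots> = (k + 2) * T_leaf M * ?Z ^ k * (?Z + 1) ^ k * (?Z + 1)"
    unfolding assms(4) by (simp add: algebra_simps)
  \<comment> \<open>Since \<open>W\<close> has \<open>k + 1\<close> elements, one factor
    \<open>Z + 1\<close> is in excess. Bounding it by \<open>2 * Z\<close> gives the power of
    \<open>Z\<close> that cancels against the left side.\<close>
  also have "\<dots> \<le> (k + 2) * T_leaf M * ?Z ^ k * (?Z + 1) ^ k * (2 * ?Z)"
    by (intro mult_le_mono2) simp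
  also have "\<dots> = (2 * (k + 2) * T_leaf M * (?Z + 1) ^ k) * ?Z ^ length W"
    unfolding assms(4) by (simp only: power_Suc ac_simps)
  finally show ?thesis by simp
qed

section \<open>Cost of the iteration over the edges\<close>

abbreviation solve_args where
  "solve_args n \<alpha> k es \<equiv> [enc_nat n, enc_nat \<alpha>, enc_nat k, enc_es es]"

lemma solve_Nil_spec: "runs_to f_solve (solve_args n \<alpha> k []) (enc_opt nl (solve n \<alpha> k [])) True 20"
  by (rule runs_toI, (rule code)+) (simp add: b_solve_def)

definition T_solve :: "nat \<Rightarrow> nat" where
  "T_solve M = T_mem M + M * (T_mem M + 40) + 60 * M + 2 * M * T_leaf M + 400"

lemma solve_Cons_spec:
  fixes n \<alpha> k i u v es
  defines "es' \<equiv> (i, u, v) # es"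
  assumes ih: "halts f_solve (solve_args n \<alpha> k es) \<and>
    res f_solve (solve_args n \<alpha> k es) = enc_opt nl (solve n \<alpha> k es)"
  shows "runs_to f_solve (solve_args n \<alpha> k es')
      (enc_opt nl (solve n \<alpha> k es')) ((\<forall>(i, u, v) \<in> set es'. i < \<alpha> \<and> u < n \<and> v < n) \<and> length es' < M \<and>
          \<alpha> < M \<and> 2 * n + 1 + \<alpha> * n < M)
      (cost f_solve (solve_args n \<alpha> k es) + T_solve M * (20 ^ \<alpha> + 1) ^ k)"
proof -
  let ?A = "(\<forall>(i, u, v) \<in> set es'. i < \<alpha> \<and> u < n \<and> v < n) \<and> length es' < M \<and> \<alpha> < M \<and> 2 * n + 1 + \<alpha> * n < M"
  let ?o = "solve n \<alpha> k es" and ?B = "T_solve M * (20 ^ \<alpha> + 1) ^ k"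
  let ?a1 = "[enc_nat n, enc_nat \<alpha>, enc_nat k, enc_es es', enc_opt nl ?o]"
  have one: "1 \<le> (20 ^ \<alpha> + 1 :: nat) ^ k" by simp
  have s1: "halts f_solve1 ?a1 \<and> res f_solve1 ?a1 = enc_opt nl (solve n \<alpha> k es') \<and>
    (?A \<longrightarrow> cost f_solve1 ?a1 + 60 \<le> ?B)"
  proof (cases ?o)
    case None
    have "runs_to f_solve1 ?a1 (enc_opt nl (solve n \<alpha> k es')) True 40"
      by (rule runs_toI, (rule code)+) (simp add: b_solve1_def None es'_def)
    moreover have "100 * 1 \<le> ?B" using one by (intro mult_le_mono) (auto simp: T_solve_def)
    ultimately show ?thesis by auto
  next
    case (Some S)
    let ?vs = "filter (\<lambda>x. x \<notin> set (u # S)) (down n)"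
    let ?a2 = "[enc_nat n, enc_nat \<alpha>, enc_nat k, enc_es es', nl S, enc_nat u]"
    let ?g = "guess_args n \<alpha> k es' ?vs (u # S) k [] []"
    have s2: "runs_to f_solve2 ?a2
      (enc_opt nl (solve n \<alpha> k es')) True
      (cost f_mem [enc_nat u, nl S] + cost f_leq [Node Leaf (nl S), enc_nat k] + cost f_down [enc_nat n]
          + cost f_diff [nl (down n), nl (u # S)] + (if u \<in> set S \<or> length S < k then 0 else cost
            f_guess ?g) + 100)"
      by (rule runs_toI, (rule code)+)
        (use diff_spec[of "down n" "u # S"] guess_run[of n \<alpha> k es' ?vs "u # S" k "[]" "[]"]
          in \<open>auto simp: b_solve2_def Some es'_def Suc_le_eq\<close>)
    have t1: "runs_to f_solve1 ?a1 (enc_opt nl (solve n \<alpha> k es')) True (cost f_solve2 ?a2 + 40)"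
      by (rule runs_toI, (rule code)+) (use s2 in \<open>simp add: b_solve1_def Some es'_def\<close>)
    have "cost f_solve1 ?a1 + 60 \<le> ?B" if A: ?A
    proof -
      have es: "\<forall>(i, u, v) \<in> set es. i < \<alpha> \<and> u < n \<and> v < n" and u: "u < n" using A by (auto simp: es'_def)
      have S: "solution es (set S)" "set S \<subseteq> {..<n}" "length S \<le> k" "distinct S"
        using solve_correct[OF es, of k] Some by auto
      have lS: "length S \<le> n" using S(2,4) card_mono[of "{..<n}" "set S"] distinct_card[of S] by simp
      have c1: "cost f_mem [enc_nat u, nl S] \<le> T_mem M" using mem_cost_le[of u M S] lS u A by simp
      have c2: "cost f_leq [Node Leaf (nl S), enc_nat k] \<le> 12 * M + 12"
        using leq_cost[of "Node Leaf (nl S)" "enc_nat k"] lS A by simp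
      have c3: "cost f_down [enc_nat n] \<le> 10 * M" using down_cost[of n] A by simp
      have "cost f_diff [nl (down n), nl (u # S)] \<le> Suc (length (down n)) * (T_mem M + 40)"
        using diff_cost[of "down n" M "u # S"] lS A by simp
      also have "\<dots> \<le> M * (T_mem M + 40)" using A by (intro mult_le_mono1) simp
      finally have c4: "cost f_diff [nl (down n), nl (u # S)] \<le> M * (T_mem M + 40)" .
      have c5: "(if u \<in> set S \<or> length S < k then 0 else cost f_guess ?g) \<le>
          2 * M * T_leaf M * (20 ^ \<alpha> + 1) ^ k"
      proof (cases "u \<in> set S \<or> length S < k")
        case False
        have "length ?vs \<le> n" using length_filter_le[of _ "down n"] by simp
        then have "cost f_guess ?g \<le> 2 * (k + 2) * T_leaf M * (20 ^ \<alpha> + 1) ^ k"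
          using guess_cost_total[of es' "u # S" ?vs n k \<alpha> M k] solution_Cons[OF S(1), of i u v] False S lS u A
          by (auto simp: es'_def)
        \<comment> \<open>The parameter is not part of the input size, but guessing starts only from
          a solution with exactly \<open>k\<close> distinct vertices. Hence
          \<open>k \<le> n\<close>, and \<open>k + 2 \<le> M\<close>.\<close>
        also have "\<dots> \<le> 2 * M * T_leaf M * (20 ^ \<alpha> + 1) ^ k"
          using False S(3) lS A by (intro mult_le_mono1 mult_le_mono2) auto
        finally show ?thesis using False by simp
      qed simp
      have B: "?B = (20 ^ \<alpha> + 1) ^ k * (T_mem M + M * (T_mem M + 40) + 60 * M + 400) +
          2 * M * T_leaf M * (20 ^ \<alpha> + 1) ^ k"
        by (simp add: T_solve_def algebra_simps)
      have c6: "1 * (T_mem M + M * (T_mem M + 40) + 60 * M + 400) \<le>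
        (20 ^ \<alpha> + 1) ^ k * (T_mem M + M * (T_mem M + 40) + 60 * M + 400)" using one by (rule mult_le_mono1)
      have "x + 60 \<le> z + g'" if "x \<le> y + 40" "y \<le> me + le + dn + di + g + 100" "me \<le> a" "le \<le> 12 * M + 12"
        "dn \<le> 10 * M" "di \<le> b" "g \<le> g'" "1 * (a + b + 60 * M + 400) \<le> z"
        for x y me le dn di g g' a b z :: nat using that by simp
      from this[OF t1[THEN costD] s2[THEN costD] c1 c2 c3 c4 c5 c6] show ?thesis unfolding B .
    qed
    then show ?thesis using t1 by blast
  qed
  have st: "runs_to f_solve (solve_args n \<alpha> k es')
      (enc_opt nl (solve n \<alpha> k es')) True
      (cost f_solve (solve_args n \<alpha> k es) + cost f_solve1 ?a1 + 40)"
    by (rule runs_toI, (rule code)+) (use s1 ih in \<open>simp add: b_solve_def es'_def\<close>)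
  have "cost f_solve (solve_args n \<alpha> k es') \<le> cost f_solve (solve_args n \<alpha> k es) + ?B" if ?A
    using st[THEN costD] s1 that by auto
  then show ?thesis using st by blast
qed

lemma solve_run: "halts f_solve (solve_args n \<alpha> k es) \<and>
    res f_solve (solve_args n \<alpha> k es) = enc_opt nl (solve n \<alpha> k es)"
proof (induction es)
  case Nil
  then show ?case using solve_Nil_spec by blast
next
  case (Cons e es)
  obtain i u v where e: "e = (i, u, v)" by (cases e)
  show ?case unfolding e using solve_Cons_spec[OF Cons.IH, where i = i and u = u and v = v] by blast
qed

lemma solve_cost:
  assumes "\<forall>(i, u, v) \<in> set es. i < \<alpha> \<and> u < n \<and> v < n" "length es < M" "\<alpha> < M" "2 * n + 1 + \<alpha> * n < M"
  shows "cost f_solve (solve_args n \<alpha> k es) \<le> Suc (length es) * (T_solve M * (20 ^ \<alpha> + 1) ^ k)"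
  using assms
proof (induction es)
  case Nil
  have "20 * 1 \<le> T_solve M * (20 ^ \<alpha> + 1) ^ k" by (intro mult_le_mono) (auto simp: T_solve_def)
  then show ?case using solve_Nil_spec[THEN costD, of n \<alpha> k] by simp
next
  case (Cons e es)
  obtain i u v where e: "e = (i, u, v)" by (cases e)
  have "cost f_solve (solve_args n \<alpha> k es) \<le> Suc (length es) * (T_solve M * (20 ^ \<alpha> + 1) ^ k)"
    using Cons by auto
  moreover have "cost f_solve (solve_args n \<alpha> k (e # es)) \<le>
      cost f_solve (solve_args n \<alpha> k es) + T_solve M * (20 ^ \<alpha> + 1) ^ k"
    using solve_Cons_spec[OF solve_run, where i = i and u = u and v = v and M = M]
        Cons.prems unfolding e by blast
  ultimately show ?case by simp
qed

lemma main_spec: "runs_to f_main [enc_instance I]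
      (bool_tree (solve (num_verts I) (num_colours I) (param I) (edge_list I) \<noteq> None)) True
      (cost f_solve (solve_args (num_verts I) (num_colours I) (param I) (edge_list I)) + 60)"
  by (rule runs_toI, (rule code)+)
    (use solve_run[of "num_verts I" "num_colours I" "param I" "edge_list I"]
     in \<open>auto simp: b_main_def enc_instance_def enc_edge_eq\<close>)

lemma solve_iff_simfvs:
  assumes "I \<in> simfvs_instances"
  shows "solve (num_verts I) (num_colours I) (param I) (edge_list I) \<noteq> None \<longleftrightarrow> simfvs I"
    and "\<forall>(i, u, v) \<in> set (edge_list I). i < num_colours I \<and> u < num_verts I \<and> v < num_verts I"
proof -
  have wf: "wf_cgraph (num_colours I) (graph_of I)" using assms by (simp add: simfvs_instances_def)
  show ends: "\<forall>(i, u, v) \<in> set (edge_list I). i < num_colours I \<and> u < num_verts I \<and> v < num_verts I"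
    using edge_bounds[OF wf] by blast
  show "solve (num_verts I) (num_colours I) (param I) (edge_list I) \<noteq> None \<longleftrightarrow> simfvs I"
  proof (cases "solve (num_verts I) (num_colours I) (param I) (edge_list I)")
    case None
    then show ?thesis using solve_correct[OF ends, of "param I"]
      unfolding simfvs_def sim_fvs_iff_solution[OF wf] by auto
  next
    case (Some S)
    then have "solution (edge_list I) (set S) \<and> set S \<subseteq> {..<num_verts I} \<and> length S \<le> param I"
      using solve_correct[OF ends, of "param I"] by auto
    then have "simfvs I" unfolding simfvs_def sim_fvs_iff_solution[OF wf]
      using card_length[of S] by (auto intro!: exI[of _ "set S"])
    then show ?thesis using Some by simp
  qed
qed

section \<open>Polynomial bounds and the conclusion\<close>

definition polyb :: "(nat \<Rightarrow> nat) \<Rightarrow> bool" where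
  "polyb f \<longleftrightarrow> (\<exists>p. \<forall>n. f n = poly p n)"

lemma polyb_const: "polyb (\<lambda>n. c)"
  unfolding polyb_def by (rule exI[of _ "[:c:]"]) simp

lemma polyb_id: "polyb (\<lambda>n. n)"
  unfolding polyb_def by (rule exI[of _ "[:0, 1:]"]) simp

lemma polyb_add:
  assumes "polyb f" "polyb g"
  shows "polyb (\<lambda>n. f n + g n)"
proof -
  obtain p q where "\<forall>n. f n = poly p n" "\<forall>n. g n = poly q n" using assms unfolding polyb_def by blast
  then show ?thesis unfolding polyb_def by (intro exI[of _ "p + q"]) simp
qed

lemma polyb_mult:
  assumes "polyb f" "polyb g"
  shows "polyb (\<lambda>n. f n * g n)"
proof -
  obtain p q where "\<forall>n. f n = poly p n" "\<forall>n. g n = poly q n" using assms unfolding polyb_def by blast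
  then show ?thesis unfolding polyb_def by (intro exI[of _ "p * q"]) simp
qed

lemma polyb_T_solve:
  assumes "polyb g"
  shows "polyb (\<lambda>n. T_solve (g n))"
  unfolding T_solve_def T_leaf_def T_fin_def T_minhit_def T_upd_def T_disj_def T_all_def T_step_def T_exp_def
    T_node_def T_contr1_def T_order1_def T_nbrs_def T_mem_def T_eq_def
  by (intro polyb_add polyb_mult polyb_const assms)

theorem theorem1:
  shows "solvable_in_Ostar enc_instance instance_size simfvs_instances simfvs
    (\<lambda>I. 23 ^ (num_colours I * param I))"
proof -
  \<comment> \<open>Quadratic because of the summand \<open>\<alpha> n\<close>, which bounds the
    number of classes and forced vertices in a family.\<close>
  let ?M = "\<lambda>N. (N + 2) * (N + 2)"
  have "polyb (\<lambda>N. (N + 1) * T_solve (?M N) + 70)"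
    by (intro polyb_add polyb_mult polyb_const polyb_id polyb_T_solve)
  then obtain p where p: "\<And>N. (N + 1) * T_solve (?M N) + 70 = poly p N" unfolding polyb_def by blast
  have "decides_in_time prog enc_instance simfvs_instances simfvs
      (\<lambda>I. 23 ^ (num_colours I * param I) * poly p (instance_size I))"
    unfolding decides_in_time_def
  proof
    fix I assume I: "I \<in> simfvs_instances"
    let ?n = "num_verts I" and ?a = "num_colours I" and ?k = "param I" and ?es = "edge_list I"
    let ?N = "instance_size I" and ?c = "cost f_main [enc_instance I]"
    have a: "?a \<ge> 1" using I by (simp add: simfvs_instances_def)
    have "?a * ?n \<le> ?N * ?N" by (intro mult_le_mono) (auto simp: instance_size_def)
    then have M: "length ?es < ?M ?N" "?a < ?M ?N" "2 * ?n + 1 + ?a * ?n < ?M ?N"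
      by (auto simp: instance_size_def algebra_simps)
    \<comment> \<open>This is where \<open>\<alpha> \<ge> 1\<close> enters: the base case is
      \<open>21 \<le> 23\<close>, whereas at \<open>\<alpha> = 0\<close> the inequality
      fails.\<close>
    have "(20 ^ ?a + 1 :: nat) \<le> 23 ^ ?a"
      using a by (induction rule: dec_induct) auto
    then have "(20 ^ ?a + 1 :: nat) ^ ?k \<le> (23 ^ ?a) ^ ?k" by (rule power_mono) simp
    then have e: "(20 ^ ?a + 1 :: nat) ^ ?k \<le> 23 ^ (?a * ?k)" by (simp add: power_mult)
    have "cost f_solve (solve_args ?n ?a ?k ?es) \<le> Suc (length ?es) * (T_solve (?M ?N) * (20 ^ ?a + 1) ^ ?k)"
      by (rule solve_cost[OF solve_iff_simfvs(2)[OF I] M])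
    also have "\<dots> \<le> (?N + 1) * (T_solve (?M ?N) * 23 ^ (?a * ?k))"
      using e by (intro mult_le_mono) (auto simp: instance_size_def)
    finally have "?c \<le> (?N + 1) * (T_solve (?M ?N) * 23 ^ (?a * ?k)) + 60"
      using main_spec[of I, THEN costD] by linarith
    \<comment> \<open>The 70 covers the 60 steps of the main body and the two steps of the initial
      call and its argument.\<close>
    moreover have "(70 :: nat) \<le> 23 ^ (?a * ?k) * 70" by simp
    moreover have "23 ^ (?a * ?k) * poly p ?N =
        (?N + 1) * (T_solve (?M ?N) * 23 ^ (?a * ?k)) + 23 ^ (?a * ?k) * 70"
      unfolding p[symmetric] by (simp add: algebra_simps)
    ultimately have t: "Suc (1 + ?c) \<le> 23 ^ (?a * ?k) * poly p ?N" by linarith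
    have "wp prog [enc_instance I] (Call f_main [Var 0])
        (\<lambda>t v. t = Suc (1 + ?c) \<and> v = bool_tree (simfvs I))"
      using main_spec[of I] solve_iff_simfvs(1)[OF I] by simp
    then have "runs prog (enc_instance I) (Suc (1 + ?c)) (bool_tree (simfvs I))"
      unfolding wp_def runs_def f_main_def by blast
    then show "\<exists>t \<le> 23 ^ (?a * ?k) * poly p ?N. runs prog (enc_instance I) t (bool_tree (simfvs I))"
      using t by blast
  qed
  then show ?thesis unfolding solvable_in_Ostar_def by blast
qed

end
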